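(* Let $-1<p<1$, $p\neq 0$, and let $L$ be an infinitely smooth origin-symmetric strictly convex body in $\mathbb{R}^n$ for which $(\mathbb{R}^n,\|\cdot\|_L)$ does not embed in $L_p$. Then there exists an origin-symmetric convex body $K$ in $\mathbb{R}^n$ such that $$\Gamma^*_pK\subset\Gamma^*_pL,$$ but $$\mathrm{vol}(L)>\mathrm{vol}(K).$$
   Context: A convex body is a compact convex set with non-empty interior in $\mathbb{R}^n$; $\mathrm{vol}$ denotes $n$-dimensional Lebesgue measure, and $(x,\xi)$ is the standard inner product. The Minkowski functional of an origin-symmetric star body (in particular, of an origin-symmetric convex body) $K$ is $\|x\|_K=\min\{a\ge 0: x\in aK\}$. A body $K$ is infinitely smooth if $\|\cdot\|_K$ is $C^\infty$ on $\mathbb{R}^n\setminus\{0\}$. Polar $p$-centroid body: for $p>-1$, $p\ne 0$, the polar $p$-centroid body $\Gamma^*_pK$ of $K$ is the (possibly non-convex) body $\Gamma_p^*K=\{\xi:\|\xi\|_{\Gamma^*_pK}\le 1\}$ whose Minkowski functional is $$\|\xi\|_{\Gamma^*_p K}=\left(\frac{1}{\mathrm{vol}(K)}\int_K|(x,\xi)|^p\,dx\right)^{1/p},\quad \xi\in\mathbb{R}^n\setminus\{0\}.$$ Embedding in $L_p$: for $p>-1$, $p\neq0$, the space $(\mathbb{R}^n,\|\cdot\|)$ embeds in $L_p$ if there exists a finite (non-negative) Borel measure $\mu$ on the unit sphere $S^{n-1}$ such that for every $x\in\mathbb{R}^n\setminus\{0\}$, $\|x\|^p=\int_{S^{n-1}}|(x,\xi)|^p\,d\mu(\xi)$.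 *)

theory Defs
  imports "HOL-Analysis.Analysis"
begin

definition convex_body :: "'a::euclidean_space set \<Rightarrow> bool" where
  "convex_body K \<longleftrightarrow> compact K \<and> convex K \<and> interior K \<noteq> {}"

definition origin_symmetric :: "'a::real_vector set \<Rightarrow> bool" where
  "origin_symmetric K \<longleftrightarrow> uminus ` K = K"

definition strictly_convex :: "'a::euclidean_space set \<Rightarrow> bool" where
  "strictly_convex K \<longleftrightarrow>
     (\<forall>x\<in>K. \<forall>y\<in>K. x \<noteq> y \<longrightarrow> open_segment x y \<subseteq> interior K)"

text \<open>For an origin-symmetric convex body (more generally, a star body) the infimum is a minimum.\<close>

definition minkowski_functional :: "'a::euclidean_space set \<Rightarrow> 'a \<Rightarrow> real" where
  "minkowski_functional K x = Inf {a. 0 \<le> a \<and> x \<in> (\<lambda>y. a *\<^sub>R y) ` K}"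

text \<open>Being of class \<open>C\<^sup>k\<close> on an open set \<open>S\<close>, via iterated partial derivatives.\<close>

primrec Ck_on :: "nat \<Rightarrow> ('a::euclidean_space \<Rightarrow> real) \<Rightarrow> 'a set \<Rightarrow> bool" where
  "Ck_on 0 f S \<longleftrightarrow> continuous_on S f"
| "Ck_on (Suc k) f S \<longleftrightarrow>
     (\<forall>x\<in>S. f differentiable (at x)) \<and>
     (\<forall>b\<in>Basis. Ck_on k (\<lambda>x. frechet_derivative f (at x) b) S)"

definition infinitely_smooth :: "'a::euclidean_space set \<Rightarrow> bool" where
  "infinitely_smooth K \<longleftrightarrow> (\<forall>k. Ck_on k (minkowski_functional K) (UNIV - {0}))"

text \<open>For \<open>p < 0\<close> the integrand is \<open>+\<infinity>\<close> on the hyperplane orthogonal to \<open>\<xi>\<close>, where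
  \<^const>\<open>powr\<close> yields \<open>0\<close>; for a body \<open>K\<close> this does not affect the integral, since the
  hyperplane is Lebesgue-null when \<open>\<xi> \<noteq> 0\<close>.\<close>

definition polar_centroid_functional ::
    "real \<Rightarrow> 'a::euclidean_space set \<Rightarrow> 'a \<Rightarrow> real" where
  "polar_centroid_functional p K \<xi> =
     (if \<xi> = 0 then 0
      else (1 / measure lborel K * (LINT x:K|lborel. \<bar>x \<bullet> \<xi>\<bar> powr p)) powr (1 / p))"

definition polar_centroid_body ::
    "real \<Rightarrow> 'a::euclidean_space set \<Rightarrow> 'a set" where
  "polar_centroid_body p K = {\<xi>. polar_centroid_functional p K \<xi> \<le> 1}"

text \<open>The function \<open>|t|\<^sup>p\<close> with its true value \<open>+\<infinity>\<close> at \<open>t = 0\<close> when \<open>p < 0\<close>.  Here the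
  convention \<open>0 powr p = 0\<close> would matter, because the measure below may charge great subspheres.\<close>

definition abs_powr :: "real \<Rightarrow> real \<Rightarrow> ennreal" where
  "abs_powr p t = (if t = 0 \<and> p < 0 then \<infinity> else ennreal (\<bar>t\<bar> powr p))"

text \<open>\<open>N\<close> is the norm-like functional (positive off the origin) of the space.\<close>

definition embeds_in_Lp :: "real \<Rightarrow> ('a::euclidean_space \<Rightarrow> real) \<Rightarrow> bool" where
  "embeds_in_Lp p N \<longleftrightarrow>
     (\<exists>\<mu> :: 'a measure.
        finite_measure \<mu> \<and> sets \<mu> = sets (restrict_space borel (sphere 0 1)) \<and>
        (\<forall>x. x \<noteq> 0 \<longrightarrow> ennreal (N x powr p) = (\<integral>\<^sup>+ \<xi>. abs_powr p (x \<bullet> \<xi>) \<partial>\<mu>)))"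

end

theory Submission
  imports Defs "HOL-Probability.Probability"
begin

text \<open>Write \<open>N\<close> for the norm with unit ball \<open>L\<close> and \<open>n\<close> for the dimension. If \<open>N\<^sup>p\<close> is not a
  superposition of the functions \<open>|(x,\<xi>)|\<^sup>p\<close>, a separation argument yields an even function \<open>h\<close>,
  homogeneous of degree \<open>0\<close>, with \<open>\<integral>\<^sub>L |(x,\<xi>)|\<^sup>p h \<ge> \<kappa> \<integral>\<^sub>L |(x,\<xi>)|\<^sup>p\<close> for all \<open>\<xi>\<close> and some \<open>\<kappa> > 0\<close>,
  but \<open>\<integral>\<^sub>L N\<^sup>p h < 0\<close>. Strict convexity of \<open>N\<close> alone makes the differences \<open>M - t N\<close> of seminorms and
  multiples of \<open>N\<close> uniformly dense in the even functions, so the perturbation of \<open>N\<close> in the direction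
  \<open>- sgn p \<cdot> h N\<close> can be carried out through norms. To first order it changes
  \<open>\<integral>\<^sub>K |(x,\<xi>)|\<^sup>p\<close> by \<open>(n + p) sgn p \<integral>\<^sub>L |(x,\<xi>)|\<^sup>p h\<close> and the volume by \<open>(n + p) sgn p \<integral>\<^sub>L N\<^sup>p h\<close>. For \<open>p > 0\<close>
  the perturbed body is the required \<open>K\<close>; for \<open>p < 0\<close> its volume has grown, and it is shrunk until
  the volume is slightly below that of \<open>L\<close>.\<close>

section \<open>Separation from a closed convex cone\<close>

text \<open>The separation takes place in a sequence space: \<open>N^p\<close> and every kernel
  \<open>|(x,v)|^p\<close> are represented by their integrals over \<open>L\<close> against
  countably many test functions, and a measure on the sphere is sought as a multiple of the image of
  a probability law on the real line under a continuous curve meeting every line through the origin.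
  Compactness is then Helly selection for finitely supported laws on [0,1]. For p < 0 the kernel is
  unbounded. Continuity of its integrals in v then needs a uniform truncation estimate, and equal
  test integrals identify the potential of the measure with \<open>N^p\<close> only almost
  everywhere, whereas an embedding demands equality at every nonzero point. The strict gap \<kappa>
  makes the perturbation robust: errors up to a fixed fraction of the first-order gain are harmless,
  so uniform approximation of \<open>h\<close> suffices and no derivative of the approximating norm
  has to be controlled. The centroid functional is an average raised to the power 1/p. It has to
  increase, so the average must rise for p > 0 and drop for p < 0; this is the source of the factor
  sgn p.\<close>

lemma real_distribution_pmf: "real_distribution (distr (measure_pmf (P :: real pmf)) borel (\<lambda>x. x))"
proof -
  interpret prob_space "distr (measure_pmf P) borel (\<lambda>x. x)"
    by (rule prob_space.prob_space_distr[OF prob_space_measure_pmf]) auto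
  show ?thesis
    by unfold_locales auto
qed

text \<open>Laws carried by one compact interval are tight, so Helly selection applies; weak
  convergence is restated through expectations of bounded continuous functions, the form in which
  the limit is used.\<close>

lemma pmf_weak_subsequence:
  fixes P :: "nat \<Rightarrow> real pmf"
  assumes "\<And>k. set_pmf (P k) \<subseteq> {0..1}"
  obtains r Q where "strict_mono (r :: nat \<Rightarrow> nat)" "real_distribution Q"
    "\<And>(f :: real \<Rightarrow> real) B. (\<And>x. isCont f x) \<Longrightarrow> (\<And>x. \<bar>f x\<bar> \<le> B) \<Longrightarrow>
       (\<lambda>k. measure_pmf.expectation (P (r k)) f) \<longlonglongrightarrow> integral\<^sup>L Q f"
proof -
  define \<mu> where "\<mu> k = distr (measure_pmf (P k)) borel (\<lambda>x. x)" for k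
  have rd: "real_distribution (\<mu> k)" for k
    unfolding \<mu>_def by (rule real_distribution_pmf)
  \<comment> \<open>Tightness is phrased with intervals open on the left, so the interval has to
    begin strictly below 0.\<close>
  have "measure (\<mu> k) {-1<..1} = 1" for k
  proof -
    have "measure (\<mu> k) {-1<..1} = measure (measure_pmf (P k)) {-1<..1}"
      unfolding \<mu>_def by (subst measure_distr) auto
    also have "\<dots> = 1"
      using assms[of k] by (subst measure_pmf.prob_eq_1) (auto simp: AE_measure_pmf_iff)
    finally show ?thesis .
  qed
  then have "tight \<mu>"
    unfolding tight_def using rd by (intro conjI allI impI exI[of _ "-1::real"] exI[of _ "1::real"]) auto
  then obtain r Q where rQ: "strict_mono (r :: nat \<Rightarrow> nat)" "real_distribution Q" "weak_conv_m (\<mu> \<circ> id \<circ> r) Q"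
    using tight_imp_convergent_subsubsequence[of \<mu> id] by (auto simp: strict_mono_id)
  have "(\<lambda>k. measure_pmf.expectation (P (r k)) f) \<longlonglongrightarrow> integral\<^sup>L Q f"
    if f: "\<And>x. isCont f x" "\<And>x. \<bar>f x\<bar> \<le> B" for f :: "real \<Rightarrow> real" and B
  proof -
    have fm: "f \<in> borel_measurable borel"
      using f(1) by (intro borel_measurable_continuous_onI) (simp add: continuous_at_imp_continuous_on)
    have "(\<lambda>k. integral\<^sup>L ((\<mu> \<circ> id \<circ> r) k) f) \<longlonglongrightarrow> integral\<^sup>L Q f"
      by (rule weak_conv_imp_integral_bdd_continuous_conv[where B=B])
        (use rQ rd f in \<open>auto simp: o_def\<close>)
    moreover have "integral\<^sup>L ((\<mu> \<circ> id \<circ> r) k) f = measure_pmf.expectation (P (r k)) f" for k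
      unfolding \<mu>_def o_def id_def by (subst integral_distr) (auto simp: fm)
    ultimately show ?thesis by simp
  qed
  with rQ that show ?thesis by blast
qed

text \<open>Normalises the sum of \<open>m\<close> times the law \<open>P\<close> and a mass
  \<open>s\<close> at \<open>t\<close>. It shows that the cone of multiples of finitely supported
  laws is closed under adding a point mass, one of the two directions in which a minimiser over the
  cone is varied.\<close>

lemma finite_pmf_mixture:
  fixes P :: "'a pmf"
  assumes "finite (set_pmf P)" "0 \<le> m" "0 \<le> s"
  obtains P' where "finite (set_pmf P')" "set_pmf P' \<subseteq> insert t (set_pmf P)"
    "\<And>f :: 'a \<Rightarrow> real. (m + s) * measure_pmf.expectation P' f = m * measure_pmf.expectation P f + s * f t"
proof (cases "m + s = 0")
  case True
  then have "m = 0" "s = 0" using assms by auto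
  then show ?thesis using that[of P] assms by auto
next
  case False
  define q where "q = s / (m + s)"
  have q: "0 \<le> q" "q \<le> 1" "(m + s) * q = s" "(m + s) * (1 - q) = m"
    using False assms by (auto simp: q_def field_simps)
  define P' where "P' = bind_pmf (bernoulli_pmf q) (\<lambda>b. if b then return_pmf t else P)"
  have fin: "finite (set_pmf (if b then return_pmf t else P))" for b using assms by auto
  have "(m + s) * measure_pmf.expectation P' f = m * measure_pmf.expectation P f + s * f t"
    for f :: "'a \<Rightarrow> real"
  proof -
    have "measure_pmf.expectation P' f =
        (\<Sum>a\<in>UNIV. pmf (bernoulli_pmf q) a *\<^sub>R measure_pmf.expectation (if a then return_pmf t else P) f)"
      unfolding P'_def by (rule pmf_expectation_bind) (use fin in auto)
    also have "\<dots> = (1 - q) * measure_pmf.expectation P f + q * f t"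
      using q by (simp add: UNIV_bool)
    finally have "(m + s) * measure_pmf.expectation P' f =
        (m + s) * ((1 - q) * measure_pmf.expectation P f + q * f t)" by simp
    also have "\<dots> = ((m + s) * (1 - q)) * measure_pmf.expectation P f + ((m + s) * q) * f t"
      by (simp only: distrib_left mult.assoc)
    finally show ?thesis using q by simp
  qed
  moreover have "set_pmf P' \<subseteq> insert t (set_pmf P)" by (auto simp: P'_def split: if_splits)
  moreover from this have "finite (set_pmf P')" using assms finite_subset by auto
  ultimately show ?thesis using that by blast
qed

text \<open>The first-order condition at a minimum: for small \<open>s\<close> a negative linear
  term would outweigh the quadratic one.\<close>

lemma nonneg_slope:
  fixes A D :: real
  assumes "\<And>s. 0 < s \<Longrightarrow> s \<le> 1 \<Longrightarrow> 0 \<le> 2 * s * A + s\<^sup>2 * D"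
  shows "0 \<le> A"
proof (rule ccontr)
  assume "\<not> 0 \<le> A"
  define s where "s = min 1 (- A / (\<bar>D\<bar> + 1))"
  have s: "0 < s" "s \<le> 1" using \<open>\<not> 0 \<le> A\<close> by (auto simp: s_def divide_neg_pos)
  have "s * (\<bar>D\<bar> + 1) \<le> - A" using mult_right_mono[of s "- A / (\<bar>D\<bar> + 1)" "\<bar>D\<bar> + 1"] by (simp add: s_def)
  then have "s * D \<le> - A" using s by (smt (verit) abs_ge_self mult_left_mono)
  then have "2 * A + s * D < 0" using \<open>\<not> 0 \<le> A\<close> by simp
  then have "s * (2 * A + s * D) < 0" using s by (simp add: mult_pos_neg)
  then show False using assms[OF s] by (simp add: algebra_simps power2_eq_square)
qed

text \<open>The closed convex cone generated by a curve is separated from a point by minimising a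
  weighted \<open>\<ell>\<^sup>2\<close>-distance over the cone: the residual of the minimiser is the separating functional.\<close>

theorem cone_alternative:
  fixes T :: "nat \<Rightarrow> real \<Rightarrow> real" and w :: "nat \<Rightarrow> real"
  assumes cont: "\<And>i t. isCont (T i) t"
    and dom: "\<And>i t. \<bar>T i t\<bar> \<le> T 0 t" and up: "\<And>t. T 0 t \<le> B"
    and low: "\<And>t. c \<le> T 0 t" and c: "0 < c" and w: "\<And>i. \<bar>w i\<bar> \<le> w 0"
  shows "(\<exists>m Q. 0 \<le> m \<and> real_distribution Q \<and> (\<forall>i. w i = m * integral\<^sup>L Q (T i))) \<or>
    (\<exists>k a \<kappa>. 0 < \<kappa> \<and> (\<forall>t\<in>{0..1}. \<kappa> * T 0 t \<le> (\<Sum>i<k. a i * T i t)) \<and> (\<Sum>i<k. a i * w i) < 0)"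
proof -
  define Z where "Z = {(m :: real, P :: real pmf). 0 \<le> m \<and> finite (set_pmf P) \<and> set_pmf P \<subseteq> {0..1}}"
  define V where "V = (\<lambda>(m, P) i. m * measure_pmf.expectation P (T i) :: real)"
  \<comment> \<open>The geometric weights make the sum converge on bounded sequences and allow
    limits to be taken coordinatewise.\<close>
  define \<Phi> where "\<Phi> v = (\<Sum>i. (1/2)^i * (v i - w i)\<^sup>2)" for v :: "nat \<Rightarrow> real"
  have w0: "0 \<le> w 0" using w[of 0] by simp
  have B0: "0 < B" using c low[of 0] up[of 0] by linarith
  have TB: "\<bar>T i t\<bar> \<le> B" for i t using dom up order_trans by blast
  have summ: "summable (\<lambda>i. (1/2)^i * (f i * g i))"
    if "\<And>i. \<bar>f i\<bar> \<le> F" "\<And>i. \<bar>g i\<bar> \<le> G" for f g :: "nat \<Rightarrow> real" and F G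
  proof (rule summable_comparison_test'[where g="\<lambda>i. (1/2)^i * (F * G)" and N=0])
    show "summable (\<lambda>i. (1/2)^i * (F * G))"
      by (intro summable_mult2 summable_geometric) simp
    show "norm ((1/2)^n * (f n * g n)) \<le> (1/2)^n * (F * G)" for n
      using that[of n] by (auto simp: abs_mult intro!: mult_mono order_trans[OF abs_ge_zero])
  qed
  have bnd: "\<bar>v i - w i\<bar> \<le> C + w 0" if "\<And>i. \<bar>v i\<bar> \<le> C" for v :: "nat \<Rightarrow> real" and C i
    using that[of i] w[of i] by linarith
  have VB: "\<bar>V (m, P) i\<bar> \<le> m * B" "V (m, P) 0 \<ge> m * c" if "(m, P) \<in> Z" for m P i
  proof -
    have fin: "finite (set_pmf P)" and m: "0 \<le> m" using that by (auto simp: Z_def)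
    have int: "integrable (measure_pmf P) f" for f :: "real \<Rightarrow> real"
      by (rule integrable_measure_pmf_finite[OF fin])
    have "\<bar>measure_pmf.expectation P (T i)\<bar> \<le> measure_pmf.expectation P (\<lambda>t. \<bar>T i t\<bar>)"
      by (rule integral_abs_bound)
    also have "\<dots> \<le> B" by (intro measure_pmf.integral_le_const int) (auto simp: TB)
    finally show "\<bar>V (m, P) i\<bar> \<le> m * B" using m by (simp add: V_def abs_mult mult_left_mono)
    have "c \<le> measure_pmf.expectation P (T 0)"
      by (intro measure_pmf.integral_ge_const int) (auto simp: low)
    then show "V (m, P) 0 \<ge> m * c" using m by (simp add: V_def mult_left_mono)
  qed
  have summ2: "summable (\<lambda>i. (1/2)^i * (v i - w i)\<^sup>2)" if "\<And>i. \<bar>v i\<bar> \<le> C" for v :: "nat \<Rightarrow> real" and C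
    using summ[OF bnd[OF that] bnd[OF that]] by (simp add: power2_eq_square)
  have \<Phi>_nonneg: "0 \<le> \<Phi> v" if "\<And>i. \<bar>v i\<bar> \<le> C" for v C
    unfolding \<Phi>_def by (intro suminf_nonneg summ2[OF that]) auto
  have \<Phi>_ge: "(v 0 - w 0)\<^sup>2 \<le> \<Phi> v" if "\<And>i. \<bar>v i\<bar> \<le> C" for v C
    using sum_le_suminf[OF summ2[OF that], of "{0}"] by (simp add: \<Phi>_def)
  define I where "I = (INF z\<in>Z. \<Phi> (V z))"
  have Zne: "(0, return_pmf 0) \<in> Z" by (simp add: Z_def)
  have bdd: "bdd_below ((\<lambda>z. \<Phi> (V z)) ` Z)"
  proof (rule bdd_belowI2)
    fix z assume "z \<in> Z"
    then show "0 \<le> \<Phi> (V z)" using VB(1) by (cases z) (blast intro: \<Phi>_nonneg)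
  qed
  have I_le: "I \<le> \<Phi> (V z)" if "z \<in> Z" for z
    unfolding I_def by (rule cINF_lower[OF bdd that])
  have "\<exists>z\<in>Z. \<Phi> (V z) < I + 1 / (real k + 1)" for k
    using cINF_less_iff[OF _ bdd, of "I + 1 / (real k + 1)"] Zne by (auto simp: I_def)
  then obtain z where z: "\<And>k. z k \<in> Z" "\<And>k. \<Phi> (V (z k)) < I + 1 / (real k + 1)" by metis
  define m where "m k = fst (z k)" for k
  define P where "P k = snd (z k)" for k
  have zmP: "z k = (m k, P k)" for k by (simp add: m_def P_def)
  have m0: "0 \<le> m k" and P01: "set_pmf (P k) \<subseteq> {0..1}" and Pfin: "finite (set_pmf (P k))" for k
    using z(1)[of k] by (auto simp: zmP Z_def)
  define R where "R = (w 0 + sqrt (I + 1)) / c"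
  \<comment> \<open>A near-minimiser has a bounded coordinate 0, and that coordinate is at least
    \<open>m k * c\<close>. The positive lower bound on \<open>T 0\<close> thus confines the masses
    to a compact interval.\<close>
  have mR: "m k \<le> R" for k
  proof -
    have "(V (z k) 0 - w 0)\<^sup>2 \<le> \<Phi> (V (z k))"
      by (rule \<Phi>_ge[of _ "m k * B"]) (use VB(1) z(1)[of k] zmP in auto)
    also have "\<dots> \<le> I + 1" using z(2)[of k] by (smt (verit) divide_le_eq_1 of_nat_0_le_iff)
    finally have "V (z k) 0 - w 0 \<le> sqrt (I + 1)" by (simp add: real_le_rsqrt)
    moreover have "m k * c \<le> V (z k) 0" using VB(2) z(1)[of k] zmP by simp
    ultimately show ?thesis using c by (simp add: R_def pos_le_divide_eq)
  qed
  obtain r1 Q where r1: "strict_mono (r1 :: nat \<Rightarrow> nat)" and Q: "real_distribution Q"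
    and conv1: "\<And>(f :: real \<Rightarrow> real) B. (\<And>x. isCont f x) \<Longrightarrow> (\<And>x. \<bar>f x\<bar> \<le> B) \<Longrightarrow>
       (\<lambda>k. measure_pmf.expectation (P (r1 k)) f) \<longlonglongrightarrow> integral\<^sup>L Q f"
    using pmf_weak_subsequence[of P] P01 by blast
  have "\<forall>k. (m \<circ> r1) k \<in> {0..R}" using m0 mR by auto
  then obtain m' r2 where m': "m' \<in> {0..R}" "strict_mono (r2 :: nat \<Rightarrow> nat)" "((m \<circ> r1) \<circ> r2) \<longlonglongrightarrow> m'"
    using compact_imp_seq_compact[OF compact_Icc, of 0 R] unfolding seq_compact_def by blast
  define r where "r = r1 \<circ> r2"
  have r: "strict_mono r" unfolding r_def using r1 m'(2) by (rule strict_mono_o)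
  define v where "v i = m' * integral\<^sup>L Q (T i)" for i
  have Vlim: "(\<lambda>k. V (z (r k)) i) \<longlonglongrightarrow> v i" for i
  proof -
    have "(\<lambda>k. measure_pmf.expectation (P (r1 k)) (T i)) \<longlonglongrightarrow> integral\<^sup>L Q (T i)"
      by (rule conv1[OF cont TB])
    from LIMSEQ_subseq_LIMSEQ[OF this m'(2)] m'(3) show ?thesis
      unfolding v_def V_def zmP by (auto simp: o_def r_def intro!: tendsto_mult)
  qed
  have VRB: "\<bar>V (z k) i\<bar> \<le> R * B" for k i
    using VB(1)[of "m k" "P k" i] z(1)[of k] zmP mR[of k] B0
    by (smt (verit) mult_right_mono)
  have vRB: "\<bar>v i\<bar> \<le> R * B" for i
    using tendsto_rabs[OF Vlim] by (rule LIMSEQ_le_const2) (use VRB in auto)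
  have \<Phi>_lim: "(\<lambda>k. \<Phi> (\<lambda>i. x * V (z (r k)) i + d i)) \<longlonglongrightarrow> \<Phi> (\<lambda>i. x * v i + d i)"
    if d: "\<And>i. \<bar>d i\<bar> \<le> D" for x d D
  proof -
    let ?C = "\<bar>x\<bar> * (R * B) + D + w 0"
    show ?thesis
      unfolding \<Phi>_def
    proof (rule tannerys_theorem[where M="\<lambda>i. (1/2)^i * (?C * ?C)", THEN conjunct2, THEN conjunct2])
      show "summable (\<lambda>i. (1/2::real)^i * (?C * ?C))"
        by (intro summable_mult2 summable_geometric) simp
      show "\<forall>\<^sub>F (i, k) in at_top \<times>\<^sub>F sequentially. norm ((1/2)^i * (x * V (z (r k)) i + d i - w i)\<^sup>2)
          \<le> (1/2::real)^i * (?C * ?C)"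
      proof (rule always_eventually, clarify)
        fix i k
        have "\<bar>x * V (z (r k)) i\<bar> \<le> \<bar>x\<bar> * (R * B)"
          using VRB[of "r k" i] by (simp add: abs_mult mult_left_mono)
        then have "\<bar>x * V (z (r k)) i + d i - w i\<bar> \<le> ?C"
          using d[of i] w[of i] by linarith
        then have "\<bar>x * V (z (r k)) i + d i - w i\<bar> * \<bar>x * V (z (r k)) i + d i - w i\<bar>
            \<le> ?C * ?C"
          by (intro mult_mono) auto
        then show "norm ((1/2)^i * (x * V (z (r k)) i + d i - w i)\<^sup>2)
          \<le> (1/2::real)^i * (?C * ?C)"
          by (simp add: abs_mult power2_eq_square)
      qed
      show "(\<lambda>k. (1/2)^i * (x * V (z (r k)) i + d i - w i)\<^sup>2) \<longlonglongrightarrow> (1/2)^i * (x * v i + d i - w i)\<^sup>2" for i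
        by (intro tendsto_intros Vlim)
    qed auto
  qed
  have \<Phi>_min: "\<Phi> v \<le> I"
  proof (rule LIMSEQ_le)
    show "(\<lambda>k. \<Phi> (V (z (r k)))) \<longlonglongrightarrow> \<Phi> v" using \<Phi>_lim[of "\<lambda>_. 0" 0 1] by simp
    show "(\<lambda>k. I + 1 / (real (r k) + 1)) \<longlonglongrightarrow> I"
    proof -
      have "(\<lambda>k. I + inverse (real (Suc k))) \<longlonglongrightarrow> I + 0"
        by (intro tendsto_add tendsto_const LIMSEQ_inverse_real_of_nat)
      from LIMSEQ_subseq_LIMSEQ[OF this r] show ?thesis by (simp add: o_def inverse_eq_divide add.commute)
    qed
  qed (use z(2) less_imp_le in blast)
  \<comment> \<open>\<open>v\<close> is only a limit of points of the cone, so the mass at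
    \<open>t\<close> is added to the approximating points and the inequality is carried to the
    limit. The same is done for \<open>scale\<close>.\<close>
  have add: "I \<le> \<Phi> (\<lambda>i. v i + s * T i t)" if s0: "0 \<le> s" and t01: "t \<in> {0..1}" for s t
  proof (rule LIMSEQ_le_const)
    show "(\<lambda>k. \<Phi> (\<lambda>i. V (z (r k)) i + s * T i t)) \<longlonglongrightarrow> \<Phi> (\<lambda>i. v i + s * T i t)"
      using \<Phi>_lim[of "\<lambda>i. s * T i t" "s * B" 1] s0 TB by (simp add: abs_mult mult_left_mono)
    have "I \<le> \<Phi> (\<lambda>i. V (z k) i + s * T i t)" for k
    proof -
      obtain P' where P': "finite (set_pmf P')" "set_pmf P' \<subseteq> insert t (set_pmf (P k))"
        "\<And>f :: real \<Rightarrow> real. (m k + s) * measure_pmf.expectation P' f = m k * measure_pmf.expectation (P k) f + s * f t"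
        using finite_pmf_mixture[OF Pfin m0 s0] by metis
      have "(m k + s, P') \<in> Z" using P' P01[of k] m0[of k] s0 t01 by (auto simp: Z_def)
      from I_le[OF this] show ?thesis using P'(3) by (simp add: V_def zmP)
    qed
    then show "\<exists>N. \<forall>n\<ge>N. I \<le> \<Phi> (\<lambda>i. V (z (r n)) i + s * T i t)" by blast
  qed
  have scale: "I \<le> \<Phi> (\<lambda>i. x * v i)" if "0 \<le> x" for x
  proof (rule LIMSEQ_le_const)
    show "(\<lambda>k. \<Phi> (\<lambda>i. x * V (z (r k)) i)) \<longlonglongrightarrow> \<Phi> (\<lambda>i. x * v i)"
      using \<Phi>_lim[of "\<lambda>_. 0" 0 x] by simp
    have "I \<le> \<Phi> (\<lambda>i. x * V (z k) i)" for k
      using I_le[of "(x * m k, P k)"] that m0 P01 Pfin by (simp add: V_def zmP Z_def mult.assoc)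
    then show "\<exists>N. \<forall>n\<ge>N. I \<le> \<Phi> (\<lambda>i. x * V (z (r n)) i)" by blast
  qed
  \<comment> \<open>Half the gradient of \<open>\<Phi>\<close> at \<open>v\<close>, that is, the
    residual seen through the weighted inner product.\<close>
  define a where "a i = (1/2)^i * (v i - w i)" for i
  define U where "U = R * B + w 0"
  have vw: "\<bar>v i - w i\<bar> \<le> U" for i unfolding U_def by (rule bnd[OF vRB])
  have suma: "summable (\<lambda>i. a i * g i)" if "\<And>i. \<bar>g i\<bar> \<le> G" for g G
    using summ[OF vw that] by (simp add: a_def mult.assoc)
  have deriv: "0 \<le> (\<Sum>i. a i * d i)"
    if d: "\<And>i. \<bar>d i\<bar> \<le> D" and ge: "\<And>s. 0 < s \<Longrightarrow> s \<le> 1 \<Longrightarrow> I \<le> \<Phi> (\<lambda>i. v i + s * d i)" for d D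
  proof (rule nonneg_slope)
    fix s :: real assume s: "0 < s" "s \<le> 1"
    have S: "(\<lambda>i. (1/2)^i * (v i - w i)\<^sup>2) sums \<Phi> v"
      unfolding \<Phi>_def using summ2[OF vRB] by (rule summable_sums)
    have S1: "(\<lambda>i. a i * d i) sums (\<Sum>i. a i * d i)"
      using suma[OF d] by (rule summable_sums)
    have S2: "(\<lambda>i. (1/2)^i * (d i * d i)) sums (\<Sum>i. (1/2)^i * (d i * d i))"
      using summ[OF d d] by (rule summable_sums)
    have "(\<lambda>i. (1/2)^i * (v i - w i)\<^sup>2 + (2 * s) * (a i * d i) + s\<^sup>2 * ((1/2)^i * (d i * d i)))
        sums (\<Phi> v + (2 * s) * (\<Sum>i. a i * d i) + s\<^sup>2 * (\<Sum>i. (1/2)^i * (d i * d i)))"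
      by (intro sums_add sums_mult S S1 S2)
    also have "(\<lambda>i. (1/2)^i * (v i - w i)\<^sup>2 + (2 * s) * (a i * d i) + s\<^sup>2 * ((1/2)^i * (d i * d i)))
       = (\<lambda>i. (1/2)^i * (v i + s * d i - w i)\<^sup>2)"
      by (rule ext) (simp add: a_def algebra_simps power2_eq_square)
    finally have "\<Phi> (\<lambda>i. v i + s * d i) = \<Phi> v + (2 * s) * (\<Sum>i. a i * d i) + s\<^sup>2 * (\<Sum>i. (1/2)^i * (d i * d i))"
      unfolding \<Phi>_def by (rule sums_unique[symmetric])
    then show "0 \<le> 2 * s * (\<Sum>i. a i * d i) + s\<^sup>2 * (\<Sum>i. (1/2)^i * (d i * d i))"
      using ge[OF s] \<Phi>_min by linarith
  qed
  have aT: "0 \<le> (\<Sum>i. a i * T i t)" if "t \<in> {0..1}" for t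
    by (rule deriv[OF TB]) (use add that in auto)
  \<comment> \<open>In a cone, scaling up and scaling down are both admissible variations, so the
    residual is orthogonal to the minimiser.\<close>
  have av: "(\<Sum>i. a i * v i) = 0"
  proof (rule antisym)
    show "0 \<le> (\<Sum>i. a i * v i)"
      by (rule deriv[OF vRB]) (use scale[of "1 + _"] in \<open>auto simp: algebra_simps\<close>)
    have "0 \<le> (\<Sum>i. a i * (- v i))"
    proof (rule deriv[of _ "R * B"])
      show "I \<le> \<Phi> (\<lambda>i. v i + s * - v i)" if "0 < s" "s \<le> 1" for s
        using scale[of "1 - s"] that by (auto simp: algebra_simps)
    qed (use vRB in auto)
    then show "(\<Sum>i. a i * v i) \<le> 0" by (simp add: suminf_minus suma[OF vRB])
  qed
  show ?thesis
  proof (cases "\<forall>i. v i = w i")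
    case True
    then show ?thesis using Q m'(1) by (intro disjI1 exI[of _ m'] exI[of _ Q]) (auto simp: v_def)
  next
    case False
    then obtain j where j: "v j \<noteq> w j" by blast
    define \<rho> where "\<rho> = \<Phi> v"
    have "0 < (1/2)^j * (v j - w j)\<^sup>2" using j by simp
    also have "\<dots> \<le> \<rho>" unfolding \<rho>_def \<Phi>_def
      using sum_le_suminf[OF summ2[OF vRB], of "{j}"] by simp
    finally have \<rho>: "0 < \<rho>" .
    have aw: "(\<Sum>i. a i * w i) = - \<rho>"
    proof -
      have "(\<Sum>i. a i * v i) - (\<Sum>i. a i * w i) = (\<Sum>i. a i * v i - a i * w i)"
        by (intro suminf_diff suma[OF vRB] suma[OF w])
      also have "\<dots> = \<rho>" unfolding \<rho>_def \<Phi>_def a_def by (simp add: algebra_simps power2_eq_square)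
      finally show ?thesis using av by simp
    qed
    \<comment> \<open>Cutting the series to finitely many terms costs at most
      \<open>\<delta> / 2 * T 0 t\<close>; raising the coefficient of \<open>T 0\<close> by
      \<open>\<delta>\<close> repays this and leaves \<kappa> = \<open>\<delta> / 2\<close>. On
      \<open>w\<close> the two changes together cost at most \<open>3 / 2 * \<delta> * w 0\<close>,
      well below \<open>\<rho>\<close>.\<close>
    define \<delta> where "\<delta> = \<rho> / (4 * (w 0 + 1))"
    have \<delta>: "0 < \<delta>" "\<delta> * w 0 \<le> \<rho> / 4"
      using \<rho> w0 by (auto simp: \<delta>_def field_simps)
    have suma1: "summable (\<lambda>i. \<bar>a i\<bar>)"
      using summ[of "\<lambda>i. \<bar>v i - w i\<bar>" U "\<lambda>_. 1" 1] vw by (simp add: a_def abs_mult)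
    from suminf_exist_split[of "\<delta> / 2", OF _ this] obtain k0
      where k0: "\<And>n. n \<ge> k0 \<Longrightarrow> norm (\<Sum>i. \<bar>a (i + n)\<bar>) < \<delta> / 2" using \<delta> by auto
    \<comment> \<open>The successor ensures that index 0, whose coefficient is raised, is among the
      terms kept.\<close>
    define k where "k = Suc k0"
    have tail: "(\<Sum>i. \<bar>a (i + k)\<bar>) \<le> \<delta> / 2" using k0[of k] by (simp add: k_def)
    have split: "\<bar>(\<Sum>i. a i * g i) - (\<Sum>i<k. a i * g i)\<bar> \<le> \<delta> / 2 * G" if g: "\<And>i. \<bar>g i\<bar> \<le> G" for g G
    proof -
      have G0: "0 \<le> G" using g[of 0] by linarith
      have sk: "summable (\<lambda>i. \<bar>a (i + k)\<bar>)" using suma1 by (subst summable_iff_shift)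
      have sk2: "summable (\<lambda>i. norm (a (i + k) * g (i + k)))"
        by (rule summable_comparison_test'[where g="\<lambda>i. \<bar>a (i + k)\<bar> * G" and N=0])
          (use g in \<open>auto simp: abs_mult intro!: summable_mult2 sk mult_left_mono\<close>)
      have "(\<Sum>i. a i * g i) - (\<Sum>i<k. a i * g i) = (\<Sum>i. a (i + k) * g (i + k))"
        using suminf_split_initial_segment[OF suma[OF g], where k=k] by simp
      also have "\<bar>\<dots>\<bar> \<le> (\<Sum>i. norm (a (i + k) * g (i + k)))"
        using summable_norm[OF sk2] by simp
      also have "\<dots> \<le> (\<Sum>i. \<bar>a (i + k)\<bar> * G)"
        by (rule suminf_le[OF _ sk2 summable_mult2[OF sk]]) (use g in \<open>auto simp: abs_mult intro!: mult_left_mono\<close>)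
      also have "\<dots> = (\<Sum>i. \<bar>a (i + k)\<bar>) * G" by (rule suminf_mult2[OF sk, symmetric])
      also have "\<dots> \<le> \<delta> / 2 * G" by (rule mult_right_mono[OF tail G0])
      finally show ?thesis .
    qed
    define a' where "a' i = a i + (if i = 0 then \<delta> else 0)" for i
    have a': "(\<Sum>i<k. a' i * g i) = (\<Sum>i<k. a i * g i) + \<delta> * g 0" for g
      by (simp add: a'_def distrib_right sum.distrib if_distrib[of "\<lambda>x. x * _"] sum.delta k_def cong: if_cong)
    have "\<delta> / 2 * T 0 t \<le> (\<Sum>i<k. a' i * T i t)" if "t \<in> {0..1}" for t
      using split[of "\<lambda>i. T i t" "T 0 t", OF dom] aT[OF that] unfolding a' by linarith
    moreover have "(\<Sum>i<k. a' i * w i) < 0"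
      using split[of w "w 0", OF w] aw \<delta> \<rho> unfolding a' by linarith
    ultimately show ?thesis using \<delta> by (intro disjI2 exI[of _ k] exI[of _ a'] exI[of _ "\<delta>/2"]) auto
  qed
qed

section \<open>A curve through all directions\<close>

lemma binary_expansion:
  fixes y :: real
  assumes "0 \<le> y" "y \<le> 1"
  obtains d :: "nat \<Rightarrow> bool" where "(\<lambda>k. of_bool (d k) / 2 ^ Suc k) sums y"
proof -
  \<comment> \<open>Greedy doubling of the remainder. The remainder 1 yields digit 1 and reproduces
    itself, so \<open>y = 1\<close> needs no separate treatment.\<close>
  define r where "r = rec_nat y (\<lambda>_ x. 2 * x - of_bool (1/2 \<le> x))"
  have r0: "r 0 = y" and rS: "r (Suc k) = 2 * r k - of_bool (1/2 \<le> r k)" for k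
    by (simp_all add: r_def)
  define d where "d k \<longleftrightarrow> 1/2 \<le> r k" for k
  have r01: "0 \<le> r k \<and> r k \<le> 1" for k
    by (induction k) (use assms in \<open>auto simp: r0 rS\<close>)
  have part: "(\<Sum>k<n. of_bool (d k) / 2 ^ Suc k) = y - r n / 2 ^ n" for n
    by (induction n) (auto simp: r0 rS d_def field_simps)
  have "(\<lambda>n. r n / 2 ^ n) \<longlonglongrightarrow> 0"
  proof (rule tendsto_sandwich[of "\<lambda>_. 0" _ _ "\<lambda>n. (1/2)^n"])
    show "(\<lambda>n. (1/2::real)^n) \<longlonglongrightarrow> 0" by (rule LIMSEQ_realpow_zero) auto
  qed (use r01 in \<open>auto simp: power_one_over field_simps intro!: always_eventually\<close>)
  then have "(\<lambda>n. y - r n / 2 ^ n) \<longlonglongrightarrow> y - 0" by (intro tendsto_intros)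
  then have "(\<lambda>k. of_bool (d k) / 2 ^ Suc k) sums y" unfolding sums_def part by simp
  then show ?thesis using that by blast
qed

text \<open>A continuous function of period 2 that is 0 on [0,1/3] and 1 on [2/3,1], so it tells an
  initial ternary digit 0 from an initial digit 2. Clipping a cosine makes continuity and
  periodicity immediate.\<close>

definition schoenberg :: "real \<Rightarrow> real" where
  "schoenberg t = max 0 (min 1 (1/2 - cos (pi * t)))"

lemma schoenberg_bounds: "0 \<le> schoenberg t" "schoenberg t \<le> 1"
  by (auto simp: schoenberg_def)

text \<open>The witness is the point of the Cantor set with ternary digits 0 or 2 as dictated by
  \<open>a\<close>. Multiplying by \<open>3 ^ k\<close> turns the earlier digits into an even
  integer, which a function of period 2 ignores, while the later digits leave a remainder in
  [0,1/3], which keeps the argument in the interval belonging to digit \<open>k\<close>.\<close>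

lemma schoenberg_digit:
  fixes a :: "nat \<Rightarrow> bool"
  obtains t where "t \<in> {0..1}" "\<And>k. schoenberg (3 ^ k * t) = of_bool (a k)"
proof -
  define c where "c i = 2 * of_bool (a i) * (1/3::real) ^ Suc i" for i
  have geo: "(\<lambda>i. 2 * (1/3::real) ^ Suc (i + k)) sums (1/3) ^ k" for k
    using sums_mult[OF geometric_sums[of "1/3::real"], of "2 * (1/3) ^ Suc k"]
    by (simp add: power_add algebra_simps)
  have c_le: "0 \<le> c i" "c i \<le> 2 * (1/3) ^ Suc i" for i by (auto simp: c_def)
  have sumc: "summable c"
    by (rule summable_comparison_test'[OF sums_summable[OF geo[of 0]], of 0]) (use c_le in auto)
  have tail: "0 \<le> (\<Sum>i. c (i + k))" "(\<Sum>i. c (i + k)) \<le> (1/3) ^ k" for k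
  proof -
    have s: "summable (\<lambda>i. c (i + k))" using sumc by (subst summable_iff_shift)
    show "0 \<le> (\<Sum>i. c (i + k))" by (rule suminf_nonneg[OF s]) (use c_le in auto)
    have "(\<Sum>i. c (i + k)) \<le> (\<Sum>i. 2 * (1/3::real) ^ Suc (i + k))"
      by (rule suminf_le[OF _ s sums_summable[OF geo]]) (use c_le in blast)
    then show "(\<Sum>i. c (i + k)) \<le> (1/3) ^ k" using sums_unique[OF geo[of k]] by simp
  qed
  define t where "t = suminf c"
  have t01: "t \<in> {0..1}" using tail[of 0] by (simp add: t_def)
  have "schoenberg (3 ^ k * t) = of_bool (a k)" for k
  proof -
    define \<rho> where "\<rho> = 3 ^ k * (\<Sum>i. c (i + Suc k))"
    have \<rho>: "0 \<le> \<rho>" "\<rho> \<le> 1/3"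
    proof -
      have "\<rho> \<le> 3 ^ k * (1/3) ^ Suc k" unfolding \<rho>_def by (intro mult_left_mono tail) simp
      then show "\<rho> \<le> 1/3" by (simp add: power_one_over)
    qed (auto simp: \<rho>_def intro!: mult_nonneg_nonneg tail(1)[of "Suc k", simplified])
    have "t = (\<Sum>i. c (i + Suc k)) + (\<Sum>i<Suc k. c i)"
      unfolding t_def by (rule suminf_split_initial_segment[OF sumc])
    then have "3 ^ k * t = \<rho> + (3 ^ k * (\<Sum>i<k. c i) + 3 ^ k * c k)"
      by (simp add: \<rho>_def algebra_simps)
    also have "3 ^ k * c k = 2/3 * of_bool (a k)" by (simp add: c_def power_one_over)
    also have "3 ^ k * (\<Sum>i<k. c i) = 2 * real_of_int (\<Sum>i<k. of_bool (a i) * 3 ^ (k - Suc i))"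
    proof -
      have "3 ^ k * c i = 2 * (of_bool (a i) * 3 ^ (k - Suc i))" if "i < k" for i
      proof -
        have "(3::real) ^ k = 3 ^ Suc i * 3 ^ (k - Suc i)"
          using that by (subst power_add[symmetric]) simp
        then show ?thesis by (simp add: c_def power_one_over)
      qed
      then have "3 ^ k * (\<Sum>i<k. c i) = (\<Sum>i<k. 2 * (of_bool (a i) * 3 ^ (k - Suc i)))"
        unfolding sum_distrib_left by (intro sum.cong) auto
      then show ?thesis by (simp only: sum_distrib_left of_int_sum of_int_mult of_int_of_bool of_int_power of_int_numeral)
    qed
    finally have "3 ^ k * t = \<rho> + (2 * real_of_int (\<Sum>i<k. of_bool (a i) * 3 ^ (k - Suc i)) + 2/3 * of_bool (a k))" .
    moreover define j :: int where "j = (\<Sum>i<k. of_bool (a i) * 3 ^ (k - Suc i))"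
    ultimately have "3 ^ k * t = \<rho> + (2 * of_int j + 2/3 * of_bool (a k))" by simp
    then have "pi * (3 ^ k * t) = pi * (\<rho> + 2/3 * of_bool (a k)) + 2 * pi * of_int j"
      by (simp only: algebra_simps)
    then have cos_eq: "cos (pi * (3 ^ k * t)) = cos (pi * (\<rho> + 2/3 * of_bool (a k)))"
      by (simp add: cos_add[of _ "2 * pi * real_of_int j"])
    show ?thesis
    proof (cases "a k")
      case True
      have "cos (pi * (\<rho> + 2/3)) \<le> cos (2 * pi / 3)"
        by (rule cos_monotone_0_pi_le) (use \<rho> in \<open>auto simp: field_simps\<close>)
      then show ?thesis using True cos_eq unfolding cos_120 by (simp add: schoenberg_def)
    next
      case False
      have "cos (pi / 3) \<le> cos (pi * \<rho>)"
        by (rule cos_monotone_0_pi_le) (use \<rho> in \<open>auto simp: field_simps\<close>)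
      then show ?thesis using False cos_eq by (simp add: schoenberg_def cos_60)
    qed
  qed
  with t01 that show ?thesis by blast
qed

text \<open>Schoenberg's space-filling curve: the ternary digits of the parameter, read in residue
  classes of positions, are the binary digits of the coordinates.\<close>

lemma cube_curve:
  obtains z :: "real \<Rightarrow> 'a::euclidean_space" where "\<And>t. isCont z t"
    "\<And>t b. b \<in> Basis \<Longrightarrow> 0 \<le> z t \<bullet> b"
    "\<And>y. (\<And>b. b \<in> Basis \<Longrightarrow> y \<bullet> b \<in> {0..2}) \<Longrightarrow> \<exists>t\<in>{0..1}. z t = y"
proof -
  define n where "n = DIM('a)"
  obtain e :: "'a \<Rightarrow> nat" where e: "bij_betw e Basis {..<n}"
    using ex_bij_betw_finite_nat[of "Basis :: 'a set"] by (auto simp: n_def atLeast0LessThan)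
  have e_lt: "e b < n" if "b \<in> Basis" for b using bij_betwE[OF e] that by auto
  have n0: "0 < n" by (simp add: n_def)
  define g where "g b k t = schoenberg (3 ^ (n * k + e b) * t) / 2 ^ Suc k" for b k t
  define \<phi> where "\<phi> b t = (\<Sum>k. g b k t)" for b t
  have g_bd: "norm (g b k t) \<le> (1/2) ^ Suc k" for b k t
    using schoenberg_bounds by (simp add: g_def power_one_over divide_right_mono)
  have summ: "summable (\<lambda>k. (1/2::real) ^ Suc k)"
    by (subst summable_Suc_iff) (rule summable_geometric, simp)
  have cont: "isCont (\<phi> b) t" for b t
  proof -
    have "continuous_on UNIV (\<phi> b)"
    proof (rule uniform_limit_theorem)
      show "uniform_limit UNIV (\<lambda>m t. \<Sum>k<m. g b k t) (\<phi> b) sequentially"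
        unfolding \<phi>_def by (rule Weierstrass_m_test[OF _ summ]) (rule g_bd)
      show "\<forall>\<^sub>F m in sequentially. continuous_on UNIV (\<lambda>t. \<Sum>k<m. g b k t)"
        unfolding g_def schoenberg_def by (intro always_eventually allI continuous_intros) auto
    qed simp
    then show ?thesis by (simp add: continuous_on_eq_continuous_at)
  qed
  \<comment> \<open>The factor 2 stretches the unit cube to side length 2, so that it can hold the
    cube of points with coordinates in [-1,1] translated by \<open>One\<close>.\<close>
  define z where "z t = (\<Sum>b\<in>Basis. (2 * \<phi> b t) *\<^sub>R b :: 'a)" for t
  have zb: "z t \<bullet> b = 2 * \<phi> b t" if "b \<in> Basis" for t b
    using that by (simp add: z_def inner_sum_left inner_Basis if_distrib sum.delta cong: if_cong)
  have \<phi>_nonneg: "0 \<le> \<phi> b t" for b t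
    unfolding \<phi>_def
    by (intro suminf_nonneg summable_comparison_test'[OF summ, of 0] g_bd)
      (use schoenberg_bounds in \<open>auto simp: g_def\<close>)
  have z_cont: "isCont z t" for t
    unfolding z_def by (intro continuous_intros cont)
  have z_onto: "\<exists>t\<in>{0..1}. z t = y" if y: "\<And>b. b \<in> Basis \<Longrightarrow> y \<bullet> b \<in> {0..2}" for y
  proof -
    have "\<exists>d :: nat \<Rightarrow> bool. (\<lambda>k. of_bool (d k) / 2 ^ Suc k) sums ((y \<bullet> b) / 2)" if "b \<in> Basis" for b
      using y[OF that] binary_expansion[of "(y \<bullet> b) / 2"] by auto
    then obtain D :: "'a \<Rightarrow> nat \<Rightarrow> bool"
      where D: "\<And>b. b \<in> Basis \<Longrightarrow> (\<lambda>k. of_bool (D b k) / 2 ^ Suc k) sums ((y \<bullet> b) / 2)" by metis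
    define a where "a i = D (inv_into Basis e (i mod n)) (i div n)" for i
    have a: "a (n * k + e b) = D b k" if "b \<in> Basis" for b k
      using e_lt[OF that] n0 bij_betw_inv_into_left[OF e that] by (simp add: a_def)
    obtain t where t: "t \<in> {0..1}" "\<And>k. schoenberg (3 ^ k * t) = of_bool (a k)"
      using schoenberg_digit by blast
    have \<phi>_eq: "\<phi> b t = (y \<bullet> b) / 2" if "b \<in> Basis" for b
      using sums_unique[OF D[OF that]] by (simp add: \<phi>_def g_def t(2) a[OF that])
    have "z t = y" by (rule euclidean_eqI) (simp add: zb \<phi>_eq)
    with t(1) show ?thesis by blast
  qed
  show ?thesis
    by (rule that[of z]) (simp_all add: z_cont zb \<phi>_nonneg z_onto)
qed

text \<open>A cube-filling curve is pushed onto the set of points whose largest coordinate is 1,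
  which avoids the origin, and is then normalised. Lines rather than rays are reached, so the factor
  \<open>c\<close> may be negative; for even kernels this is enough.\<close>

lemma sphere_curve:
  obtains \<xi> :: "real \<Rightarrow> 'a::euclidean_space" where "\<And>t. isCont \<xi> t" "\<And>t. norm (\<xi> t) = 1"
    "\<And>x. x \<noteq> 0 \<Longrightarrow> \<exists>t\<in>{0..1}. \<exists>c. x = c *\<^sub>R \<xi> t"
proof -
  obtain z :: "real \<Rightarrow> 'a" where z: "\<And>t. isCont z t"
    "\<And>t b. b \<in> Basis \<Longrightarrow> 0 \<le> z t \<bullet> b"
    "\<And>y. (\<And>b. b \<in> Basis \<Longrightarrow> y \<bullet> b \<in> {0..2}) \<Longrightarrow> \<exists>t\<in>{0..1}. z t = y"
    using cube_curve by blast
  have attained: "\<exists>b\<in>Basis. \<bar>x \<bullet> b\<bar> = infnorm x" for x :: 'a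
  proof -
    have "infnorm x \<in> (\<lambda>b. \<bar>x \<bullet> b\<bar>) ` Basis"
      unfolding infnorm_Max by (rule Max_in) auto
    then show ?thesis by auto
  qed
  \<comment> \<open>Since \<open>z t\<close> has nonnegative coordinates,
    \<open>infnorm (z t)\<close> is its largest coordinate, and the shift along \<open>One\<close>
    makes the largest coordinate of \<open>c t\<close> equal to 1.\<close>
  define c where "c t = z t + (1 - infnorm (z t)) *\<^sub>R One" for t
  have c0: "c t \<noteq> 0" for t
  proof -
    obtain b where b: "b \<in> Basis" "\<bar>z t \<bullet> b\<bar> = infnorm (z t)" using attained by blast
    then have "c t \<bullet> b = 1" using z(2)[of b t] by (simp add: c_def inner_add_left)
    then show ?thesis by auto
  qed
  have cc: "isCont c t" for t
    unfolding c_def by (intro continuous_intros z(1) continuous_infnorm)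
  define \<xi> where "\<xi> t = c t /\<^sub>R norm (c t)" for t
  have "isCont \<xi> t" for t unfolding \<xi>_def by (intro continuous_intros cc) (use c0 in auto)
  moreover have "norm (\<xi> t) = 1" for t using c0 by (simp add: \<xi>_def)
  moreover have "\<exists>t\<in>{0..1}. \<exists>s. x = s *\<^sub>R \<xi> t" if "x \<noteq> 0" for x
  proof -
    obtain b where b: "b \<in> Basis" "\<bar>x \<bullet> b\<bar> = infnorm x" using attained by blast
    have l0: "infnorm x \<noteq> 0" using that by (simp add: infnorm_eq_0)
    then have xb: "x \<bullet> b \<noteq> 0" using b by auto
    \<comment> \<open>Division by the coordinate of largest modulus, sign included, gives
      coordinates in [-1,1] with the value 1 attained. The point \<open>u + One\<close> lies in the
      filled cube and has \<open>infnorm\<close> 2, so the shift in \<open>c\<close> returns exactly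
      \<open>u\<close>.\<close>
    define u where "u = x /\<^sub>R (x \<bullet> b)"
    have ub: "u \<bullet> b = 1" using xb by (simp add: u_def)
    have ule: "\<bar>u \<bullet> b'\<bar> \<le> 1" if "b' \<in> Basis" for b'
      using Basis_le_infnorm[OF that, of x] xb unfolding b(2)[symmetric]
      by (simp add: u_def abs_mult divide_le_eq_1 inverse_eq_divide)
    have "\<exists>t\<in>{0..1}. z t = u + One"
      by (rule z(3)) (use ule in \<open>simp add: inner_add_left abs_le_iff, smt (verit)\<close>)
    then obtain t where t: "t \<in> {0..1}" "z t = u + One" by blast
    have "infnorm (u + One) = 2"
    proof (rule antisym)
      show "infnorm (u + One) \<le> 2"
      proof -
        obtain b' where "b' \<in> Basis" "\<bar>(u + One) \<bullet> b'\<bar> = infnorm (u + One)" using attained by blast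
        then show ?thesis using ule[of b'] by (simp add: inner_add_left)
      qed
      show "2 \<le> infnorm (u + One)"
        using Basis_le_infnorm[OF b(1), of "u + One"] ub b(1) by (simp add: inner_add_left)
    qed
    then have "c t = u" by (simp add: c_def t)
    then have "\<xi> t = u /\<^sub>R norm u" "norm u \<noteq> 0" using c0[of t] by (simp_all add: \<xi>_def)
    moreover have "x = (x \<bullet> b) *\<^sub>R u" using xb by (simp add: u_def)
    ultimately have "x = ((x \<bullet> b) * norm u) *\<^sub>R \<xi> t" by (simp add: mult.assoc)
    with t show ?thesis by blast
  qed
  ultimately show ?thesis using that by blast
qed

section \<open>Integrals of homogeneous functions\<close>

lemma nn_integral_lborel_scale:
  fixes f :: "'a::euclidean_space \<Rightarrow> ennreal"
  assumes [measurable]: "f \<in> borel_measurable borel" and c: "0 < c"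
  shows "(\<integral>\<^sup>+x. f x \<partial>lborel) = ennreal (c ^ DIM('a)) * (\<integral>\<^sup>+x. f (c *\<^sub>R x) \<partial>lborel)"
proof -
  have "(\<integral>\<^sup>+x. f x \<partial>lborel) =
      (\<integral>\<^sup>+x. f x \<partial>density (distr lborel borel (\<lambda>x. 0 + c *\<^sub>R x)) (\<lambda>_. \<bar>c\<bar> ^ DIM('a)))"
    using c by (subst lborel_affine[of c 0, symmetric]) auto
  also have "\<dots> = (\<integral>\<^sup>+x. ennreal (c ^ DIM('a)) * f (c *\<^sub>R x) \<partial>lborel)"
    using c by (subst nn_integral_density) (auto simp: nn_integral_distr)
  also have "\<dots> = ennreal (c ^ DIM('a)) * (\<integral>\<^sup>+x. f (c *\<^sub>R x) \<partial>lborel)"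
    by (rule nn_integral_cmult) simp
  finally show ?thesis .
qed

lemma nn_integral_lborel_translate:
  fixes f :: "'a::euclidean_space \<Rightarrow> ennreal"
  assumes [measurable]: "f \<in> borel_measurable borel"
  shows "(\<integral>\<^sup>+x. f (c + x) \<partial>lborel) = (\<integral>\<^sup>+x. f x \<partial>lborel)"
proof -
  have "(\<integral>\<^sup>+x. f x \<partial>lborel) = (\<integral>\<^sup>+x. f x \<partial>distr lborel borel ((+) c))"
    by (simp add: lborel_distr_plus)
  also have "\<dots> = (\<integral>\<^sup>+x. f (c + x) \<partial>lborel)"
    by (subst nn_integral_distr) auto
  finally show ?thesis by simp
qed

lemma nn_integral_powr_from_0:
  fixes a c :: real
  assumes "0 < a" "0 \<le> c"
  shows "(\<integral>\<^sup>+t. ennreal (t powr (a - 1)) * indicator {0..c} t \<partial>lborel) = ennreal (c powr a / a)"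
proof -
  have "((\<lambda>x. x powr (a - 1)) has_integral (c powr a / a)) {0..c}"
    using has_integral_powr_from_0[of "a - 1" c] assms by simp
  then have "((\<lambda>x. x powr (a - 1) * indicator {0..c} x) has_integral (c powr a / a)) UNIV"
    by (subst (asm) has_integral_restrict_UNIV[symmetric])
      (rule has_integral_eq[rotated], assumption, auto simp: indicator_def)
  then have "(\<integral>\<^sup>+x. ennreal (x powr (a - 1) * indicator {0..c} x) \<partial>lborel) = ennreal (c powr a / a)"
    by (rule nn_integral_has_integral_lborel[rotated 2]) auto
  then show ?thesis by (simp add: ennreal_mult' ennreal_indicator)
qed

lemma nn_integral_powr_to_inf:
  fixes b c :: real
  assumes "0 < b" "0 < c"
  shows "(\<integral>\<^sup>+t. ennreal (t powr (- b - 1)) * indicator {c..} t \<partial>lborel) = ennreal (c powr (- b) / b)"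
proof -
  have "((\<lambda>x. x powr (- b - 1)) has_integral (c powr (- b) / b)) {c..}"
    using has_integral_powr_to_inf[of "- b - 1" c] assms by simp
  then have "((\<lambda>x. x powr (- b - 1) * indicator {c..} x) has_integral (c powr (- b) / b)) UNIV"
    by (subst (asm) has_integral_restrict_UNIV[symmetric])
      (rule has_integral_eq[rotated], assumption, auto simp: indicator_def)
  then have "(\<integral>\<^sup>+x. ennreal (x powr (- b - 1) * indicator {c..} x) \<partial>lborel) = ennreal (c powr (- b) / b)"
    by (rule nn_integral_has_integral_lborel[rotated 2]) auto
  then show ?thesis by (simp add: ennreal_mult' ennreal_indicator)
qed

text \<open>Polar coordinates in disguise: insert \<open>1 = \<beta> N\<^sup>\<beta> \<integral>\<^sub>N\<^sup>\<infinity> t\<^sup>-\<^sup>\<beta>\<^sup>-\<^sup>1 dt\<close>, exchange the integrals, rescale by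
  \<open>t\<close>, and exchange back.\<close>

lemma radial_integral:
  fixes M N :: "'a::euclidean_space \<Rightarrow> real" and G :: "'a \<Rightarrow> ennreal"
  assumes [measurable]: "M \<in> borel_measurable borel" "N \<in> borel_measurable borel" "G \<in> borel_measurable borel"
    and Mpos: "\<And>x. x \<noteq> 0 \<Longrightarrow> 0 < M x" and Npos: "\<And>x. x \<noteq> 0 \<Longrightarrow> 0 < N x"
    and Mhom: "\<And>t x. 0 < t \<Longrightarrow> M (t *\<^sub>R x) = t * M x" and Nhom: "\<And>t x. 0 < t \<Longrightarrow> N (t *\<^sub>R x) = t * N x"
    and Ghom: "\<And>t x. 0 < t \<Longrightarrow> G (t *\<^sub>R x) = ennreal (t powr d) * G x"
    and d: "0 < real DIM('a) + d" and \<beta>: "0 < \<beta>"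
  shows "(\<integral>\<^sup>+x. G x * indicator {x. M x \<le> 1} x \<partial>lborel) =
    ennreal (\<beta> / (real DIM('a) + d)) *
    (\<integral>\<^sup>+x. G x * ennreal (N x powr \<beta> * M x powr - (real DIM('a) + d)) * indicator {x. N x \<le> 1} x \<partial>lborel)"
proof -
  define a where "a = real DIM('a) + d"
  have a: "0 < a" using d by (simp add: a_def)
  \<comment> \<open>\<open>H\<close> contains the inserted integral over \<open>t \<ge> N x\<close>.
    \<open>J\<close> is its form after \<open>x\<close> becomes \<open>t *\<^sub>R x\<close>: the
    condition \<open>N x \<le> t\<close> turns into \<open>N x \<le> 1\<close>, and
    \<open>M x \<le> 1\<close> into an upper bound on \<open>t\<close>.\<close>
  define H where "H t x = G x * ennreal (N x powr \<beta>) * indicator {x. M x \<le> 1} x *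
      (ennreal (\<beta> * t powr (- \<beta> - 1)) * indicator {N x..} t * indicator {0<..} t)" for t x
  define J where "J t x = G x * ennreal (N x powr \<beta>) * indicator {x. N x \<le> 1} x *
      (ennreal (\<beta> * t powr (a - 1)) * (if t * M x \<le> 1 then 1 else 0) * indicator {0<..} t)" for t x
  have [measurable]: "case_prod H \<in> borel_measurable (borel \<Otimes>\<^sub>M borel)"
    "case_prod J \<in> borel_measurable (borel \<Otimes>\<^sub>M borel)"
    unfolding H_def J_def atLeast_def by measurable
  have AE0: "AE x in lborel. x \<noteq> (0 :: 'a)" using AE_lborel_singleton[of 0] by simp
  have "(\<integral>\<^sup>+x. G x * indicator {x. M x \<le> 1} x \<partial>lborel) = (\<integral>\<^sup>+x. (\<integral>\<^sup>+t. H t x \<partial>lborel) \<partial>lborel)"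
  proof (rule nn_integral_cong_AE, use AE0 in eventually_elim)
    fix x :: 'a assume x: "x \<noteq> 0"
    have "(\<integral>\<^sup>+t. H t x \<partial>lborel) = G x * ennreal (N x powr \<beta>) * indicator {x. M x \<le> 1} x *
        (\<integral>\<^sup>+t. ennreal (\<beta> * t powr (- \<beta> - 1)) * indicator {N x..} t * indicator {0<..} t \<partial>lborel)"
      unfolding H_def by (rule nn_integral_cmult) measurable
    also have "(\<integral>\<^sup>+t. ennreal (\<beta> * t powr (- \<beta> - 1)) * indicator {N x..} t * indicator {0<..} t \<partial>lborel)
        = (\<integral>\<^sup>+t. ennreal \<beta> * (ennreal (t powr (- \<beta> - 1)) * indicator {N x..} t) \<partial>lborel)"
      using Npos[OF x] \<beta> by (intro nn_integral_cong) (auto simp: ennreal_mult' split: split_indicator)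
    also have "\<dots> = ennreal \<beta> * ennreal (N x powr (- \<beta>) / \<beta>)"
      by (subst nn_integral_cmult) (auto simp: nn_integral_powr_to_inf[OF \<beta> Npos[OF x]])
    also have "\<dots> = ennreal (N x powr (- \<beta>))"
      using \<beta> by (simp add: ennreal_mult'[symmetric])
    also have "G x * ennreal (N x powr \<beta>) * indicator {x. M x \<le> 1} x * ennreal (N x powr (- \<beta>))
        = G x * indicator {x. M x \<le> 1} x * (ennreal (N x powr \<beta>) * ennreal (N x powr (- \<beta>)))"
      by (simp add: mult_ac)
    also have "ennreal (N x powr \<beta>) * ennreal (N x powr (- \<beta>)) = 1"
      using Npos[OF x] by (simp add: ennreal_mult'[symmetric] powr_add[symmetric])
    finally show "G x * indicator {x. M x \<le> 1} x = (\<integral>\<^sup>+t. H t x \<partial>lborel)" by simp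
  qed
  also have "\<dots> = (\<integral>\<^sup>+t. (\<integral>\<^sup>+x. H t x \<partial>lborel) \<partial>lborel)"
    by (rule lborel_pair.Fubini') simp
  also have "\<dots> = (\<integral>\<^sup>+t. (\<integral>\<^sup>+x. J t x \<partial>lborel) \<partial>lborel)"
  proof (rule nn_integral_cong)
    fix t :: real
    show "(\<integral>\<^sup>+x. H t x \<partial>lborel) = (\<integral>\<^sup>+x. J t x \<partial>lborel)"
    proof (cases "0 < t")
      case False
      then show ?thesis by (simp add: H_def J_def)
    next
      case t: True
      have "(\<integral>\<^sup>+x. H t x \<partial>lborel) = ennreal (t ^ DIM('a)) * (\<integral>\<^sup>+x. H t (t *\<^sub>R x) \<partial>lborel)"
        by (rule nn_integral_lborel_scale[OF _ t]) measurable
      also have "\<dots> = (\<integral>\<^sup>+x. ennreal (t ^ DIM('a)) * H t (t *\<^sub>R x) \<partial>lborel)"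
        by (rule nn_integral_cmult[symmetric]) measurable
      also have "\<dots> = (\<integral>\<^sup>+x. J t x \<partial>lborel)"
      proof (rule nn_integral_cong_AE, use AE0 in eventually_elim)
        fix x :: 'a assume x: "x \<noteq> 0"
        have ind: "indicator {x. M x \<le> 1} (t *\<^sub>R x) = (if t * M x \<le> 1 then 1 else 0 :: ennreal)"
          "indicator {N (t *\<^sub>R x)..} t = (indicator {x. N x \<le> 1} x :: ennreal)"
          using t by (auto simp: Mhom Nhom split: split_indicator)
        have pw: "N (t *\<^sub>R x) powr \<beta> = t powr \<beta> * N x powr \<beta>"
          using t Npos[OF x] by (simp add: Nhom powr_mult)
        have "t ^ DIM('a) * (t powr d * (t powr \<beta> * (\<beta> * t powr (- \<beta> - 1)))) = \<beta> * t powr (a - 1)"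
        proof -
          have "t ^ DIM('a) * (t powr d * (t powr \<beta> * (\<beta> * t powr (- \<beta> - 1)))) =
              \<beta> * (t powr real DIM('a) * t powr d * t powr \<beta> * t powr (- \<beta> - 1))"
            using t by (simp add: powr_realpow)
          also have "\<dots> = \<beta> * t powr (a - 1)"
            unfolding powr_add[symmetric] by (simp add: a_def algebra_simps)
          finally show ?thesis .
        qed
        then have e: "ennreal (t ^ DIM('a)) * (ennreal (t powr d) * (ennreal (t powr \<beta>) * ennreal (\<beta> * t powr (- \<beta> - 1))))
            = ennreal (\<beta> * t powr (a - 1))"
          using t \<beta> by (simp add: ennreal_mult'[symmetric])
        have "ennreal (t ^ DIM('a)) * H t (t *\<^sub>R x) =
          (ennreal (t ^ DIM('a)) * (ennreal (t powr d) * (ennreal (t powr \<beta>) * ennreal (\<beta> * t powr (- \<beta> - 1))))) *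
          (G x * ennreal (N x powr \<beta>) * indicator {x. N x \<le> 1} x * ((if t * M x \<le> 1 then 1 else 0) * indicator {0<..} t))"
          unfolding H_def ind pw Ghom[OF t] by (simp add: ennreal_mult mult_ac)
        also have "\<dots> = J t x" unfolding e J_def by (simp only: mult_ac)
        finally show "ennreal (t ^ DIM('a)) * H t (t *\<^sub>R x) = J t x" .
      qed
      finally show ?thesis .
    qed
  qed
  also have "\<dots> = (\<integral>\<^sup>+x. (\<integral>\<^sup>+t. J t x \<partial>lborel) \<partial>lborel)"
    by (rule lborel_pair.Fubini'[symmetric]) measurable
  also have "\<dots> = (\<integral>\<^sup>+x. ennreal (\<beta> / a) *
      (G x * ennreal (N x powr \<beta> * M x powr - a) * indicator {x. N x \<le> 1} x) \<partial>lborel)"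
  proof (rule nn_integral_cong_AE, use AE0 in eventually_elim)
    fix x :: 'a assume x: "x \<noteq> 0"
    have "(\<integral>\<^sup>+t. J t x \<partial>lborel) = G x * ennreal (N x powr \<beta>) * indicator {x. N x \<le> 1} x *
      (\<integral>\<^sup>+t. ennreal (\<beta> * t powr (a - 1)) * (if t * M x \<le> 1 then 1 else 0) * indicator {0<..} t \<partial>lborel)"
      unfolding J_def by (rule nn_integral_cmult) measurable
    also have "(\<integral>\<^sup>+t. ennreal (\<beta> * t powr (a - 1)) * (if t * M x \<le> 1 then 1 else 0) * indicator {0<..} t \<partial>lborel)
      = (\<integral>\<^sup>+t. ennreal \<beta> * (ennreal (t powr (a - 1)) * indicator {0..1 / M x} t) \<partial>lborel)"
      using Mpos[OF x] \<beta> 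
      by (intro nn_integral_cong) (auto simp: ennreal_mult' pos_le_divide_eq less_le split: split_indicator)
    also have "\<dots> = ennreal \<beta> * ennreal ((1 / M x) powr a / a)"
      using Mpos[OF x] by (subst nn_integral_cmult) (auto simp: nn_integral_powr_from_0[OF a])
    also have "\<dots> = ennreal (\<beta> / a) * ennreal (M x powr - a)"
      using Mpos[OF x] \<beta> a by (simp add: ennreal_mult'[symmetric] powr_minus powr_divide divide_simps)
    finally show "(\<integral>\<^sup>+t. J t x \<partial>lborel) = ennreal (\<beta> / a) *
      (G x * ennreal (N x powr \<beta> * M x powr - a) * indicator {x. N x \<le> 1} x)"
      by (simp add: ennreal_mult mult_ac)
  qed
  also have "\<dots> = ennreal (\<beta> / a) *
      (\<integral>\<^sup>+x. G x * ennreal (N x powr \<beta> * M x powr - a) * indicator {x. N x \<le> 1} x \<partial>lborel)"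
    by (rule nn_integral_cmult) measurable
  finally show ?thesis unfolding a_def .
qed

text \<open>The bound does not depend on \<open>c\<close>: within distance 1 of \<open>c\<close>
  each side contributes at most 1/(1+q), and farther away the integrand is at most 1 because
  \<open>q \<le> 0\<close>.\<close>

lemma nn_integral_abs_powr_unit:
  fixes q c :: real
  assumes q: "-1 < q" "q \<le> 0"
  shows "(\<integral>\<^sup>+\<tau>. ennreal (\<bar>c - \<tau>\<bar> powr q) * indicator {0..1} \<tau> \<partial>lborel) \<le> ennreal (2 / (1 + q) + 1)"
proof -
  let ?f = "\<lambda>s. ennreal (s powr ((q + 1) - 1)) * indicator {0..1} s"
  have f: "(\<integral>\<^sup>+s. ?f s \<partial>lborel) = ennreal (1 / (1 + q))"
    using nn_integral_powr_from_0[of "q + 1" 1] q by (simp add: add.commute)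
  have "(\<integral>\<^sup>+\<tau>. ennreal (\<bar>c - \<tau>\<bar> powr q) * indicator {0..1} \<tau> \<partial>lborel)
      \<le> (\<integral>\<^sup>+\<tau>. (?f (c - \<tau>) + ?f (\<tau> - c)) + indicator {0..1} \<tau> \<partial>lborel)"
  proof (rule nn_integral_mono)
    fix \<tau> :: real
    consider "\<tau> \<notin> {0..1}" | "\<bar>c - \<tau>\<bar> \<ge> 1" | "0 \<le> c - \<tau>" "c - \<tau> \<le> 1" | "0 \<le> \<tau> - c" "\<tau> - c \<le> 1" by linarith
    then show "ennreal (\<bar>c - \<tau>\<bar> powr q) * indicator {0..1} \<tau> \<le> (?f (c - \<tau>) + ?f (\<tau> - c)) + indicator {0..1} \<tau>"
    proof cases
      case 2
      then have "\<bar>c - \<tau>\<bar> powr q \<le> 1" using q powr_mono2'[of q 1 "\<bar>c - \<tau>\<bar>"] by simp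
      then have "ennreal (\<bar>c - \<tau>\<bar> powr q) * indicator {0..1} \<tau> \<le> indicator {0..1} \<tau>"
        by (auto split: split_indicator)
      then show ?thesis by (meson order_trans add_increasing zero_le order_refl)
    next
      case 3
      then have "ennreal (\<bar>c - \<tau>\<bar> powr q) * indicator {0..1} \<tau> \<le> ?f (c - \<tau>)"
        by (auto split: split_indicator)
      then show ?thesis by (meson order_trans add_increasing2 zero_le order_refl)
    next
      case 4
      then have "ennreal (\<bar>c - \<tau>\<bar> powr q) * indicator {0..1} \<tau> \<le> ?f (\<tau> - c)"
        by (auto simp: abs_minus_commute split: split_indicator)
      then show ?thesis by (meson order_trans add_increasing add_increasing2 zero_le order_refl)
    qed auto
  qed
  also have "\<dots> = (\<integral>\<^sup>+\<tau>. ?f (c - \<tau>) \<partial>lborel) + (\<integral>\<^sup>+\<tau>. ?f (\<tau> - c) \<partial>lborel) + 1"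
    by (subst nn_integral_add; (subst nn_integral_add)?) auto
  also have "(\<integral>\<^sup>+\<tau>. ?f (c - \<tau>) \<partial>lborel) = (\<integral>\<^sup>+s. ?f s \<partial>lborel)"
    by (subst nn_integral_real_affine[of ?f "-1" c]) auto
  also have "(\<integral>\<^sup>+\<tau>. ?f (\<tau> - c) \<partial>lborel) = (\<integral>\<^sup>+s. ?f s \<partial>lborel)"
    by (subst nn_integral_real_affine[of ?f 1 "- c"]) auto
  also have "(\<integral>\<^sup>+s. ?f s \<partial>lborel) + (\<integral>\<^sup>+s. ?f s \<partial>lborel) + 1 = ennreal (2 / (1 + q) + 1)"
    unfolding f using q by (subst ennreal_1[symmetric], simp del: ennreal_1 add: ennreal_plus[symmetric] del: ennreal_plus)
  finally show ?thesis .
qed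

text \<open>Averaging over the translations by \<open>\<tau> \<xi>\<close> with \<open>0 \<le> \<tau> \<le> 1\<close> reduces the bound to dimension one.\<close>

lemma slab_integral_bound:
  fixes q R :: real
  assumes q: "-1 < q" "q \<le> 0"
  obtains C where "0 < C" "\<And>b (\<xi> :: 'a::euclidean_space). norm \<xi> = 1 \<Longrightarrow>
    (\<integral>\<^sup>+x. ennreal (\<bar>b + x \<bullet> \<xi>\<bar> powr q) * indicator (cball 0 R) x \<partial>lborel) \<le> ennreal C"
proof
  let ?C = "(2 / (1 + q) + 1) * (measure lborel (cball (0::'a) (R + 1)) + 1)"
  show "0 < ?C" using q by (intro mult_pos_pos add_nonneg_pos) auto
  fix b and \<xi> :: 'a assume \<xi>: "norm \<xi> = 1"
  have [measurable]: "cball (0::'a) r \<in> sets borel" for r by simp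
  have \<xi>\<xi>: "\<xi> \<bullet> \<xi> = 1" using \<xi> by (simp add: norm_eq_1)
  let ?f = "\<lambda>x. ennreal (\<bar>b + x \<bullet> \<xi>\<bar> powr q) * indicator (cball 0 R) x"
  let ?I = "\<integral>\<^sup>+x. ?f x \<partial>lborel"
  let ?g = "\<lambda>\<tau> x. ennreal (\<bar>(b + x \<bullet> \<xi>) - \<tau>\<bar> powr q) * indicator {0..1} \<tau> * indicator (cball 0 (R + 1)) x"
  \<comment> \<open>Translation by \<open>\<tau> *\<^sub>R \<xi>\<close> shifts the linear form by
    \<open>- \<tau>\<close> and moves the ball inside the one of radius
    \<open>R + 1\<close>.\<close>
  have le: "?I * indicator {0..1} \<tau> \<le>
      (\<integral>\<^sup>+x. ?g \<tau> x \<partial>lborel)" for \<tau> :: real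
  proof (cases "\<tau> \<in> {0..1}")
    case True
    have "?I = (\<integral>\<^sup>+x. ?f ((- \<tau> *\<^sub>R \<xi>) + x) \<partial>lborel)"
      by (rule nn_integral_lborel_translate[symmetric]) measurable
    also have "\<dots> \<le> (\<integral>\<^sup>+x. ?g \<tau> x \<partial>lborel)"
    proof (rule nn_integral_mono)
      fix x :: 'a
      have "x \<in> cball 0 (R + 1)" if "(- \<tau> *\<^sub>R \<xi>) + x \<in> cball 0 R"
        using that True \<xi> norm_triangle_ineq[of "(- \<tau> *\<^sub>R \<xi>) + x" "\<tau> *\<^sub>R \<xi>"] by simp
      then show "?f ((- \<tau> *\<^sub>R \<xi>) + x) \<le> ?g \<tau> x"
        using True by (auto simp: inner_diff_left \<xi>\<xi> algebra_simps split: split_indicator)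
    qed
    finally show ?thesis using True by simp
  qed simp
  have "?I = (\<integral>\<^sup>+\<tau>. ?I * indicator {0..1::real} \<tau> \<partial>lborel)"
    by (subst nn_integral_cmult_indicator) auto
  also have "\<dots> \<le> (\<integral>\<^sup>+\<tau>. (\<integral>\<^sup>+x. ?g \<tau> x \<partial>lborel) \<partial>lborel)"
    by (rule nn_integral_mono) (rule le)
  also have "\<dots> = (\<integral>\<^sup>+x. (\<integral>\<^sup>+\<tau>. ?g \<tau> x \<partial>lborel) \<partial>lborel)"
    by (rule lborel_pair.Fubini'[symmetric]) measurable
  also have "\<dots> \<le> (\<integral>\<^sup>+x. ennreal (2 / (1 + q) + 1) * indicator (cball 0 (R + 1) :: 'a set) x \<partial>lborel)"
  proof (rule nn_integral_mono)
    fix x :: 'a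
    have "(\<integral>\<^sup>+\<tau>. ?g \<tau> x \<partial>lborel)
      = (\<integral>\<^sup>+\<tau>. ennreal (\<bar>(b + x \<bullet> \<xi>) - \<tau>\<bar> powr q) * indicator {0..1} \<tau> \<partial>lborel) * indicator (cball 0 (R + 1)) x"
      by (rule nn_integral_multc) measurable
    also have "\<dots> \<le> ennreal (2 / (1 + q) + 1) * indicator (cball 0 (R + 1)) x"
      by (intro mult_right_mono nn_integral_abs_powr_unit q) simp
    finally show "(\<integral>\<^sup>+\<tau>. ?g \<tau> x \<partial>lborel)
      \<le> ennreal (2 / (1 + q) + 1) * indicator (cball 0 (R + 1)) x" .
  qed
  also have "\<dots> = ennreal (2 / (1 + q) + 1) * ennreal (measure lborel (cball (0::'a) (R + 1)))"
    by (subst nn_integral_cmult_indicator) (use emeasure_lborel_cball_finite[of "0::'a" "R + 1"] in \<open>auto simp: emeasure_eq_ennreal_measure\<close>)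
  also have "\<dots> \<le> ennreal ?C"
    using q by (subst ennreal_mult'[symmetric]) (auto intro!: ennreal_leI mult_left_mono)
  finally show "?I \<le> ennreal ?C" .
qed

section \<open>Norms and symmetric convex bodies\<close>

locale gauge_norm =
  fixes N :: "'a::euclidean_space \<Rightarrow> real"
  assumes pos: "x \<noteq> 0 \<Longrightarrow> 0 < N x"
    and scale: "N (c *\<^sub>R x) = \<bar>c\<bar> * N x"
    and triangle: "N (x + y) \<le> N x + N y"
begin

lemma zero [simp]: "N 0 = 0"
  using scale[of 0 0] by simp

lemma nonneg: "0 \<le> N x"
  using pos[of x] by (cases "x = 0") auto

lemma minus: "N (- x) = N x"
  using scale[of "-1" x] by simp

lemma convex_on: "convex_on UNIV N"
proof (rule convex_onI)
  fix t :: real and x y assume "0 < t" "t < 1"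
  then show "N ((1 - t) *\<^sub>R x + t *\<^sub>R y) \<le> (1 - t) * N x + t * N y"
    using triangle[of "(1 - t) *\<^sub>R x" "t *\<^sub>R y"] by (simp add: scale)
qed auto

lemma continuous: "continuous_on A N"
  using convex_on_continuous[OF open_UNIV convex_on] continuous_on_subset by blast

lemma measurable [measurable]: "N \<in> borel_measurable borel"
  by (rule borel_measurable_continuous_onI) (rule continuous)

lemma lower_bound: obtains c where "0 < c" "\<And>x. c * norm x \<le> N x"
proof -
  have "sphere (0::'a) 1 \<noteq> {}" using norm_Basis[OF SOME_Basis] by (metis empty_iff mem_sphere_0)
  then obtain u where u: "norm u = 1" "\<And>y. norm y = 1 \<Longrightarrow> N u \<le> N y"
    using continuous_attains_inf[OF compact_sphere _ continuous, of "0::'a" 1] by auto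
  have "0 < N u" using u by (intro pos) auto
  moreover have "N u * norm x \<le> N x" for x
  proof (cases "x = 0")
    case False
    then have "N u \<le> N (x /\<^sub>R norm x)" by (intro u(2)) simp
    then show ?thesis using False by (simp add: scale field_simps)
  qed simp
  ultimately show ?thesis using that by blast
qed

lemma bounded_unit: "bounded {x. N x \<le> 1}"
proof -
  obtain c where c: "0 < c" "\<And>x. c * norm x \<le> N x" using lower_bound by blast
  have "norm x \<le> 1 / c" if "N x \<le> 1" for x
    using c(2)[of x] that c(1) by (simp add: pos_le_divide_eq mult.commute)
  then show ?thesis unfolding bounded_iff by blast
qed

lemma compact_unit: "compact {x. N x \<le> 1}" "compact {x. N x = 1}"
proof -
  have "closed {x. N x \<le> 1}" "closed {x. N x = 1}"
    by (intro closed_Collect_le closed_Collect_eq continuous continuous_on_const)+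
  moreover have "bounded {x. N x = 1}" by (rule bounded_subset[OF bounded_unit]) auto
  ultimately show "compact {x. N x \<le> 1}" "compact {x. N x = 1}"
    using bounded_unit by (auto simp: compact_eq_bounded_closed)
qed

lemma convex_body_unit: "convex_body {x. N x \<le> 1}"
proof -
  have "open {x. N x < 1}" by (intro open_Collect_less continuous continuous_on_const)
  then have "{x. N x < 1} \<subseteq> interior {x. N x \<le> 1}" by (intro interior_maximal) auto
  moreover have "0 \<in> {x. N x < 1}" by simp
  ultimately have "interior {x. N x \<le> 1} \<noteq> {}" by blast
  moreover have "convex {x. N x \<le> 1}"
  proof (rule convexI, clarify)
    fix x y and u v :: real assume *: "N x \<le> 1" "N y \<le> 1" "0 \<le> u" "0 \<le> v" "u + v = 1"
    have "N (u *\<^sub>R x + v *\<^sub>R y) \<le> u * N x + v * N y"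
      using triangle[of "u *\<^sub>R x" "v *\<^sub>R y"] * by (simp add: scale)
    also have "\<dots> \<le> 1" using * by (rule convex_bound_le)
    finally show "N (u *\<^sub>R x + v *\<^sub>R y) \<le> 1" .
  qed
  ultimately show ?thesis unfolding convex_body_def using compact_unit(1) by simp
qed

lemma origin_symmetric_unit: "origin_symmetric {x. N x \<le> 1}"
  unfolding origin_symmetric_def
proof (intro set_eqI iffI)
  show "x \<in> uminus ` {x. N x \<le> 1}" if "x \<in> {x. N x \<le> 1}" for x
    using that by (intro image_eqI[of _ _ "- x"]) (auto simp: minus)
qed (auto simp: minus)

text \<open>The open unit ball is separated from \<open>x0\<close>. It contains a small positive
  multiple of the normal \<open>a\<close>, so \<open>a \<bullet> x0\<close> is positive and can be
  normalised to 1.\<close>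

lemma support:
  assumes "N x0 = 1"
  obtains a where "\<And>x. a \<bullet> x \<le> N x" "a \<bullet> x0 = 1"
proof -
  have conv: "convex {x. N x < 1}"
  proof (rule convexI, clarify)
    fix x y and u v :: real assume *: "N x < 1" "N y < 1" "0 \<le> u" "0 \<le> v" "u + v = 1"
    have "N (u *\<^sub>R x + v *\<^sub>R y) \<le> u * N x + v * N y"
      using triangle[of "u *\<^sub>R x" "v *\<^sub>R y"] * by (simp add: scale)
    also have "\<dots> < 1" using * by (rule convex_bound_lt)
    finally show "N (u *\<^sub>R x + v *\<^sub>R y) < 1" .
  qed
  have "{x. N x < 1} \<noteq> {}" using zero by (metis empty_iff mem_Collect_eq zero_less_one)
  moreover have "{x. N x < 1} \<inter> {x0} = {}" using assms by auto
  ultimately obtain a b where ab: "a \<noteq> 0" "\<And>x. N x < 1 \<Longrightarrow> a \<bullet> x \<le> b" "b \<le> a \<bullet> x0"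
    using separating_hyperplane_sets[OF conv, of "{x0}"] by auto
  define s where "s = a \<bullet> x0"
  have le: "a \<bullet> x \<le> s" if "N x < 1" for x using ab that by (force simp: s_def)
  have Na: "0 < N a" by (rule pos[OF ab(1)])
  have "a \<bullet> ((1 / (2 * N a)) *\<^sub>R a) \<le> s" by (rule le) (use Na in \<open>simp add: scale\<close>)
  moreover have "0 < a \<bullet> ((1 / (2 * N a)) *\<^sub>R a)" using Na ab(1) by simp
  ultimately have s: "0 < s" by linarith
  have "a \<bullet> x \<le> s * N x" for x
  proof (rule dense_ge)
    fix y assume y: "s * N x < y"
    then have Nx: "N x < y / s" using s by (simp add: field_simps)
    from this have y0: "0 < y / s" using nonneg[of x] by linarith
    define r where "r = y / s"
    have "0 < r" "N x < r" using Nx y0 by (simp_all only: r_def)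
    then have "N (inverse r *\<^sub>R x) < 1" by (simp add: scale inverse_eq_divide pos_divide_less_eq del: inverse_divide abs_divide)
    from le[OF this] show "a \<bullet> x \<le> y" using y0 s \<open>0 < r\<close> by (simp add: r_def field_simps zero_less_divide_iff)
  qed
  then have "(a /\<^sub>R s) \<bullet> x \<le> N x" for x using s by (simp add: field_simps)
  moreover have "(a /\<^sub>R s) \<bullet> x0 = 1" using s by (simp add: s_def)
  ultimately show ?thesis using that by blast
qed

end

locale strict_gauge = gauge_norm +
  assumes strict: "N x = 1 \<Longrightarrow> N y = 1 \<Longrightarrow> x \<noteq> y \<Longrightarrow> N (x + y) < 2"
begin

text \<open>Strict convexity makes differences of seminorms and multiples of \<open>N\<close> dense: \<open>M\<close> is the supremum
  of the linear functionals below \<open>f + t N\<close>, and for large \<open>t\<close> suitable multiples of the support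
  functionals of \<open>N\<close> are among them.\<close>

lemma approx_by_seminorm_difference:
  fixes f :: "'a \<Rightarrow> real"
  assumes cont: "continuous_on {x. N x = 1} f" and fhom: "\<And>c x. f (c *\<^sub>R x) = \<bar>c\<bar> * f x" and \<eta>: "0 < \<eta>"
  obtains t M where "0 \<le> t" "\<And>c x. M (c *\<^sub>R x) = \<bar>c\<bar> * M x" "\<And>x y. M (x + y) \<le> M x + M y"
    "\<And>x. \<bar>M x - t * N x - f x\<bar> \<le> \<eta> * N x"
proof -
  define S where "S = {x. N x = 1}"
  have S: "compact S" unfolding S_def by (rule compact_unit)
  have unc: "uniformly_continuous_on S f"
    using cont S by (intro compact_uniformly_continuous) (auto simp: S_def)
  then obtain r where r: "0 < r" "\<And>x y. x \<in> S \<Longrightarrow> y \<in> S \<Longrightarrow> dist x y < r \<Longrightarrow> dist (f x) (f y) < \<eta>"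
    using \<eta> unfolding uniformly_continuous_on_def by metis
  have "bounded (f ` S)"
    using cont S by (intro compact_imp_bounded compact_continuous_image) (auto simp: S_def)
  then obtain F where F: "0 < F" "\<And>x. x \<in> S \<Longrightarrow> \<bar>f x\<bar> \<le> F"
    unfolding bounded_pos by auto
  \<comment> \<open>A modulus of convexity at the scale \<open>r\<close>: strict convexity is
    uniform on the compact set of pairs at distance at least \<open>r\<close>.\<close>
  have "\<exists>\<delta>>0. \<forall>x\<in>S. \<forall>y\<in>S. r \<le> dist x y \<longrightarrow> N (x + y) \<le> 2 - \<delta>"
  proof -
    define D where "D = (S \<times> S) \<inter> {z. r \<le> dist (fst z) (snd z)}"
    have "compact D" unfolding D_def
      by (intro compact_Int_closed compact_Times S closed_Collect_le continuous_intros)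
    moreover have "continuous_on D (\<lambda>z. N (fst z + snd z))"
      by (intro continuous_on_compose2[OF continuous[of UNIV]] continuous_intros) auto
    ultimately have "D = {} \<or> (\<exists>z\<in>D. \<forall>w\<in>D. N (fst w + snd w) \<le> N (fst z + snd z))"
      using continuous_attains_sup by blast
    then show ?thesis
    proof
      assume "D = {}"
      then show ?thesis by (intro exI[of _ 1]) (auto simp: D_def)
    next
      assume "\<exists>z\<in>D. \<forall>w\<in>D. N (fst w + snd w) \<le> N (fst z + snd z)"
      then obtain z where z: "z \<in> D" "\<And>w. w \<in> D \<Longrightarrow> N (fst w + snd w) \<le> N (fst z + snd z)" by blast
      have "N (fst z + snd z) < 2"
        using z(1) r(1) by (intro strict) (auto simp: D_def S_def)
      moreover have "N (x + y) \<le> N (fst z + snd z)" if "x \<in> S" "y \<in> S" "r \<le> dist x y" for x y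
        using z(2)[of "(x, y)"] that by (simp add: D_def)
      ultimately show ?thesis by (intro exI[of _ "2 - N (fst z + snd z)"]) auto
    qed
  qed
  then obtain \<delta> where \<delta>: "0 < \<delta>" "\<And>x y. x \<in> S \<Longrightarrow> y \<in> S \<Longrightarrow> r \<le> dist x y \<Longrightarrow> N (x + y) \<le> 2 - \<delta>"
    by blast
  \<comment> \<open>Large enough that every multiplier \<open>k\<close> used below is at least
    \<open>2 * F / \<delta>\<close>.\<close>
  define t where "t = F + \<eta> + 2 * F / \<delta>"
  have t0: "0 \<le> t" using F(1) \<eta> \<delta>(1) by (simp add: t_def)
  define \<Lambda> where "\<Lambda> = {a. \<forall>x. a \<bullet> x \<le> f x + t * N x}"
  have fin: "f x \<le> F * N x" "- (F * N x) \<le> f x" for x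
  proof -
    have "f 0 = 0" using fhom[of 0 0] by simp
    moreover have "\<bar>f x\<bar> \<le> F * N x" if "x \<noteq> 0"
    proof -
      have "inverse (N x) *\<^sub>R x \<in> S" using pos[OF that] by (simp add: S_def scale)
      from F(2)[OF this] show ?thesis using pos[OF that] by (simp add: fhom abs_mult field_simps)
    qed
    ultimately show "f x \<le> F * N x" "- (F * N x) \<le> f x" by (cases "x = 0"; force)+
  qed
  have supp: "\<exists>a\<in>\<Lambda>. a \<bullet> x0 = t + f x0 - \<eta>" if x0: "x0 \<in> S" for x0
  proof -
    obtain a where a: "\<And>x. a \<bullet> x \<le> N x" "a \<bullet> x0 = 1" using support x0 by (auto simp: S_def)
    \<comment> \<open>The multiple \<open>k\<close> of the support functional falls short of
      \<open>f + t\<close> at \<open>x0\<close> by exactly \<open>\<eta>\<close>. Near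
      \<open>x0\<close> this slack absorbs the oscillation of \<open>f\<close>; away from
      \<open>x0\<close> the functional loses at least \<open>k * \<delta>\<close>, which is no less
      than the total oscillation \<open>2 * F\<close>.\<close>
    define k where "k = t + f x0 - \<eta>"
    have k: "2 * F / \<delta> \<le> k" using F(2)[OF x0] by (simp add: k_def t_def)
    then have k0: "0 \<le> k" using F(1) \<delta>(1) by (smt (verit) divide_nonneg_pos)
    have main: "k * (a \<bullet> x) \<le> f x + t" if x: "x \<in> S" for x
    proof (cases "dist x x0 < r")
      case True
      then have "f x0 - \<eta> \<le> f x" using r(2)[OF x x0] by (simp add: dist_real_def abs_less_iff)
      moreover have "k * (a \<bullet> x) \<le> k * 1" using a(1)[of x] x k0 by (intro mult_left_mono) (auto simp: S_def)
      ultimately show ?thesis by (simp add: k_def)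
    next
      case False
      then have "a \<bullet> x + 1 \<le> 2 - \<delta>"
        using \<delta>(2)[OF x x0] a(1)[of "x + x0"] a(2) by (simp add: inner_add_right)
      then have "k * (a \<bullet> x) \<le> k * (1 - \<delta>)" using k0 by (intro mult_left_mono) auto
      moreover have "2 * F \<le> k * \<delta>" using k \<delta>(1) by (simp add: pos_divide_le_eq)
      ultimately have "k * (a \<bullet> x) \<le> k - 2 * F" by (simp add: algebra_simps)
      then show ?thesis using F(2)[OF x0] F(2)[OF x] \<eta> by (simp add: k_def abs_le_iff)
    qed
    have "(k *\<^sub>R a) \<bullet> x \<le> f x + t * N x" for x
    proof (cases "x = 0")
      case True
      then show ?thesis using fhom[of 0 0] by simp
    next
      case False
      have Nx: "0 < N x" by (rule pos[OF False])
      then have "inverse (N x) *\<^sub>R x \<in> S" by (simp add: S_def scale)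
      from main[OF this] Nx have "k * (a \<bullet> x) / N x \<le> (f x + t * N x) / N x"
        by (simp add: fhom field_simps)
      then show ?thesis using Nx by (simp add: divide_le_cancel)
    qed
    then show ?thesis using a(2) by (intro bexI[of _ "k *\<^sub>R a"]) (auto simp: \<Lambda>_def k_def)
  qed
  define M where "M x = (SUP a\<in>\<Lambda>. a \<bullet> x)" for x
  have "\<exists>x. x \<in> S"
  proof -
    obtain u :: 'a where "norm u = 1" using norm_Basis[OF SOME_Basis] by blast
    then have "0 < N u" by (intro pos) auto
    then show ?thesis by (intro exI[of _ "inverse (N u) *\<^sub>R u"]) (simp add: S_def scale)
  qed
  then have ne: "\<Lambda> \<noteq> {}" using supp by blast
  have bdd: "bdd_above ((\<lambda>a. a \<bullet> x) ` \<Lambda>)" for x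
    by (rule bdd_aboveI2[of _ _ "f x + t * N x"]) (auto simp: \<Lambda>_def)
  have M_ge: "a \<bullet> x \<le> M x" if "a \<in> \<Lambda>" for a x
    unfolding M_def by (rule cSUP_upper[OF that bdd])
  have M_le: "M x \<le> y" if "\<And>a. a \<in> \<Lambda> \<Longrightarrow> a \<bullet> x \<le> y" for x y
    unfolding M_def by (rule cSUP_least[OF ne that])
  \<comment> \<open>Evenness of \<open>f + t N\<close> makes \<open>\<Lambda>\<close> symmetric, so
    its support function \<open>M\<close> is even.\<close>
  have sym: "- a \<in> \<Lambda>" if "a \<in> \<Lambda>" for a
  proof -
    have "(- a) \<bullet> x \<le> f x + t * N x" for x
    proof -
      have "a \<bullet> (- x) \<le> f (- x) + t * N (- x)" using that unfolding \<Lambda>_def by blast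
      then show ?thesis using fhom[of "-1" x] by (simp add: minus)
    qed
    then show ?thesis by (simp add: \<Lambda>_def)
  qed
  have M_scale_le: "M (c *\<^sub>R x) \<le> \<bar>c\<bar> * M x" for c x
  proof (rule M_le)
    fix a assume a: "a \<in> \<Lambda>"
    show "a \<bullet> (c *\<^sub>R x) \<le> \<bar>c\<bar> * M x"
    proof (cases "0 \<le> c")
      case True
      then show ?thesis using M_ge[OF a, of x] by (simp add: mult_left_mono)
    next
      case False
      then have "(- c) * ((- a) \<bullet> x) \<le> (- c) * M x" by (intro mult_left_mono M_ge[OF sym[OF a]]) auto
      then show ?thesis using False by simp
    qed
  qed
  have "M (c *\<^sub>R x) = \<bar>c\<bar> * M x" for c x
  proof (rule antisym[OF M_scale_le])
    show "\<bar>c\<bar> * M x \<le> M (c *\<^sub>R x)"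
    proof (cases "c = 0")
      case True
      then show ?thesis using M_ge[of _ 0] ne by auto
    next
      case False
      have "M x \<le> \<bar>inverse c\<bar> * M (c *\<^sub>R x)" using M_scale_le[of "inverse c" "c *\<^sub>R x"] False by simp
      then show ?thesis using False by (simp add: field_simps)
    qed
  qed
  moreover have "M (x + y) \<le> M x + M y" for x y
    by (rule M_le) (simp add: inner_add_right add_mono M_ge)
  moreover have "\<bar>M x - t * N x - f x\<bar> \<le> \<eta> * N x" for x
  proof -
    have "M x \<le> f x + t * N x" by (rule M_le) (auto simp: \<Lambda>_def)
    moreover have "f x + t * N x - \<eta> * N x \<le> M x"
    proof (cases "x = 0")
      case True
      then show ?thesis using M_ge[of _ 0] ne fhom[of 0 0] by auto
    next
      case False
      have Nx: "0 < N x" by (rule pos[OF False])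
      then have "inverse (N x) *\<^sub>R x \<in> S" by (simp add: S_def scale)
      from supp[OF this] obtain a where "a \<in> \<Lambda>" "a \<bullet> (inverse (N x) *\<^sub>R x) = t + f (inverse (N x) *\<^sub>R x) - \<eta>" by blast
      then have "a \<bullet> x = f x + t * N x - \<eta> * N x" "a \<in> \<Lambda>" using Nx by (simp_all add: fhom field_simps)
      then show ?thesis using M_ge by metis
    qed
    moreover have "0 \<le> \<eta> * N x" using \<eta> nonneg by simp
    ultimately show ?thesis by (simp add: abs_le_iff)
  qed
  ultimately show ?thesis using that t0 by blast
qed

end

section \<open>Minkowski functionals of symmetric convex bodies\<close>

context
  fixes L :: "'a::euclidean_space set"
  assumes body: "convex_body L" and sym: "origin_symmetric L"
begin

lemma minus_mem_symmetric: "x \<in> L \<Longrightarrow> - x \<in> L"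
  using sym unfolding origin_symmetric_def by blast

text \<open>With \<open>x\<close> an interior point, a small \<open>z\<close> is the midpoint of
  \<open>x + z\<close> and \<open>- (x - z)\<close>, which both belong to the symmetric
  body.\<close>

lemma symmetric_body_ball: obtains e where "0 < e" "ball 0 e \<subseteq> L"
proof -
  obtain x e where e: "0 < e" "ball x e \<subseteq> L"
    using body unfolding convex_body_def by (meson ex_in_conv mem_interior)
  have "z \<in> L" if "z \<in> ball 0 e" for z
  proof -
    have "x + z \<in> L" "x - z \<in> L" using e(2) that by (auto simp: subset_iff dist_norm)
    then have "(1/2) *\<^sub>R (x + z) + (1/2) *\<^sub>R (- (x - z)) \<in> L"
      using body minus_mem_symmetric[of "x - z"] by (intro convexD) (simp_all add: convex_body_def)
    also have "(1/2) *\<^sub>R (x + z) + (1/2) *\<^sub>R (- (x - z)) = (1/2) *\<^sub>R (z + z)"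
      by (simp add: algebra_simps)
    also have "\<dots> = z" by (metis scaleR_half_double)
    finally show ?thesis .
  qed
  with e that show ?thesis by blast
qed

text \<open>Every scale above the infimum is admissible, by convexity and \<open>0 \<in> L\<close>;
  letting the scale decrease to \<open>b\<close>, closedness gives membership at \<open>b\<close>
  itself. This replaces reasoning about the infimum by reasoning about membership.\<close>

lemma minkowski_functional_le_iff:
  assumes "0 < b"
  shows "minkowski_functional L x \<le> b \<longleftrightarrow> inverse b *\<^sub>R x \<in> L"
proof
  define A where "A = {a. 0 \<le> a \<and> x \<in> (\<lambda>y. a *\<^sub>R y) ` L}"
  have N: "minkowski_functional L x = Inf A" by (simp add: minkowski_functional_def A_def)
  have bdd: "bdd_below A" by (rule bdd_belowI[of _ 0]) (auto simp: A_def)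
  have mem: "a \<in> A \<longleftrightarrow> inverse a *\<^sub>R x \<in> L" if "0 < a" for a
  proof -
    have "x = a *\<^sub>R y \<longleftrightarrow> inverse a *\<^sub>R x = y" for y using that by auto
    then show ?thesis using that by (auto simp: A_def image_iff)
  qed
  obtain e where e: "0 < e" "ball 0 e \<subseteq> L" using symmetric_body_ball by blast
  have zero: "0 \<in> L" using e by auto
  have conv: "convex L" and closed: "closed L" using body by (auto simp: convex_body_def compact_imp_closed)
  show "inverse b *\<^sub>R x \<in> L \<Longrightarrow> minkowski_functional L x \<le> b"
    unfolding N using mem[OF assms] bdd by (intro cInf_lower) auto
  assume le: "minkowski_functional L x \<le> b"
  have big: "inverse c *\<^sub>R x \<in> L" if "b < c" for c
  proof -
    have "inverse (2 * norm x / e + 1) *\<^sub>R x \<in> ball 0 e"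
    proof -
      have "norm x < e * (2 * norm x / e + 1)" using e by (simp add: algebra_simps) (smt (verit) norm_ge_zero)
      moreover have "0 < 2 * norm x / e + 1" using e by (smt (verit) divide_nonneg_pos norm_ge_zero)
      ultimately show ?thesis by (simp add: field_simps)
    qed
    moreover have "0 < 2 * norm x / e + 1" using e by (smt (verit) divide_nonneg_pos norm_ge_zero)
    ultimately have "A \<noteq> {}" using mem e(2) by blast
    moreover have "Inf A < c" using le that unfolding N by linarith
    ultimately obtain a where a: "a \<in> A" "a < c" using cInf_lessD by blast
    then obtain y where y: "y \<in> L" "x = a *\<^sub>R y" "0 \<le> a" unfolding A_def by blast
    have "(a / c) *\<^sub>R y + (1 - a / c) *\<^sub>R 0 \<in> L"
      using a y zero assms that by (intro convexD[OF conv]) (auto simp: divide_le_eq)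
    then show ?thesis using y by (simp add: field_simps)
  qed
  have "(\<lambda>n. inverse (b + inverse (real (Suc n))) *\<^sub>R x) \<longlonglongrightarrow> inverse (b + 0) *\<^sub>R x"
    using assms by (intro tendsto_intros LIMSEQ_inverse_real_of_nat) auto
  then have "inverse (b + 0) *\<^sub>R x \<in> L"
    by (rule closed_sequentially[OF closed, rotated]) (rule big, simp)
  then show "inverse b *\<^sub>R x \<in> L" by simp
qed

lemma minkowski_functional_nonneg: "0 \<le> minkowski_functional L x"
proof (rule ccontr)
  assume neg: "\<not> 0 \<le> minkowski_functional L x"
  \<comment> \<open>\<open>Inf\<close> of an empty set of reals carries no information. A negative
    value is in particular at most 1, which by the equivalence above puts \<open>x\<close> into
    \<open>L\<close> and exhibits an element of the set.\<close>
  have "{a. 0 \<le> a \<and> x \<in> (\<lambda>y. a *\<^sub>R y) ` L} \<noteq> {}"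
  proof -
    have "minkowski_functional L x \<le> 1" using neg by simp
    then show ?thesis unfolding minkowski_functional_le_iff[OF zero_less_one]
      by (auto intro!: exI[of _ 1])
  qed
  then have "0 \<le> minkowski_functional L x"
    unfolding minkowski_functional_def by (intro cInf_greatest) auto
  with neg show False by simp
qed

lemma gauge_minkowski_functional: "gauge_norm (minkowski_functional L)"
proof
  let ?N = "minkowski_functional L"
  note iff = minkowski_functional_le_iff
  have conv: "convex L" using body by (auto simp: convex_body_def)
  obtain R where R: "\<And>y. y \<in> L \<Longrightarrow> norm y \<le> R"
    using body unfolding convex_body_def by (meson bounded_iff compact_imp_bounded)
  show "0 < ?N x" if "x \<noteq> 0" for x
  proof (rule ccontr)
    assume "\<not> 0 < ?N x"
    then have *: "inverse b *\<^sub>R x \<in> L" if "0 < b" for b using iff[OF that, of x] that by simp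
    have R0: "0 < \<bar>R\<bar> + 1" by simp
    have "norm (inverse (norm x / (\<bar>R\<bar> + 1)) *\<^sub>R x) \<le> R"
      by (intro R *) (use that R0 in auto)
    then show False using that R0 by (simp add: field_simps abs_if split: if_splits)
  qed
  have scale_le: "?N (c *\<^sub>R x) \<le> c * ?N x" if c: "0 < c" for c x
  proof (rule dense_ge)
    fix y assume y: "c * ?N x < y"
    then have y0: "0 < y" using c minkowski_functional_nonneg[of x] by (smt (verit) mult_nonneg_nonneg)
    have "?N x \<le> y / c" using y c by (simp add: field_simps)
    then have "inverse (y / c) *\<^sub>R x \<in> L" using iff[of "y / c" x] y0 c by simp
    then show "?N (c *\<^sub>R x) \<le> y" using iff[OF y0, of "c *\<^sub>R x"] y0 c by (simp add: field_simps)
  qed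
  have scale_pos: "?N (c *\<^sub>R x) = c * ?N x" if c: "0 < c" for c x
    using scale_le[OF c, of x] scale_le[of "inverse c" "c *\<^sub>R x"] c by (simp add: field_simps)
  have minus_le: "?N (- x) \<le> ?N x" for x
  proof (rule dense_ge)
    fix y assume y: "?N x < y"
    then have y0: "0 < y" using minkowski_functional_nonneg[of x] by linarith
    show "?N (- x) \<le> y" using iff[OF y0, of x] iff[OF y0, of "- x"] y minus_mem_symmetric by fastforce
  qed
  have minus: "?N (- x) = ?N x" for x using minus_le[of x] minus_le[of "- x"] by simp
  have zero: "?N 0 = 0" using scale_pos[of 2 0] by simp
  show "?N (c *\<^sub>R x) = \<bar>c\<bar> * ?N x" for c x
  proof (cases c "0 :: real" rule: linorder_cases)
    case less
    then have "?N ((- c) *\<^sub>R (- x)) = (- c) * ?N (- x)" by (intro scale_pos) simp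
    then show ?thesis using less minus[of x] by simp
  qed (simp_all add: zero scale_pos)
  show "?N (x + y) \<le> ?N x + ?N y" for x y
  proof (rule field_le_epsilon)
    fix \<epsilon> :: real assume \<epsilon>: "0 < \<epsilon>"
    define a b where "a = ?N x + \<epsilon> / 2" and "b = ?N y + \<epsilon> / 2"
    have a: "0 < a" "?N x \<le> a" and b: "0 < b" "?N y \<le> b"
      using \<epsilon> minkowski_functional_nonneg[of x] minkowski_functional_nonneg[of y] by (auto simp: a_def b_def)
    have "(a / (a + b)) *\<^sub>R (inverse a *\<^sub>R x) + (b / (a + b)) *\<^sub>R (inverse b *\<^sub>R y) \<in> L"
      using a b iff by (intro convexD[OF conv]) (auto simp: add_divide_distrib[symmetric])
    also have "(a / (a + b)) *\<^sub>R (inverse a *\<^sub>R x) + (b / (a + b)) *\<^sub>R (inverse b *\<^sub>R y) = inverse (a + b) *\<^sub>R (x + y)"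
      using a b by (simp add: scaleR_add_right field_simps)
    finally have "?N (x + y) \<le> a + b" using iff[of "a + b"] a b by simp
    then show "?N (x + y) \<le> ?N x + ?N y + \<epsilon>" by (simp add: a_def b_def)
  qed
qed

lemma minkowski_functional_le_1: "{x. minkowski_functional L x \<le> 1} = L"
  using minkowski_functional_le_iff[of 1] by auto

text \<open>The midpoint of two distinct boundary points is interior, so a slightly dilated copy of
  it still lies in \<open>L\<close>; hence its norm is strictly below 1.\<close>

lemma strict_gauge_minkowski_functional:
  assumes "strictly_convex L"
  shows "strict_gauge (minkowski_functional L)"
proof -
  define N where "N = minkowski_functional L"
  have g: "gauge_norm N" unfolding N_def by (rule gauge_minkowski_functional)
  have mem: "w \<in> L \<longleftrightarrow> N w \<le> 1" for w using minkowski_functional_le_iff[of 1 w] by (simp add: N_def)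
  have "N (x + y) < 2" if xy: "N x = 1" "N y = 1" "x \<noteq> y" for x y
  proof -
    define z where "z = midpoint x y"
    have "x \<in> L" "y \<in> L" using xy by (simp_all add: mem)
    then have "z \<in> interior L"
      using assms xy(3) unfolding strictly_convex_def z_def
      by (metis midpoint_in_open_segment subsetD)
    then obtain e where e: "0 < e" "cball z e \<subseteq> L" unfolding mem_interior_cball by blast
    define k where "k = e / (norm z + 1)"
    have nz: "0 < norm z + 1" using norm_ge_zero[of z] by linarith
    have k: "0 < k" "k * norm z \<le> e"
      using e(1) nz by (simp_all add: k_def pos_divide_le_eq)
    have "dist z (z + k *\<^sub>R z) = k * norm z" using k(1) by (simp add: dist_norm)
    then have "z + k *\<^sub>R z \<in> L" using e(2) k(2) by (auto simp: subset_iff)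
    also have "z + k *\<^sub>R z = (1 + k) *\<^sub>R z" by (simp add: scaleR_add_left)
    finally have "\<bar>1 + k\<bar> * N z \<le> 1" unfolding mem gauge_norm.scale[OF g] .
    then have "N z + k * N z \<le> 1" using k(1) by (simp add: distrib_right)
    moreover have "0 < k * N z \<or> N z = 0" using k(1) gauge_norm.nonneg[OF g, of z] by (auto simp: less_le)
    ultimately have "N z < 1" by auto
    moreover have "N (x + y) = 2 * N z" using gauge_norm.scale[OF g, of 2 z] by (simp add: z_def midpoint_def)
    ultimately show "N (x + y) < 2" by simp
  qed
  with g show ?thesis unfolding N_def by (intro strict_gauge.intro strict_gauge_axioms.intro)
qed

end

section \<open>Integrals against powers of linear forms\<close>

lemma AE_affine_nonzero:
  fixes \<xi> :: "'a::euclidean_space"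
  assumes "\<xi> \<noteq> 0"
  shows "AE x in lborel. a + x \<bullet> \<xi> \<noteq> 0"
proof -
  let ?H = "{x. \<xi> \<bullet> x = - a}"
  have "?H \<in> sets borel" by (intro borel_closed closed_hyperplane)
  moreover have "negligible ?H" using assms by (intro negligible_hyperplane) auto
  ultimately have "?H \<in> null_sets lborel"
    by (simp add: negligible_iff_null_sets null_sets_completion_iff)
  then show ?thesis by (rule AE_I') (auto simp: inner_commute)
qed

lemmas AE_inner_nonzero = AE_affine_nonzero[of _ 0, simplified]

lemma ball_integral_powr_bound:
  fixes p R :: real
  assumes p: "-1 < p"
  obtains C where "0 < C" "\<And>\<xi> :: 'a::euclidean_space. norm \<xi> = 1 \<Longrightarrow>
    (\<integral>\<^sup>+x. ennreal (\<bar>x \<bullet> \<xi>\<bar> powr p) * indicator (cball 0 R) x \<partial>lborel) \<le> ennreal C"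
proof (cases "p \<le> 0")
  case True
  obtain C where C: "0 < C" "\<And>b (\<xi> :: 'a). norm \<xi> = 1 \<Longrightarrow>
    (\<integral>\<^sup>+x. ennreal (\<bar>b + x \<bullet> \<xi>\<bar> powr p) * indicator (cball 0 R) x \<partial>lborel) \<le> ennreal C"
    using slab_integral_bound[OF p True] by blast
  show ?thesis using that[OF C(1)] C(2)[of _ 0] by simp
next
  case False
  let ?C = "\<bar>R\<bar> powr p * measure lborel (cball (0::'a) R) + 1"
  have "(\<integral>\<^sup>+x. ennreal (\<bar>x \<bullet> \<xi>\<bar> powr p) * indicator (cball 0 R) x \<partial>lborel) \<le> ennreal ?C"
    if "norm \<xi> = 1" for \<xi> :: 'a
  proof -
    have "(\<integral>\<^sup>+x. ennreal (\<bar>x \<bullet> \<xi>\<bar> powr p) * indicator (cball 0 R) x \<partial>lborel)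
      \<le> (\<integral>\<^sup>+x. ennreal (\<bar>R\<bar> powr p) * indicator (cball 0 R :: 'a set) x \<partial>lborel)"
    proof (rule nn_integral_mono)
      fix x :: 'a
      have "\<bar>x \<bullet> \<xi>\<bar> powr p \<le> \<bar>R\<bar> powr p" if "norm x \<le> R"
        using Cauchy_Schwarz_ineq2[of x \<xi>] that \<open>norm \<xi> = 1\<close> False by (intro powr_mono2) auto
      then show "ennreal (\<bar>x \<bullet> \<xi>\<bar> powr p) * indicator (cball 0 R) x \<le> ennreal (\<bar>R\<bar> powr p) * indicator (cball 0 R) x"
        by (auto split: split_indicator intro!: ennreal_leI)
    qed
    also have "\<dots> = ennreal (\<bar>R\<bar> powr p) * ennreal (measure lborel (cball (0::'a) R))"
      by (subst nn_integral_cmult_indicator)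
        (use emeasure_lborel_cball_finite[of "0::'a" R] in \<open>auto simp: emeasure_eq_ennreal_measure\<close>)
    also have "\<dots> \<le> ennreal ?C" by (subst ennreal_mult'[symmetric]) (auto intro!: ennreal_leI)
    finally show ?thesis .
  qed
  moreover have "0 < ?C" by (intro add_nonneg_pos) auto
  ultimately show ?thesis using that by blast
qed

locale bounded_borel =
  fixes L :: "'a::euclidean_space set" and R :: real
  assumes L [measurable]: "L \<in> sets borel" and L_le: "L \<subseteq> cball 0 R"
begin

lemma emeasure_finite: "emeasure lborel L < \<infinity>"
  using emeasure_mono[OF L_le, of lborel] emeasure_lborel_cball_finite[of "0::'a" R]
  by (auto simp: le_less_trans)

lemma integral_powr_bound:
  assumes "-1 < p"
  obtains C where "0 < C" "\<And>\<xi>. norm \<xi> = 1 \<Longrightarrow>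
    (\<integral>\<^sup>+x. ennreal (indicator L x * \<bar>x \<bullet> \<xi>\<bar> powr p) \<partial>lborel) \<le> ennreal C"
proof -
  obtain C where C: "0 < C" "\<And>\<xi> :: 'a::euclidean_space. norm \<xi> = 1 \<Longrightarrow>
    (\<integral>\<^sup>+x. ennreal (\<bar>x \<bullet> \<xi>\<bar> powr p) * indicator (cball 0 R) x \<partial>lborel) \<le> ennreal C"
    using ball_integral_powr_bound[OF assms] by blast
  have "(\<integral>\<^sup>+x. ennreal (indicator L x * \<bar>x \<bullet> \<xi>\<bar> powr p) \<partial>lborel)
      \<le> (\<integral>\<^sup>+x. ennreal (\<bar>x \<bullet> \<xi>\<bar> powr p) * indicator (cball 0 R) x \<partial>lborel)" for \<xi>
    using L_le by (intro nn_integral_mono) (auto split: split_indicator)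
  with C that show ?thesis by (meson order_trans)
qed

lemma integrable_kernel_unit:
  assumes "-1 < p" "norm \<xi> = 1" "h \<in> borel_measurable borel" "\<And>x. \<bar>h x\<bar> \<le> B"
  shows "integrable lborel (\<lambda>x. indicator L x * (\<bar>x \<bullet> \<xi>\<bar> powr p * h x))"
proof (rule Bochner_Integration.integrable_bound)
  obtain C where C: "0 < C" "\<And>\<xi>. norm \<xi> = 1 \<Longrightarrow>
    (\<integral>\<^sup>+x. ennreal (indicator L x * \<bar>x \<bullet> \<xi>\<bar> powr p) \<partial>lborel) \<le> ennreal C"
    using integral_powr_bound[OF assms(1)] by blast
  have "integrable lborel (\<lambda>x. indicator L x * \<bar>x \<bullet> \<xi>\<bar> powr p)"
    using C(2)[OF assms(2)] by (intro integrableI_nonneg) (auto simp: le_less_trans)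
  then show "integrable lborel (\<lambda>x. B * (indicator L x * \<bar>x \<bullet> \<xi>\<bar> powr p))" by simp
  show "AE x in lborel. norm (indicator L x * (\<bar>x \<bullet> \<xi>\<bar> powr p * h x)) \<le> norm (B * (indicator L x * \<bar>x \<bullet> \<xi>\<bar> powr p))"
  proof (rule AE_I2)
    fix x
    have "\<bar>h x\<bar> \<le> \<bar>B\<bar>" using assms(4)[of x] by linarith
    then show "norm (indicator L x * (\<bar>x \<bullet> \<xi>\<bar> powr p * h x)) \<le> norm (B * (indicator L x * \<bar>x \<bullet> \<xi>\<bar> powr p))"
      by (auto simp: abs_mult mult.commute intro!: mult_right_mono split: split_indicator)
  qed
qed (use assms(3) in measurable)

lemma integrable_kernel:
  assumes p: "-1 < p" and \<xi>: "\<xi> \<noteq> 0" and h: "h \<in> borel_measurable borel" "\<And>x. \<bar>h x\<bar> \<le> B"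
  shows "integrable lborel (\<lambda>x. indicator L x * (\<bar>x \<bullet> \<xi>\<bar> powr p * h x))"
proof -
  have "integrable lborel (\<lambda>x. norm \<xi> powr p * (indicator L x * (\<bar>x \<bullet> (\<xi> /\<^sub>R norm \<xi>)\<bar> powr p * h x)))"
    using \<xi> by (intro integrable_mult_right integrable_kernel_unit[OF p _ h]) auto
  also have "(\<lambda>x. norm \<xi> powr p * (indicator L x * (\<bar>x \<bullet> (\<xi> /\<^sub>R norm \<xi>)\<bar> powr p * h x))) =
      (\<lambda>x. indicator L x * (\<bar>x \<bullet> \<xi>\<bar> powr p * h x))"
    using \<xi> by (auto simp: fun_eq_iff abs_mult powr_mult powr_minus_divide inverse_eq_divide powr_divide split: split_indicator)
  finally show ?thesis .
qed

text \<open>Dominated convergence: for \<open>x\<close> in \<open>L\<close> and unit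
  \<open>\<xi>\<close> the inner product stays in a compact interval, where the continuous profile
  \<open>F\<close> is bounded.\<close>

lemma continuous_on_kernel:
  fixes F :: "real \<Rightarrow> real" and h :: "'a \<Rightarrow> real"
  assumes F: "continuous_on UNIV F" and h: "h \<in> borel_measurable borel" "\<And>x. \<bar>h x\<bar> \<le> B"
  shows "continuous_on (sphere 0 1) (\<lambda>\<xi>. LINT x|lborel. indicator L x * (F (x \<bullet> \<xi>) * h x))"
proof (unfold continuous_on_sequentially, intro allI ballI impI)
  fix u :: "nat \<Rightarrow> 'a" and \<xi> assume \<xi>: "\<xi> \<in> sphere 0 1" and u: "(\<forall>n. u n \<in> sphere 0 1) \<and> u \<longlonglongrightarrow> \<xi>"
  have [measurable]: "F \<in> borel_measurable borel" "h \<in> borel_measurable borel"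
    using F h by (auto intro: borel_measurable_continuous_onI)
  have "bounded (F ` {-R..R})"
    by (intro compact_imp_bounded compact_continuous_image continuous_on_subset[OF F]) auto
  then obtain D where D0: "0 < D" "\<forall>y\<in>F ` {-R..R}. norm y \<le> D" unfolding bounded_pos by blast
  have D: "0 < D" "\<And>s. s \<in> {-R..R} \<Longrightarrow> \<bar>F s\<bar> \<le> D" using D0 by auto
  have "(\<lambda>n. LINT x|lborel. indicator L x * (F (x \<bullet> u n) * h x)) \<longlonglongrightarrow> (LINT x|lborel. indicator L x * (F (x \<bullet> \<xi>) * h x))"
  proof (rule integral_dominated_convergence[where w="\<lambda>x. (D * B) * indicator L x"])
    show "integrable lborel (\<lambda>x. (D * B) * indicator L x)"
      using emeasure_finite by (intro integrable_mult_right integrable_real_indicator) auto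
    show "AE x in lborel. (\<lambda>n. indicator L x * (F (x \<bullet> u n) * h x)) \<longlonglongrightarrow> indicator L x * (F (x \<bullet> \<xi>) * h x)"
    proof (rule AE_I2)
      fix x
      have "(\<lambda>n. F (x \<bullet> u n)) \<longlonglongrightarrow> F (x \<bullet> \<xi>)"
        using u F by (intro isCont_tendsto_compose[of _ F] tendsto_intros) (auto simp: continuous_on_eq_continuous_at)
      then show "(\<lambda>n. indicator L x * (F (x \<bullet> u n) * h x)) \<longlonglongrightarrow> indicator L x * (F (x \<bullet> \<xi>) * h x)"
        by (intro tendsto_intros)
    qed
    show "AE x in lborel. norm (indicator L x * (F (x \<bullet> u n) * h x)) \<le> (D * B) * indicator L x" for n
    proof (rule AE_I2)
      fix x
      have "\<bar>F (x \<bullet> u n)\<bar> \<le> D" if "x \<in> L"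
      proof (rule D(2))
        have "norm (u n) = 1" using u by simp
        then have "\<bar>x \<bullet> u n\<bar> \<le> norm x" using Cauchy_Schwarz_ineq2[of x "u n"] by simp
        also have "\<dots> \<le> R" using L_le that by auto
        finally show "x \<bullet> u n \<in> {-R..R}" by (auto simp: abs_le_iff)
      qed
      then show "norm (indicator L x * (F (x \<bullet> u n) * h x)) \<le> (D * B) * indicator L x"
        using h(2)[of x] D(1) by (auto simp: abs_mult mult_mono split: split_indicator)
    qed
  qed measurable
  then show "((\<lambda>\<xi>. LINT x|lborel. indicator L x * (F (x \<bullet> \<xi>) * h x)) \<circ> u) \<longlonglongrightarrow> (LINT x|lborel. indicator L x * (F (x \<bullet> \<xi>) * h x))"
    by (simp add: o_def)
qed

text \<open>The p-cosine transform of the density \<open>h\<close>, taken over the solid body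
  instead of the sphere.\<close>

definition cosine_transform :: "real \<Rightarrow> ('a \<Rightarrow> real) \<Rightarrow> 'a \<Rightarrow> real" where
  "cosine_transform p h \<xi> = (LINT x|lborel. indicator L x * (\<bar>x \<bullet> \<xi>\<bar> powr p * h x))"

text \<open>For p < 0 the kernel is singular along a hyperplane that moves with the direction. Its
  truncations have continuous transforms, and these converge uniformly because integrals of a
  slightly more singular power are bounded uniformly in the direction.\<close>

lemma continuous_on_cosine_transform:
  assumes p: "-1 < p" "p \<noteq> 0" and h: "h \<in> borel_measurable borel" "\<And>x. \<bar>h x\<bar> \<le> B"
  shows "continuous_on (sphere 0 1) (cosine_transform p h)"
proof (cases "0 < p")
  case True
  then have "continuous_on UNIV (\<lambda>s::real. \<bar>s\<bar> powr p)"
    by (intro continuous_on_powr' continuous_intros) auto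
  from continuous_on_kernel[OF this h] show ?thesis unfolding cosine_transform_def .
next
  case False
  \<comment> \<open>Any exponent strictly between -1 and \<open>p\<close> would do: powers
    \<open>q\<close> are still uniformly integrable, and the difference \<open>p - q\<close>
    supplies the decay of the truncation error.\<close>
  define q where "q = (p - 1) / 2"
  have q: "-1 < q" "q < p" using p False by (auto simp: q_def)
  obtain C where C: "0 < C" "\<And>\<xi>. norm \<xi> = 1 \<Longrightarrow>
    (\<integral>\<^sup>+x. ennreal (indicator L x * \<bar>x \<bullet> \<xi>\<bar> powr q) \<partial>lborel) \<le> ennreal C"
    using integral_powr_bound[OF q(1)] by blast
  define e where "e k = inverse (real (Suc k))" for k
  have e0: "0 < e k" for k by (simp add: e_def)
  \<comment> \<open>Replacing \<open>\<bar>s\<bar>\<close> by at least \<open>e k\<close> caps the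
    negative power at height \<open>e k powr p\<close>.\<close>
  define F where "F k s = max \<bar>s\<bar> (e k) powr p" for k and s :: real
  let ?K = "\<lambda>k \<xi>. LINT x|lborel. indicator L x * (F k (x \<bullet> \<xi>) * h x)"
  have Fc: "continuous_on UNIV (F k)" for k
    unfolding F_def using e0[of k] by (intro continuous_on_powr' continuous_intros) (auto simp: max_def not_le)
  have F_le: "\<bar>F k s - \<bar>s\<bar> powr p\<bar> \<le> e k powr (p - q) * \<bar>s\<bar> powr q" if "s \<noteq> 0" for k s
  proof (cases "\<bar>s\<bar> < e k")
    case True
    have "F k s \<le> \<bar>s\<bar> powr p"
      unfolding F_def using that False by (intro powr_mono2') auto
    then have "\<bar>F k s - \<bar>s\<bar> powr p\<bar> \<le> \<bar>s\<bar> powr p" by (simp add: F_def)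
    also have "\<dots> = \<bar>s\<bar> powr (p - q) * \<bar>s\<bar> powr q" by (simp add: powr_add[symmetric])
    also have "\<dots> \<le> e k powr (p - q) * \<bar>s\<bar> powr q"
      using True q by (intro mult_right_mono powr_mono2) auto
    finally show ?thesis .
  next
    case False
    then have "F k s = \<bar>s\<bar> powr p" by (simp add: F_def max_def)
    then show ?thesis by simp
  qed
  have B0: "0 \<le> B" using h(2)[of 0] by linarith
  have bound: "\<bar>?K k \<xi> - cosine_transform p h \<xi>\<bar> \<le> e k powr (p - q) * (B * C)"
    if \<xi>: "norm \<xi> = 1" for \<xi> k
  proof -
    let ?D = "\<lambda>x. indicator L x * (F k (x \<bullet> \<xi>) * h x) - indicator L x * (\<bar>x \<bullet> \<xi>\<bar> powr p * h x)"
    have [measurable]: "F k \<in> borel_measurable borel" "h \<in> borel_measurable borel"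
      using Fc h by (auto intro: borel_measurable_continuous_onI)
    have F_le1: "\<bar>F k s\<bar> \<le> e k powr p" for s
      unfolding F_def using e0[of k] False by (simp add: powr_mono2')
    have i1: "integrable lborel (\<lambda>x. indicator L x * (F k (x \<bullet> \<xi>) * h x))"
    proof (rule Bochner_Integration.integrable_bound)
      show "integrable lborel (\<lambda>x. (e k powr p * B) * indicator L x)"
        using emeasure_finite by (intro integrable_mult_right integrable_real_indicator) auto
      show "AE x in lborel. norm (indicator L x * (F k (x \<bullet> \<xi>) * h x)) \<le> norm ((e k powr p * B) * indicator L x)"
        using F_le1 h(2) B0 by (intro AE_I2) (auto simp: abs_mult mult_mono split: split_indicator)
    qed measurable
    have i2: "integrable lborel (\<lambda>x. indicator L x * (\<bar>x \<bullet> \<xi>\<bar> powr p * h x))"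
      by (rule integrable_kernel_unit[OF p(1) \<xi> h])
    have i3: "integrable lborel (\<lambda>x. indicator L x * (\<bar>x \<bullet> \<xi>\<bar> powr q * B))"
      by (rule integrable_kernel_unit[OF q(1) \<xi>]) auto
    have "\<bar>?K k \<xi> - cosine_transform p h \<xi>\<bar>
      = \<bar>LINT x|lborel. ?D x\<bar>"
      unfolding cosine_transform_def using i1 i2 by simp
    also have "\<dots> \<le> (LINT x|lborel. \<bar>?D x\<bar>)"
      by (rule integral_abs_bound)
    also have "\<dots> \<le> (LINT x|lborel. e k powr (p - q) * (indicator L x * (\<bar>x \<bullet> \<xi>\<bar> powr q * B)))"
    proof (rule integral_mono_AE)
      have "\<xi> \<noteq> 0" using \<xi> by auto
      from AE_inner_nonzero[OF this]
      show "AE x in lborel. \<bar>?D x\<bar>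
         \<le> e k powr (p - q) * (indicator L x * (\<bar>x \<bullet> \<xi>\<bar> powr q * B))"
      proof eventually_elim
        fix x assume "x \<bullet> \<xi> \<noteq> 0"
        from mult_mono[OF F_le[OF this, of k] h(2)[of x]]
        show "\<bar>?D x\<bar>
         \<le> e k powr (p - q) * (indicator L x * (\<bar>x \<bullet> \<xi>\<bar> powr q * B))"
          by (auto simp: abs_mult[symmetric] algebra_simps split: split_indicator)
      qed
    qed (use i1 i2 i3 in auto)
    also have "\<dots> = e k powr (p - q) * (B * (LINT x|lborel. indicator L x * \<bar>x \<bullet> \<xi>\<bar> powr q))"
    proof -
      have "(LINT x|lborel. e k powr (p - q) * (indicator L x * (\<bar>x \<bullet> \<xi>\<bar> powr q * B)))
        = (LINT x|lborel. (e k powr (p - q) * B) * (indicator L x * \<bar>x \<bullet> \<xi>\<bar> powr q))"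
        by (simp only: mult_ac)
      then show ?thesis by (simp only: integral_mult_right_zero mult.assoc)
    qed
    also have "\<dots> \<le> e k powr (p - q) * (B * C)"
    proof (intro mult_left_mono B0)
      have "(LINT x|lborel. indicator L x * \<bar>x \<bullet> \<xi>\<bar> powr q) =
        enn2real (\<integral>\<^sup>+x. ennreal (indicator L x * \<bar>x \<bullet> \<xi>\<bar> powr q) \<partial>lborel)"
        by (rule integral_eq_nn_integral) auto
      also have "\<dots> \<le> C" using C(2)[OF \<xi>] C(1) by (intro enn2real_leI) auto
      finally show "(LINT x|lborel. indicator L x * \<bar>x \<bullet> \<xi>\<bar> powr q) \<le> C" .
    qed auto
    finally show ?thesis .
  qed
  have lim: "(\<lambda>k. e k powr (p - q) * (B * C)) \<longlonglongrightarrow> 0"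
  proof -
    have "(\<lambda>k. e k powr (p - q)) \<longlonglongrightarrow> 0 powr (p - q)"
      unfolding e_def using q by (intro tendsto_powr' LIMSEQ_inverse_real_of_nat tendsto_const) auto
    then show ?thesis using q tendsto_mult_left_zero by fastforce
  qed
  show ?thesis
  proof (rule uniform_limit_theorem)
    show "\<forall>\<^sub>F k in sequentially. continuous_on (sphere 0 1) (?K k)"
      by (intro always_eventually allI continuous_on_kernel[OF Fc h])
    show "uniform_limit (sphere 0 1) (?K) (cosine_transform p h) sequentially"
    proof (rule uniform_limitI)
      fix \<epsilon> :: real assume "0 < \<epsilon>"
      from order_tendstoD(2)[OF lim this]
      show "\<forall>\<^sub>F k in sequentially. \<forall>\<xi>\<in>sphere 0 1. dist (?K k \<xi>) (cosine_transform p h \<xi>) < \<epsilon>"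
      proof eventually_elim
        case (elim k)
        then show ?case using le_less_trans[OF bound elim] by (simp add: dist_real_def)
      qed
    qed
  qed simp
qed

end

section \<open>Potentials of measures on the sphere\<close>

text \<open>For p < 0 it is the value \<infinity> at 0 that makes the kernel continuous; it arises
  as the \<open>ennreal\<close> inverse of the continuous function
  \<open>\<bar>t\<bar> powr (- p)\<close>.\<close>

lemma continuous_on_abs_powr: "p \<noteq> 0 \<Longrightarrow> continuous_on A (abs_powr p)"
proof (cases "0 < p")
  case True
  then have "abs_powr p = (\<lambda>t. ennreal (\<bar>t\<bar> powr p))" by (auto simp: abs_powr_def fun_eq_iff)
  moreover have "continuous_on A (\<lambda>t::real. ennreal (\<bar>t\<bar> powr p))"
    using True by (intro continuous_on_ennreal continuous_on_powr' continuous_intros) auto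
  ultimately show ?thesis by simp
next
  case False
  assume "p \<noteq> 0"
  with False have p: "p < 0" by simp
  have "abs_powr p t = inverse (ennreal (\<bar>t\<bar> powr (- p)))" for t
    using p by (auto simp: abs_powr_def inverse_ennreal powr_minus)
  moreover have "continuous_on A (\<lambda>t::real. inverse (ennreal (\<bar>t\<bar> powr (- p))))"
    using p by (intro continuous_on_inverse_ennreal continuous_on_ennreal continuous_on_powr' continuous_intros) auto
  ultimately show ?thesis by (simp cong: continuous_on_cong)
qed

lemma abs_powr_nonzero: "t \<noteq> 0 \<Longrightarrow> abs_powr p t = ennreal (\<bar>t\<bar> powr p)"
  by (simp add: abs_powr_def)

lemma abs_powr_mult: "0 < c \<Longrightarrow> abs_powr p (c * t) = ennreal (c powr p) * abs_powr p t"
  by (auto simp: abs_powr_def abs_mult powr_mult ennreal_mult ennreal_mult_top)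

text \<open>The \<open>A_1\<close> estimate in normalised form. If \<open>\<bar>a\<bar> < 2\<close>,
  the integral has a uniform bound while \<open>\<bar>a\<bar> powr p\<close> is bounded below;
  otherwise the linear form keeps modulus at least \<open>\<bar>a\<bar> / 2\<close> on the unit
  ball.\<close>

lemma ball_average_powr_le:
  fixes p :: real
  assumes p: "-1 < p" "p < 0"
  obtains C where "0 < C" "\<And>a (\<xi> :: 'a::euclidean_space). norm \<xi> = 1 \<Longrightarrow> a \<noteq> 0 \<Longrightarrow>
    (\<integral>\<^sup>+z. ennreal (\<bar>a + z \<bullet> \<xi>\<bar> powr p) * indicator (cball 0 1) z \<partial>lborel) \<le> ennreal (C * \<bar>a\<bar> powr p)"
proof -
  obtain C0 where C0: "0 < C0" "\<And>b (\<xi> :: 'a). norm \<xi> = 1 \<Longrightarrow>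
    (\<integral>\<^sup>+x. ennreal (\<bar>b + x \<bullet> \<xi>\<bar> powr p) * indicator (cball 0 1) x \<partial>lborel) \<le> ennreal C0"
    using slab_integral_bound[of p 1] p by auto
  define V where "V = measure lborel (cball (0::'a) 1)"
  define C where "C = (C0 + V) * 2 powr (- p)"
  have C: "0 < C" using C0(1) by (simp add: C_def V_def add_pos_nonneg)
  have "(\<integral>\<^sup>+z. ennreal (\<bar>a + z \<bullet> \<xi>\<bar> powr p) * indicator (cball 0 1) z \<partial>lborel) \<le> ennreal (C * \<bar>a\<bar> powr p)"
    if \<xi>: "norm \<xi> = 1" and a: "a \<noteq> 0" for a and \<xi> :: 'a
  proof (cases "\<bar>a\<bar> < 2")
    case True
    have "1 = (2 powr (- p)) * 2 powr p" by (simp add: powr_add[symmetric])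
    also have "\<dots> \<le> 2 powr (- p) * \<bar>a\<bar> powr p"
      using True a p by (intro mult_left_mono powr_mono2') auto
    finally have "C0 \<le> C0 * (2 powr (- p) * \<bar>a\<bar> powr p)" using C0(1) by simp
    also have "\<dots> \<le> C * \<bar>a\<bar> powr p" by (simp add: C_def V_def distrib_right mult.assoc)
    finally show ?thesis using C0(2)[OF \<xi>, of a] order_trans ennreal_leI by blast
  next
    case False
    have "(\<integral>\<^sup>+z. ennreal (\<bar>a + z \<bullet> \<xi>\<bar> powr p) * indicator (cball 0 1) z \<partial>lborel)
      \<le> (\<integral>\<^sup>+z. ennreal (2 powr (- p) * \<bar>a\<bar> powr p) * indicator (cball 0 1 :: 'a set) z \<partial>lborel)"
    proof (rule nn_integral_mono)
      fix z :: 'a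
      have "\<bar>a + z \<bullet> \<xi>\<bar> powr p \<le> 2 powr (- p) * \<bar>a\<bar> powr p" if "norm z \<le> 1"
      proof -
        have "\<bar>z \<bullet> \<xi>\<bar> \<le> 1" using Cauchy_Schwarz_ineq2[of z \<xi>] \<xi> that by simp
        then have "\<bar>a\<bar> / 2 \<le> \<bar>a + z \<bullet> \<xi>\<bar>" using False by linarith
        then have "\<bar>a + z \<bullet> \<xi>\<bar> powr p \<le> (\<bar>a\<bar> / 2) powr p" using a p by (intro powr_mono2') auto
        then show ?thesis by (simp add: powr_divide powr_minus field_simps)
      qed
      then show "ennreal (\<bar>a + z \<bullet> \<xi>\<bar> powr p) * indicator (cball 0 1) z \<le>
        ennreal (2 powr (- p) * \<bar>a\<bar> powr p) * indicator (cball 0 1) z"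
        by (auto split: split_indicator intro!: ennreal_leI)
    qed
    also have "\<dots> = ennreal (2 powr (- p) * \<bar>a\<bar> powr p) * ennreal V"
      unfolding V_def by (subst nn_integral_cmult_indicator)
        (use emeasure_lborel_cball_finite[of "0::'a" 1] in \<open>auto simp: emeasure_eq_ennreal_measure\<close>)
    also have "\<dots> \<le> ennreal (C * \<bar>a\<bar> powr p)"
      using C0(1) by (subst ennreal_mult''[symmetric]) (auto simp: V_def C_def algebra_simps intro!: ennreal_leI)
    finally show ?thesis .
  qed
  with C that show ?thesis by blast
qed

lemma AE_lborel_dense:
  fixes U :: "'a::euclidean_space set"
  assumes "AE x in lborel. P x" "open U" "U \<noteq> {}"
  shows "\<exists>x\<in>U. P x"
proof (rule ccontr)
  assume "\<not> (\<exists>x\<in>U. P x)"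
  then have "AE x in lborel. x \<notin> U" using assms(1) by (auto elim: AE_mp)
  then have "U \<in> null_sets lborel" using assms(2) by (subst (asm) AE_iff_null_sets[symmetric]) auto
  then have "negligible U" using assms(2) by (simp add: negligible_iff_null_sets null_sets_completion_iff)
  then show False using open_not_negligible[OF assms(2,3)] by simp
qed

lemma nn_integral_cball:
  fixes F :: "'a::euclidean_space \<Rightarrow> ennreal"
  assumes [measurable]: "F \<in> borel_measurable borel" and s: "0 < s"
  shows "(\<integral>\<^sup>+x. F x * indicator (cball x0 s) x \<partial>lborel) =
    ennreal (s ^ DIM('a)) * (\<integral>\<^sup>+z. F (x0 + s *\<^sub>R z) * indicator (cball 0 1) z \<partial>lborel)"
proof -
  have [measurable]: "cball y r \<in> sets borel" for y :: 'a and r by simp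
  have "(\<integral>\<^sup>+x. F x * indicator (cball x0 s) x \<partial>lborel) =
      (\<integral>\<^sup>+x. F (x0 + x) * indicator (cball x0 s) (x0 + x) \<partial>lborel)"
    by (rule nn_integral_lborel_translate[symmetric]) measurable
  also have "\<dots> = ennreal (s ^ DIM('a)) *
      (\<integral>\<^sup>+z. F (x0 + s *\<^sub>R z) * indicator (cball x0 s) (x0 + s *\<^sub>R z) \<partial>lborel)"
    by (rule nn_integral_lborel_scale[OF _ s]) measurable
  also have "(\<lambda>z. indicator (cball x0 s) (x0 + s *\<^sub>R z) :: ennreal) = indicator (cball 0 1)"
    using s by (auto simp: fun_eq_iff dist_norm split: split_indicator)
  finally show ?thesis by (simp add: fun_eq_iff)
qed

locale sphere_measure =
  fixes \<mu> :: "'a::euclidean_space measure" and p :: real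
  assumes fin: "finite_measure \<mu>" and sets_\<mu>: "sets \<mu> = sets (restrict_space borel (sphere 0 1))"
    and p: "-1 < p" "p \<noteq> 0"
begin

sublocale finite_measure \<mu> by (rule fin)

lemma space_\<mu>: "space \<mu> = sphere 0 1"
  using sets_eq_imp_space_eq[OF sets_\<mu>] by (simp add: space_restrict_space)

lemma inner_measurable [measurable]: "(\<lambda>\<xi>. x \<bullet> \<xi>) \<in> borel_measurable \<mu>"
proof -
  have "(\<lambda>\<xi>. x \<bullet> \<xi>) \<in> borel_measurable (restrict_space borel (sphere 0 1))"
    by (intro measurable_restrict_space1) simp
  then show ?thesis using measurable_cong_sets[OF sets_\<mu> refl] by blast
qed

lemma abs_powr_measurable [measurable]: "abs_powr p \<in> borel_measurable borel"
  by (rule borel_measurable_continuous_onI) (rule continuous_on_abs_powr[OF p(2)])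

lemma id_measurable: "(\<lambda>\<xi>. \<xi>) \<in> measurable \<mu> borel"
proof -
  have "(\<lambda>\<xi>. \<xi>) \<in> measurable (restrict_space borel (sphere 0 1)) borel"
    by (intro measurable_restrict_space1) simp
  then show ?thesis using measurable_cong_sets[OF sets_\<mu> refl] by blast
qed

lemma kernel_measurable [measurable]:
  "(\<lambda>(x, \<xi>). abs_powr p (x \<bullet> \<xi>)) \<in> borel_measurable (borel \<Otimes>\<^sub>M \<mu>)"
proof -
  note [measurable] = id_measurable
  show ?thesis by measurable
qed

definition potential :: "'a \<Rightarrow> ennreal" where
  "potential x = (\<integral>\<^sup>+\<xi>. abs_powr p (x \<bullet> \<xi>) \<partial>\<mu>)"

lemma potential_measurable [measurable]: "potential \<in> borel_measurable borel"
  unfolding potential_def by measurable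

lemma potential_scale: "0 < c \<Longrightarrow> potential (c *\<^sub>R x) = ennreal (c powr p) * potential x"
  unfolding potential_def by (subst nn_integral_cmult[symmetric]) (auto simp: abs_powr_mult)

lemma nn_integral_potential:
  assumes [measurable]: "f \<in> borel_measurable borel"
  shows "(\<integral>\<^sup>+x. potential x * f x \<partial>lborel) = (\<integral>\<^sup>+\<xi>. (\<integral>\<^sup>+x. abs_powr p (x \<bullet> \<xi>) * f x \<partial>lborel) \<partial>\<mu>)"
proof -
  interpret pair_sigma_finite \<mu> lborel ..
  have "(\<integral>\<^sup>+x. potential x * f x \<partial>lborel) = (\<integral>\<^sup>+x. (\<integral>\<^sup>+\<xi>. abs_powr p (x \<bullet> \<xi>) * f x \<partial>\<mu>) \<partial>lborel)"
    unfolding potential_def by (intro nn_integral_cong nn_integral_multc[symmetric]) measurable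
  also have "\<dots> = (\<integral>\<^sup>+\<xi>. (\<integral>\<^sup>+x. abs_powr p (x \<bullet> \<xi>) * f x \<partial>lborel) \<partial>\<mu>)"
  proof (rule Fubini')
    note [measurable] = id_measurable
    show "(\<lambda>(\<xi>, x). abs_powr p (x \<bullet> \<xi>) * f x) \<in> borel_measurable (\<mu> \<Otimes>\<^sub>M lborel)" by measurable
  qed
  finally show ?thesis .
qed


text \<open>For \<open>p < 0\<close> the potential is only lower semicontinuous a priori; the reverse inequality
  comes from averaging over small balls, where \<open>|t|\<^sup>p\<close> behaves like a Muckenhoupt \<open>A\<^sub>1\<close> weight.\<close>

lemma potential_eq_gauge_near:
  assumes N: "gauge_norm N" and AE: "AE x in lborel. N x \<le> 1 \<longrightarrow> potential x = ennreal (N x powr p)"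
    and x0: "x0 \<noteq> 0" "N x0 < 1"
  shows "potential x0 = ennreal (N x0 powr p)"
proof -
  interpret gauge_norm N by (rule N)
  have "open {x. N x < 1}" by (intro open_Collect_less continuous continuous_on_const)
  then obtain e where e: "0 < e" "\<And>y. dist y x0 < e \<Longrightarrow> N y < 1"
    using x0(2) unfolding open_dist by blast
  have Nx0: "0 < N x0" by (rule pos[OF x0(1)])
  have Nlim: "(\<lambda>k. ennreal (N (y k) powr p)) \<longlonglongrightarrow> ennreal (N x0 powr p)" if "y \<longlonglongrightarrow> x0" for y :: "nat \<Rightarrow> 'a"
    using that Nx0 continuous[of UNIV]
    by (intro tendsto_ennrealI tendsto_powr tendsto_const) 
      (auto simp: continuous_on_eq_continuous_at intro: isCont_tendsto_compose)
  have alim: "(\<lambda>k. abs_powr p (y k \<bullet> \<xi>)) \<longlonglongrightarrow> abs_powr p (x0 \<bullet> \<xi>)" if "y \<longlonglongrightarrow> x0" for y :: "nat \<Rightarrow> 'a" and \<xi>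
    using continuous_on_abs_powr[OF p(2), of UNIV] that
    by (intro isCont_tendsto_compose[of _ "abs_powr p"] tendsto_intros) (auto simp: continuous_on_eq_continuous_at)
  have "\<exists>y. (dist y x0 < e \<and> dist y x0 < inverse (real (Suc k))) \<and> potential y = ennreal (N y powr p)" for k
  proof -
    have "\<exists>y\<in>ball x0 (min e (inverse (real (Suc k)))). N y \<le> 1 \<longrightarrow> potential y = ennreal (N y powr p)"
    proof (rule AE_lborel_dense[OF AE])
      have "0 < min e (inverse (real (Suc k)))" using e(1) by simp
      then show "ball x0 (min e (inverse (real (Suc k)))) \<noteq> {}" by (simp only: ball_eq_empty not_le)
    qed simp
    then obtain y where "dist x0 y < e" "dist x0 y < inverse (real (Suc k))" "N y \<le> 1 \<longrightarrow> potential y = ennreal (N y powr p)"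
      by auto
    then show ?thesis using e(2)[of y] by (intro exI[of _ y]) (auto simp: dist_commute)
  qed
  then obtain y where y: "\<And>k. dist (y k) x0 < e" "\<And>k. dist (y k) x0 < inverse (real (Suc k))"
    "\<And>k. potential (y k) = ennreal (N (y k) powr p)" by metis
  have ylim: "y \<longlonglongrightarrow> x0"
  proof (rule tendstoI)
    fix r :: real assume "0 < r"
    from order_tendstoD(2)[OF LIMSEQ_inverse_real_of_nat this]
    show "\<forall>\<^sub>F k in sequentially. dist (y k) x0 < r"
      by eventually_elim (use y(2) less_trans in blast)
  qed
  \<comment> \<open>Fatou's lemma along points \<open>y k\<close> tending to \<open>x0\<close> at
    which the equality is known.\<close>
  have upper: "potential x0 \<le> ennreal (N x0 powr p)"
  proof -
    have "potential x0 = (\<integral>\<^sup>+\<xi>. liminf (\<lambda>k. abs_powr p (y k \<bullet> \<xi>)) \<partial>\<mu>)"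
      unfolding potential_def using lim_imp_Liminf[OF _ alim[OF ylim]] by simp
    also have "\<dots> \<le> liminf (\<lambda>k. potential (y k))"
      unfolding potential_def by (rule nn_integral_liminf) measurable
    also have "\<dots> = ennreal (N x0 powr p)"
      unfolding y(3) using lim_imp_Liminf[OF _ Nlim[OF ylim]] by simp
    finally show ?thesis .
  qed
  have lower: "ennreal (N x0 powr p) \<le> potential x0"
  proof (cases "0 < p")
    case True
    have "(\<lambda>k. \<integral>\<^sup>+\<xi>. abs_powr p (y k \<bullet> \<xi>) \<partial>\<mu>) \<longlonglongrightarrow> (\<integral>\<^sup>+\<xi>. abs_powr p (x0 \<bullet> \<xi>) \<partial>\<mu>)"
    proof (rule nn_integral_dominated_convergence[where w="\<lambda>_. ennreal ((norm x0 + e) powr p)"])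
      show "AE \<xi> in \<mu>. abs_powr p (y k \<bullet> \<xi>) \<le> ennreal ((norm x0 + e) powr p)" for k
      proof (rule AE_I2)
        fix \<xi> assume "\<xi> \<in> space \<mu>"
        then have "norm \<xi> = 1" by (simp add: space_\<mu>)
        then have "\<bar>y k \<bullet> \<xi>\<bar> \<le> norm (y k)" using Cauchy_Schwarz_ineq2[of "y k" \<xi>] by simp
        also have "\<dots> \<le> norm x0 + e" using norm_triangle_sub[of "y k" x0] y(1)[of k] by (simp add: dist_norm)
        finally show "abs_powr p (y k \<bullet> \<xi>) \<le> ennreal ((norm x0 + e) powr p)"
          using True by (auto simp: abs_powr_def intro!: ennreal_leI powr_mono2)
      qed
      show "(\<integral>\<^sup>+\<xi>. ennreal ((norm x0 + e) powr p) \<partial>\<mu>) < \<infinity>"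
        using emeasure_finite[of "space \<mu>"] by (auto simp: less_top[symmetric] ennreal_mult_eq_top_iff)
      show "AE \<xi> in \<mu>. (\<lambda>k. abs_powr p (y k \<bullet> \<xi>)) \<longlonglongrightarrow> abs_powr p (x0 \<bullet> \<xi>)"
        by (intro AE_I2 alim ylim)
    qed measurable
    then have "(\<lambda>k. ennreal (N (y k) powr p)) \<longlonglongrightarrow> potential x0"
      unfolding potential_def[symmetric] y(3) .
    with Nlim[OF ylim] show ?thesis using LIMSEQ_unique by (metis order_refl)
  next
    case False
    then have p0: "p < 0" using p by simp
    \<comment> \<open>These radii stay below \<open>e\<close>, so the balls around \<open>x0\<close>
      remain in the region where the almost everywhere equality applies.\<close>
    define s where "s k = e / (2 * real (Suc k))" for k
    have s0: "0 < s k" for k using e(1) by (simp add: s_def)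
    have slim: "s \<longlonglongrightarrow> 0"
    proof -
      have "(\<lambda>k. e / 2 * inverse (real (Suc k))) \<longlonglongrightarrow> e / 2 * 0"
        by (intro tendsto_intros LIMSEQ_inverse_real_of_nat)
      also have "(\<lambda>k. e / 2 * inverse (real (Suc k))) = s" by (rule ext) (simp add: s_def field_simps)
      finally show ?thesis by simp
    qed
    have [measurable]: "cball (0::'a) 1 \<in> sets borel" "\<And>k. cball x0 (s k) \<in> sets borel" by simp_all
    define V where "V = emeasure lborel (cball (0::'a) 1)"
    have V: "V \<noteq> 0" "V \<noteq> \<infinity>"
    proof -
      show "V \<noteq> \<infinity>" using emeasure_lborel_cball_finite[of "0::'a" 1] by (simp add: V_def less_top)
      show "V \<noteq> 0" using content_cball_pos[of 1 "0::'a"] by (auto simp: V_def measure_def)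
    qed
    define g where "g k \<xi> = (\<integral>\<^sup>+z. abs_powr p ((x0 + s k *\<^sub>R z) \<bullet> \<xi>) * indicator (cball 0 1) z \<partial>lborel)" for k \<xi>
    have [measurable]: "g k \<in> borel_measurable \<mu>" for k
    proof -
      note [measurable] = id_measurable
      show ?thesis unfolding g_def by measurable
    qed
    let ?A = "\<lambda>k. \<integral>\<^sup>+z. ennreal (N (x0 + s k *\<^sub>R z) powr p) * indicator (cball 0 1) z \<partial>lborel"
    \<comment> \<open>Integrating over a ball turns the almost everywhere equality into an exact
      identity, and exchanging integrals moves the averaging onto the kernel. The factor
      \<open>s k ^ DIM('a)\<close> cancels.\<close>
    have avg: "?A k = (\<integral>\<^sup>+\<xi>. g k \<xi> \<partial>\<mu>)" for k
    proof -
      have "ennreal (s k ^ DIM('a)) * ?A k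
        = (\<integral>\<^sup>+x. ennreal (N x powr p) * indicator (cball x0 (s k)) x \<partial>lborel)"
        by (rule nn_integral_cball[symmetric, OF _ s0]) measurable
      also have "\<dots> = (\<integral>\<^sup>+x. potential x * indicator (cball x0 (s k)) x \<partial>lborel)"
      proof (rule nn_integral_cong_AE, use AE in eventually_elim)
        fix x assume *: "N x \<le> 1 \<longrightarrow> potential x = ennreal (N x powr p)"
        have "s k < e" using e(1) by (simp add: s_def divide_less_eq)
        then have "N x \<le> 1" if "x \<in> cball x0 (s k)" using that e(2)[of x] by (simp add: dist_commute)
        with * show "ennreal (N x powr p) * indicator (cball x0 (s k)) x = potential x * indicator (cball x0 (s k)) x"
          by (auto split: split_indicator)
      qed
      also have "\<dots> = (\<integral>\<^sup>+\<xi>. (\<integral>\<^sup>+x. abs_powr p (x \<bullet> \<xi>) * indicator (cball x0 (s k)) x \<partial>lborel) \<partial>\<mu>)"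
        by (rule nn_integral_potential) measurable
      also have "\<dots> = (\<integral>\<^sup>+\<xi>. ennreal (s k ^ DIM('a)) * g k \<xi> \<partial>\<mu>)"
        unfolding g_def by (intro nn_integral_cong nn_integral_cball s0) measurable
      also have "\<dots> = ennreal (s k ^ DIM('a)) * (\<integral>\<^sup>+\<xi>. g k \<xi> \<partial>\<mu>)"
        by (rule nn_integral_cmult) measurable
      finally show ?thesis using s0[of k] by (simp add: ennreal_mult_cancel_left)
    qed
    obtain C where C: "0 < C" "\<And>a (\<xi> :: 'a). norm \<xi> = 1 \<Longrightarrow> a \<noteq> 0 \<Longrightarrow>
      (\<integral>\<^sup>+z. ennreal (\<bar>a + z \<bullet> \<xi>\<bar> powr p) * indicator (cball 0 1) z \<partial>lborel) \<le> ennreal (C * \<bar>a\<bar> powr p)"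
      using ball_average_powr_le[OF p(1) p0] by blast
    have g_le: "g k \<xi> \<le> ennreal C * abs_powr p (x0 \<bullet> \<xi>)" if "\<xi> \<in> space \<mu>" for k \<xi>
    proof (cases "x0 \<bullet> \<xi> = 0")
      case True
      then show ?thesis using p0 C(1) by (simp add: abs_powr_def ennreal_mult_top)
    next
      case False
      have \<xi>: "norm \<xi> = 1" "\<xi> \<noteq> 0" using that by (auto simp: space_\<mu>)
      define a where "a = (x0 \<bullet> \<xi>) / s k"
      have a: "a \<noteq> 0" using False s0[of k] by (simp add: a_def)
      have "g k \<xi> = (\<integral>\<^sup>+z. ennreal (s k powr p) * (ennreal (\<bar>a + z \<bullet> \<xi>\<bar> powr p) * indicator (cball 0 1) z) \<partial>lborel)"
        unfolding g_def
      proof (rule nn_integral_cong_AE, use AE_affine_nonzero[OF \<xi>(2), of a] in eventually_elim)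
        fix z assume nz: "a + z \<bullet> \<xi> \<noteq> 0"
        have "(x0 + s k *\<^sub>R z) \<bullet> \<xi> = s k * (a + z \<bullet> \<xi>)"
          using s0[of k] by (simp add: a_def inner_add_left field_simps)
        then show "abs_powr p ((x0 + s k *\<^sub>R z) \<bullet> \<xi>) * indicator (cball 0 1) z =
          ennreal (s k powr p) * (ennreal (\<bar>a + z \<bullet> \<xi>\<bar> powr p) * indicator (cball 0 1) z)"
          by (simp only: abs_powr_mult[OF s0] abs_powr_nonzero[OF nz] mult.assoc)
      qed
      also have "\<dots> = ennreal (s k powr p) * (\<integral>\<^sup>+z. ennreal (\<bar>a + z \<bullet> \<xi>\<bar> powr p) * indicator (cball 0 1) z \<partial>lborel)"
        by (rule nn_integral_cmult) measurable
      also have "\<dots> \<le> ennreal (s k powr p) * ennreal (C * \<bar>a\<bar> powr p)"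
        by (intro mult_left_mono C(2) \<xi> a) simp
      also have "\<dots> = ennreal C * abs_powr p (s k * a)"
        using C(1) a s0[of k] by (simp add: abs_powr_nonzero abs_mult powr_mult ennreal_mult mult_ac)
      also have "s k * a = x0 \<bullet> \<xi>" using s0[of k] by (simp add: a_def)
      finally show ?thesis .
    qed
    have g_limsup: "limsup (\<lambda>k. g k \<xi>) \<le> V * abs_powr p (x0 \<bullet> \<xi>)" if "\<xi> \<in> space \<mu>" for \<xi>
    proof (cases "x0 \<bullet> \<xi> = 0")
      case True
      then show ?thesis using p0 V by (simp add: abs_powr_def ennreal_mult_top)
    next
      case False
      have \<xi>: "norm \<xi> = 1" "\<xi> \<noteq> 0" using that by (auto simp: space_\<mu>)
      define b where "b = \<bar>x0 \<bullet> \<xi>\<bar>"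
      have b: "0 < b" using False by (simp add: b_def)
      have "\<forall>\<^sub>F k in sequentially. g k \<xi> \<le> V * ennreal ((b - s k) powr p)"
        using order_tendstoD(2)[OF slim b]
      proof eventually_elim
        fix k assume k: "s k < b"
        have "g k \<xi> \<le> (\<integral>\<^sup>+z. ennreal ((b - s k) powr p) * indicator (cball 0 1 :: 'a set) z \<partial>lborel)"
          unfolding g_def
        proof (rule nn_integral_mono)
          fix z :: 'a
          have "abs_powr p ((x0 + s k *\<^sub>R z) \<bullet> \<xi>) \<le> ennreal ((b - s k) powr p)" if "norm z \<le> 1"
          proof -
            have "\<bar>z \<bullet> \<xi>\<bar> \<le> 1" using Cauchy_Schwarz_ineq2[of z \<xi>] \<xi> that by simp
            then have "\<bar>s k * (z \<bullet> \<xi>)\<bar> \<le> s k" using s0[of k] by (simp add: abs_mult)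
            then have "b - s k \<le> \<bar>(x0 + s k *\<^sub>R z) \<bullet> \<xi>\<bar>" by (simp add: b_def inner_add_left)
            then show ?thesis using k p0 by (subst abs_powr_nonzero) (auto intro!: ennreal_leI powr_mono2')
          qed
          then show "abs_powr p ((x0 + s k *\<^sub>R z) \<bullet> \<xi>) * indicator (cball 0 1) z \<le> ennreal ((b - s k) powr p) * indicator (cball 0 1) z"
            by (auto split: split_indicator)
        qed
        also have "\<dots> = V * ennreal ((b - s k) powr p)"
          by (subst nn_integral_cmult_indicator) (auto simp: V_def mult.commute)
        finally show "g k \<xi> \<le> V * ennreal ((b - s k) powr p)" .
      qed
      then have "limsup (\<lambda>k. g k \<xi>) \<le> limsup (\<lambda>k. V * ennreal ((b - s k) powr p))" by (rule Limsup_mono)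
      also have "\<dots> = V * ennreal ((b - 0) powr p)"
      proof (rule lim_imp_Limsup)
        show "(\<lambda>k. V * ennreal ((b - s k) powr p)) \<longlonglongrightarrow> V * ennreal ((b - 0) powr p)"
          using V b by (intro ennreal_tendsto_cmult tendsto_ennrealI tendsto_powr tendsto_diff tendsto_const slim)
            (auto simp: less_top)
      qed simp
      also have "\<dots> = V * abs_powr p (x0 \<bullet> \<xi>)" using False by (simp add: abs_powr_nonzero b_def)
      finally show ?thesis .
    qed
    have "ennreal (N x0 powr p) * V = (\<integral>\<^sup>+z. liminf (\<lambda>k. ennreal (N (x0 + s k *\<^sub>R z) powr p) * indicator (cball 0 1) z) \<partial>lborel)"
    proof -
      have "liminf (\<lambda>k. ennreal (N (x0 + s k *\<^sub>R z) powr p) * indicator (cball 0 1) z) =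
          ennreal (N x0 powr p) * indicator (cball 0 1) z" for z :: 'a
      proof (rule lim_imp_Liminf)
        have "(\<lambda>k. x0 + s k *\<^sub>R z) \<longlonglongrightarrow> x0 + 0 *\<^sub>R z" by (intro tendsto_intros slim)
        then have "(\<lambda>k. x0 + s k *\<^sub>R z) \<longlonglongrightarrow> x0" by simp
        from Nlim[OF this] show "(\<lambda>k. ennreal (N (x0 + s k *\<^sub>R z) powr p) * indicator (cball 0 1) z) \<longlonglongrightarrow>
          ennreal (N x0 powr p) * indicator (cball 0 1) z"
          by (auto split: split_indicator)
      qed simp
      then show ?thesis by (simp add: nn_integral_cmult_indicator V_def)
    qed
    also have "\<dots> \<le> liminf (\<lambda>k. ?A k)"
      by (rule nn_integral_liminf) measurable
    also have "\<dots> = liminf (\<lambda>k. \<integral>\<^sup>+\<xi>. g k \<xi> \<partial>\<mu>)" by (simp only: avg)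
    also have "\<dots> \<le> limsup (\<lambda>k. \<integral>\<^sup>+\<xi>. g k \<xi> \<partial>\<mu>)" by (rule Liminf_le_Limsup) simp
    also have "\<dots> \<le> (\<integral>\<^sup>+\<xi>. limsup (\<lambda>k. g k \<xi>) \<partial>\<mu>)"
    \<comment> \<open>Reverse Fatou. The \<open>A_1\<close> estimate provides the dominating
      function, and \<open>upper\<close> already shows that its integral is finite.\<close>
    proof (rule nn_integral_limsup[where w="\<lambda>\<xi>. ennreal C * abs_powr p (x0 \<bullet> \<xi>)"])
      show "(\<integral>\<^sup>+\<xi>. ennreal C * abs_powr p (x0 \<bullet> \<xi>) \<partial>\<mu>) < \<infinity>"
        using upper by (subst nn_integral_cmult) (auto simp: potential_def[symmetric] ennreal_mult_less_top intro: le_less_trans)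
      show "AE \<xi> in \<mu>. g k \<xi> \<le> ennreal C * abs_powr p (x0 \<bullet> \<xi>)" for k
        by (rule AE_I2) (rule g_le)
    qed measurable
    also have "\<dots> \<le> (\<integral>\<^sup>+\<xi>. V * abs_powr p (x0 \<bullet> \<xi>) \<partial>\<mu>)"
      by (rule nn_integral_mono) (rule g_limsup)
    also have "\<dots> = potential x0 * V"
      by (subst nn_integral_cmult) (auto simp: potential_def mult.commute)
    finally show ?thesis using V by (simp add: mult.commute[of _ V] ennreal_mult_le_mult_iff)
  qed
  from upper lower show ?thesis by (rule antisym)
qed

lemma potential_eq_gauge:
  assumes N: "gauge_norm N" and AE: "AE x in lborel. N x \<le> 1 \<longrightarrow> potential x = ennreal (N x powr p)"
    and x: "x \<noteq> 0"
  shows "potential x = ennreal (N x powr p)"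
proof -
  interpret gauge_norm N by (rule N)
  define c where "c = 1 / (2 * N x)"
  have Nx: "0 < N x" by (rule pos[OF x])
  have c: "0 < c" using Nx by (simp add: c_def)
  have "N (c *\<^sub>R x) < 1" using Nx by (simp add: scale c_def)
  then have "potential (c *\<^sub>R x) = ennreal (N (c *\<^sub>R x) powr p)"
    using c x by (intro potential_eq_gauge_near[OF N AE]) auto
  then have "ennreal (c powr p) * potential x = ennreal (c powr p) * ennreal (N x powr p)"
    using c Nx by (simp add: potential_scale scale powr_mult ennreal_mult)
  then show ?thesis using c by (simp add: ennreal_mult_cancel_left)
qed

end

section \<open>Test functions\<close>

text \<open>Finite unions of members of a countable base form a countable family from which every
  open set arises as an increasing union. The functions \<open>min 1 (k * dist(x, -U))\<close>
  increase to the indicator of \<open>U\<close>, so their integrals determine a finite Borel measure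
  on open sets and hence everywhere. The constant member at index 0 dominates the others, as
  \<open>cone_alternative\<close> requires of index 0.\<close>

lemma countable_test_functions:
  obtains \<phi> :: "nat \<Rightarrow> 'a::euclidean_space \<Rightarrow> real" where
    "\<phi> 0 = (\<lambda>_. 1)" "\<And>i. continuous_on UNIV (\<phi> i)" "\<And>i x. 0 \<le> \<phi> i x" "\<And>i x. \<phi> i x \<le> 1"
    "\<And>A B :: 'a measure. sets A = sets borel \<Longrightarrow> sets B = sets borel \<Longrightarrow> emeasure A UNIV < \<infinity> \<Longrightarrow>
      (\<And>i. (\<integral>\<^sup>+x. ennreal (\<phi> i x) \<partial>A) = (\<integral>\<^sup>+x. ennreal (\<phi> i x) \<partial>B)) \<Longrightarrow> A = B"
proof -
  obtain \<B> :: "'a set set" where \<B>: "countable \<B>" "topological_basis \<B>"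
    using ex_countable_basis by blast
  define \<U> where "\<U> = Union ` {F. finite F \<and> F \<subseteq> \<B>}"
  have \<U>_count: "countable \<U>" unfolding \<U>_def
    using countable_Collect_finite_subset[OF \<B>(1)] by (intro countable_image) (simp add: conj_commute)
  have \<U>_empty: "{} \<in> \<U>" unfolding \<U>_def by (intro image_eqI[of _ _ "{}"]) auto
  have \<U>_open: "open U" if "U \<in> \<U>" for U
    using that topological_basis_open[OF \<B>(2)] by (auto simp: \<U>_def)
  \<comment> \<open>\<open>UNIV\<close> is treated separately because \<open>infdist\<close> to the
    empty set is 0.\<close>
  define bump :: "'a set \<times> nat \<Rightarrow> 'a \<Rightarrow> real" where
    "bump = (\<lambda>(U, k) x. if U = UNIV then 1 else min 1 (real k * infdist x (- U)))"
  define \<phi> where "\<phi> i = (case i of 0 \<Rightarrow> (\<lambda>_. 1) | Suc j \<Rightarrow> bump (from_nat_into (\<U> \<times> (UNIV :: nat set)) j))" for i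
  have \<phi>_bump: "\<exists>i. \<phi> i = bump (U, k)" if U: "U \<in> \<U>" for U k
  proof -
    have "countable (\<U> \<times> (UNIV :: nat set))" using \<U>_count by auto
    then obtain j where "from_nat_into (\<U> \<times> (UNIV :: nat set)) j = (U, k)"
      using from_nat_into_surj[of "\<U> \<times> UNIV" "(U, k)"] U by auto
    then show ?thesis by (intro exI[of _ "Suc j"]) (simp add: \<phi>_def)
  qed
  have bump_cont: "continuous_on UNIV (bump z)" for z
    by (cases z; cases "fst z = UNIV") (auto simp: bump_def intro!: continuous_intros)
  have bump_bounds: "0 \<le> bump z x" "bump z x \<le> 1" for z x
    by (cases z; auto simp: bump_def infdist_nonneg)+
  have \<phi>: "\<phi> 0 = (\<lambda>_. 1)" "continuous_on UNIV (\<phi> i)" "0 \<le> \<phi> i x" "\<phi> i x \<le> 1" for i x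
    using bump_cont bump_bounds by (auto simp: \<phi>_def split: nat.split)
  have "A = B" if A [simp]: "sets A = sets borel" and B [simp]: "sets B = sets borel"
    and fin: "emeasure A UNIV < \<infinity>" and eq: "\<And>i. (\<integral>\<^sup>+x. ennreal (\<phi> i x) \<partial>A) = (\<integral>\<^sup>+x. ennreal (\<phi> i x) \<partial>B)"
    for A B :: "'a measure"
  proof -
    have sup: "(\<integral>\<^sup>+x. (SUP k. ennreal (bump (U, k) x)) \<partial>M) = (SUP k. \<integral>\<^sup>+x. ennreal (bump (U, k) x) \<partial>M)"
      if M: "sets M = sets borel" for U and M :: "'a measure"
    proof (rule nn_integral_monotone_convergence_SUP)
      show "incseq (\<lambda>k x. ennreal (bump (U, k) x))"
        by (intro incseq_SucI le_funI ennreal_leI)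
          (auto simp: bump_def infdist_nonneg distrib_right intro: min.coboundedI2)
      show "(\<lambda>x. ennreal (bump (U, k) x)) \<in> borel_measurable M" for k
        unfolding measurable_cong_sets[OF M refl]
        by (intro measurable_compose[OF _ measurable_ennreal] borel_measurable_continuous_onI bump_cont)
    qed
    have ind: "(SUP k. ennreal (bump (U, k) x)) = indicator U x" if "open U" for U x
    proof (cases "x \<in> U")
      case False
      then have "bump (U, k) x = 0" for k by (auto simp: bump_def)
      then show ?thesis using False by simp
    next
      case True
      have "\<exists>k. bump (U, k) x = 1"
      proof (cases "U = UNIV")
        case False
        then have "0 < infdist x (- U)"
          using that True in_closed_iff_infdist_zero[of "- U" x] infdist_nonneg[of x "- U"]
          by (auto simp: closed_Compl less_le)
        then obtain k where "1 < real k * infdist x (- U)" using reals_Archimedean3 by blast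
        then show ?thesis using False by (intro exI[of _ k]) (simp add: bump_def)
      qed (simp add: bump_def)
      then obtain k where "bump (U, k) x = 1" by blast
      then have "1 \<le> (SUP k. ennreal (bump (U, k) x))" by (intro SUP_upper2[of k]) auto
      moreover have "(SUP k. ennreal (bump (U, k) x)) \<le> 1"
        using bump_bounds by (intro SUP_least) (simp add: ennreal_le_1)
      ultimately show ?thesis using True by simp
    qed
    have open_meas: "U \<in> sets borel" if "open U" for U :: "'a set" using that by simp
    have eqU: "emeasure A U = emeasure B U" if "U \<in> \<U>" for U
    proof -
      have "(\<integral>\<^sup>+x. ennreal (bump (U, k) x) \<partial>A) = (\<integral>\<^sup>+x. ennreal (bump (U, k) x) \<partial>B)" for k
        using \<phi>_bump[OF that, of k] eq by metis
      then have "(\<integral>\<^sup>+x. indicator U x \<partial>A) = (\<integral>\<^sup>+x. indicator U x \<partial>B)"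
        using sup[OF A, of U] sup[OF B, of U] by (simp add: ind[OF \<U>_open[OF that]])
      then show ?thesis using \<U>_open[OF that] by simp
    qed
    have eq_open: "emeasure A U = emeasure B U" if U: "open U" for U
    proof (cases "U = {}")
      case False
      obtain \<C> where \<C>: "\<C> \<subseteq> \<B>" "\<Union>\<C> = U" using \<B>(2) U unfolding topological_basis_def by blast
      have ne: "\<C> \<noteq> {}" and cc: "countable \<C>" using \<C> False \<B>(1) by (auto intro: countable_subset)
      define V where "V n = (\<Union>i\<le>n. from_nat_into \<C> i)" for n :: nat
      have V\<U>: "V n \<in> \<U>" for n unfolding \<U>_def V_def
        by (intro image_eqI[of _ _ "from_nat_into \<C> ` {..n}"]) (use \<C> from_nat_into[OF ne] in auto)
      have inc: "incseq V" unfolding V_def by (intro incseq_SucI UN_mono) auto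
      have VU: "(\<Union>n. V n) = U"
      proof -
        have "(\<Union>n. V n) = \<Union>(range (from_nat_into \<C>))" unfolding V_def by auto
        then show ?thesis using range_from_nat_into[OF ne cc] \<C>(2) by simp
      qed
      have limit: "emeasure M U = (SUP n. emeasure M (V n))" if "sets M = sets borel" for M :: "'a measure"
      proof -
        have "range V \<subseteq> sets M" using that \<U>_open[OF V\<U>] by auto
        from SUP_emeasure_incseq[OF this inc] show ?thesis unfolding VU by (rule sym)
      qed
      show ?thesis unfolding limit[OF A] limit[OF B] eqU[OF V\<U>] ..
    qed simp
    show "A = B"
    proof (rule measure_eqI_generator_eq[where E="{S. open S}" and \<Omega>=UNIV and A="\<lambda>_. UNIV"])
      show "Int_stable {S :: 'a set. open S}" by (auto simp: Int_stable_def)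
    qed (use fin eq_open in \<open>auto simp: borel_def\<close>)
  qed
  then show ?thesis using that[of \<phi>] \<phi> by blast
qed

lemma AE_le_if_nn_integral_le:
  fixes S W :: "'a \<Rightarrow> ennreal"
  assumes [measurable]: "S \<in> borel_measurable M" "W \<in> borel_measurable M"
    and le: "(\<integral>\<^sup>+x. S x * indicator {x. W x < S x} x \<partial>M) \<le> (\<integral>\<^sup>+x. W x * indicator {x. W x < S x} x \<partial>M)"
    and fin: "(\<integral>\<^sup>+x. W x \<partial>M) < \<infinity>"
  shows "AE x in M. S x \<le> W x"
proof -
  let ?I = "indicator {x. W x < S x} :: 'a \<Rightarrow> ennreal"
  have W_fin: "(\<integral>\<^sup>+x. W x * ?I x \<partial>M) < \<infinity>"
    using fin by (rule le_less_trans[rotated]) (auto intro!: nn_integral_mono split: split_indicator)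
  have "(\<integral>\<^sup>+x. S x * ?I x - W x * ?I x \<partial>M) = (\<integral>\<^sup>+x. S x * ?I x \<partial>M) - (\<integral>\<^sup>+x. W x * ?I x \<partial>M)"
    using W_fin by (intro nn_integral_diff) (auto split: split_indicator intro!: AE_I2 simp: less_imp_le)
  also have "\<dots> = 0" using le W_fin by (simp add: diff_eq_0_iff_ennreal less_top)
  finally have "AE x in M. S x * ?I x - W x * ?I x = 0"
    by (subst (asm) nn_integral_0_iff_AE) auto
  moreover have "AE x in M. W x \<noteq> \<infinity>" using fin by (intro nn_integral_PInf_AE) auto
  ultimately show ?thesis
  proof eventually_elim
    fix x assume *: "S x * ?I x - W x * ?I x = 0" "W x \<noteq> \<infinity>"
    show "S x \<le> W x"
    proof (rule ccontr)
      assume "\<not> S x \<le> W x"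
      then show False using * by (auto simp: diff_eq_0_iff_ennreal not_le)
    qed
  qed
qed

section \<open>Radial projection to the boundary of the unit body\<close>

context gauge_norm
begin

definition radial_proj :: "'a \<Rightarrow> 'a" where "radial_proj x = x /\<^sub>R N x"

lemma radial_proj_measurable [measurable]: "radial_proj \<in> borel_measurable borel"
  unfolding radial_proj_def by measurable

lemma radial_proj_scale: "0 < c \<Longrightarrow> radial_proj (c *\<^sub>R x) = radial_proj x"
  by (cases "x = 0") (simp_all add: radial_proj_def scale)

lemma radial_proj_minus: "radial_proj (- x) = - radial_proj x"
  by (simp add: radial_proj_def minus)

text \<open>For functions of the same degree of homogeneity the set where one exceeds the other is a
  cone, hence up to the origin a preimage under \<open>radial_proj\<close>. Equality of the image
  measures can therefore be tested on exactly this set, in both directions.\<close>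

lemma AE_eq_if_radial_distr_eq:
  fixes S W :: "'a \<Rightarrow> ennreal"
  assumes [measurable]: "S \<in> borel_measurable borel" "W \<in> borel_measurable borel"
    and S: "\<And>c x. 0 < c \<Longrightarrow> S (c *\<^sub>R x) = ennreal (c powr p) * S x"
    and W: "\<And>c x. 0 < c \<Longrightarrow> W (c *\<^sub>R x) = ennreal (c powr p) * W x"
    and fin: "(\<integral>\<^sup>+x. W x * indicator {x. N x \<le> 1} x \<partial>lborel) < \<infinity>"
    and eq: "distr (density lborel (\<lambda>x. S x * indicator {x. N x \<le> 1} x)) borel radial_proj =
      distr (density lborel (\<lambda>x. W x * indicator {x. N x \<le> 1} x)) borel radial_proj"
  shows "AE x in lborel. N x \<le> 1 \<longrightarrow> S x = W x"
proof -
  let ?I = "indicator {x. N x \<le> 1} :: 'a \<Rightarrow> ennreal"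
  have int: "(\<integral>\<^sup>+x. S x * ?I x * indicator E (radial_proj x) \<partial>lborel) = (\<integral>\<^sup>+x. W x * ?I x * indicator E (radial_proj x) \<partial>lborel)"
    if [measurable]: "E \<in> sets borel" for E
  proof -
    have "emeasure (distr (density lborel (\<lambda>x. F x * ?I x)) borel radial_proj) E =
        (\<integral>\<^sup>+x. F x * ?I x * indicator E (radial_proj x) \<partial>lborel)"
      if [measurable]: "F \<in> borel_measurable borel" for F
    proof -
      have "emeasure (distr (density lborel (\<lambda>x. F x * ?I x)) borel radial_proj) E =
        (\<integral>\<^sup>+x. indicator E x \<partial>distr (density lborel (\<lambda>x. F x * ?I x)) borel radial_proj)" by simp
      also have "\<dots> = (\<integral>\<^sup>+x. F x * ?I x * indicator E (radial_proj x) \<partial>lborel)"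
        by (subst nn_integral_distr; (subst nn_integral_density)?) auto
      finally show ?thesis .
    qed
    from this[of S] this[of W] show ?thesis using eq by simp
  qed
  have cone: "F (radial_proj x) < G (radial_proj x) \<longleftrightarrow> F x < G x"
    if x: "x \<noteq> 0" and F: "\<And>c x. 0 < c \<Longrightarrow> F (c *\<^sub>R x) = ennreal (c powr p) * F x"
      and G: "\<And>c x. 0 < c \<Longrightarrow> G (c *\<^sub>R x) = ennreal (c powr p) * G x" for F G :: "'a \<Rightarrow> ennreal" and x
  proof -
    have c: "0 < inverse (N x)" using pos[OF x] by simp
    show ?thesis unfolding radial_proj_def F[OF c] G[OF c]
      using c by (simp add: not_le[symmetric] ennreal_mult_le_mult_iff)
  qed
  have AE0: "AE x in lborel. x \<noteq> (0 :: 'a)" using AE_lborel_singleton[of 0] by simp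
  have le: "AE x in lborel. F x * ?I x \<le> G x * ?I x"
    if [measurable]: "F \<in> borel_measurable borel" "G \<in> borel_measurable borel"
      and F: "\<And>c x. 0 < c \<Longrightarrow> F (c *\<^sub>R x) = ennreal (c powr p) * F x"
      and G: "\<And>c x. 0 < c \<Longrightarrow> G (c *\<^sub>R x) = ennreal (c powr p) * G x"
      and G_fin: "(\<integral>\<^sup>+x. G x * ?I x \<partial>lborel) < \<infinity>"
      and FG: "\<And>E. E \<in> sets borel \<Longrightarrow> (\<integral>\<^sup>+x. F x * ?I x * indicator E (radial_proj x) \<partial>lborel) =
        (\<integral>\<^sup>+x. G x * ?I x * indicator E (radial_proj x) \<partial>lborel)" for F G
  proof (rule AE_le_if_nn_integral_le)
    define E where "E = {x. G x < F x}"
    have [measurable]: "E \<in> sets borel" unfolding E_def by measurable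
    have red: "(\<integral>\<^sup>+x. H x * ?I x * indicator {x. G x * ?I x < F x * ?I x} x \<partial>lborel) =
      (\<integral>\<^sup>+x. H x * ?I x * indicator E (radial_proj x) \<partial>lborel)" for H
      by (rule nn_integral_cong_AE, use AE0 in eventually_elim)
        (auto simp: E_def cone[OF _ G F] split: split_indicator)
    show "(\<integral>\<^sup>+x. F x * ?I x * indicator {x. G x * ?I x < F x * ?I x} x \<partial>lborel)
       \<le> (\<integral>\<^sup>+x. G x * ?I x * indicator {x. G x * ?I x < F x * ?I x} x \<partial>lborel)"
      unfolding red using FG[of E] by simp
  qed (use G_fin in auto)
  have "(\<integral>\<^sup>+x. S x * ?I x \<partial>lborel) < \<infinity>" using int[of UNIV] fin by simp
  from le[of W S, OF _ _ W S this int[symmetric]] le[of S W, OF _ _ S W fin int]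
  have "AE x in lborel. W x * ?I x \<le> S x * ?I x" "AE x in lborel. S x * ?I x \<le> W x * ?I x" by simp_all
  then show ?thesis by eventually_elim (auto split: split_indicator)
qed

end

section \<open>The separating function\<close>

context gauge_norm
begin

abbreviation "unit_body \<equiv> {x. N x \<le> 1}"

abbreviation "body_integral f \<equiv> LINT x|lborel. indicator unit_body x * f x"

lemma unit_body_borel: obtains R where "bounded_borel unit_body R"
proof -
  obtain R where "\<And>x. x \<in> unit_body \<Longrightarrow> norm x \<le> R" using bounded_unit unfolding bounded_iff by blast
  moreover have "unit_body \<in> sets borel" by (intro borel_compact compact_unit)
  ultimately have "bounded_borel unit_body R" by unfold_locales auto
  then show ?thesis using that by blast
qed

lemma AE_unit_body_exists:
  assumes "AE x in lborel. P x"
  shows "\<exists>x\<in>unit_body. P x"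
proof -
  have "\<exists>x\<in>{x. N x < 1}. P x"
  proof (rule AE_lborel_dense[OF assms])
    show "open {x. N x < 1}" by (intro open_Collect_less continuous continuous_on_const)
    have "0 \<in> {x. N x < 1}" by simp
    then show "{x. N x < 1} \<noteq> {}" by blast
  qed
  then show ?thesis by force
qed

lemma kernel_integrable:
  assumes "-1 < p" "v \<noteq> 0" "h \<in> borel_measurable borel" "\<And>x. \<bar>h x\<bar> \<le> B"
  shows "integrable lborel (\<lambda>x. indicator unit_body x * (\<bar>x \<bullet> v\<bar> powr p * h x))"
proof -
  obtain R where "bounded_borel unit_body R" by (rule unit_body_borel)
  from bounded_borel.integrable_kernel[OF this assms] show ?thesis .
qed

lemma kernel_integral_pos:
  assumes p: "-1 < p" and v: "v \<noteq> 0"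
  shows "0 < body_integral (\<lambda>x. \<bar>x \<bullet> v\<bar> powr p)"
proof (rule ccontr)
  assume "\<not> 0 < body_integral (\<lambda>x. \<bar>x \<bullet> v\<bar> powr p)"
  moreover have "0 \<le> body_integral (\<lambda>x. \<bar>x \<bullet> v\<bar> powr p)"
    by (intro Bochner_Integration.integral_nonneg) auto
  ultimately have zero: "body_integral (\<lambda>x. \<bar>x \<bullet> v\<bar> powr p) = 0" by simp
  have "integrable lborel (\<lambda>x. indicator unit_body x * \<bar>x \<bullet> v\<bar> powr p)"
    using kernel_integrable[OF p v, of "\<lambda>_. 1" 1] by simp
  from integral_nonneg_eq_0_iff_AE[OF this] zero
  have "AE x in lborel. indicator unit_body x * \<bar>x \<bullet> v\<bar> powr p = 0" by simp
  with AE_inner_nonzero[OF v]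
  have "AE x in lborel. indicator unit_body x * \<bar>x \<bullet> v\<bar> powr p = 0 \<and> x \<bullet> v \<noteq> 0"
    by eventually_elim simp
  from AE_unit_body_exists[OF this] show False by auto
qed

text \<open>\<open>radial_integral\<close> with both norms equal to \<open>N\<close> and \<beta> = n
  + p. Its main use is finiteness of the integral of \<open>N^p\<close>, whose integrand is
  unbounded near 0 for p < 0.\<close>

lemma nn_integral_gauge_powr:
  assumes "- real DIM('a) < p"
  shows "emeasure lborel unit_body = ennreal ((real DIM('a) + p) / real DIM('a)) *
    (\<integral>\<^sup>+x. ennreal (N x powr p) * indicator unit_body x \<partial>lborel)"
proof -
  have "emeasure lborel unit_body = (\<integral>\<^sup>+x. 1 * indicator unit_body x \<partial>lborel)"
    using compact_unit(1) by (simp add: borel_compact)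
  also have "\<dots> = ennreal ((real DIM('a) + p) / (real DIM('a) + 0)) *
    (\<integral>\<^sup>+x. 1 * ennreal (N x powr (real DIM('a) + p) * N x powr - (real DIM('a) + 0)) * indicator unit_body x \<partial>lborel)"
    by (rule radial_integral) (use pos assms in \<open>auto simp: scale\<close>)
  also have "(\<lambda>x. N x powr (real DIM('a) + p) * N x powr - (real DIM('a) + 0)) = (\<lambda>x. N x powr p)"
    by (simp add: powr_add[symmetric])
  finally show ?thesis by (simp add: fun_eq_iff)
qed

lemma nn_integral_gauge_powr_finite:
  assumes "- real DIM('a) < p"
  shows "(\<integral>\<^sup>+x. ennreal (N x powr p) * indicator unit_body x \<partial>lborel) < \<infinity>"
proof -
  obtain R where "bounded_borel unit_body R" by (rule unit_body_borel)
  then have "emeasure lborel unit_body < \<infinity>" by (rule bounded_borel.emeasure_finite)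
  then show ?thesis unfolding nn_integral_gauge_powr[OF assms]
    using assms by (auto simp: ennreal_mult_less_top ennreal_eq_0_iff divide_le_0_iff)
qed

lemma integrable_gauge_powr:
  assumes "- real DIM('a) < p" and h: "h \<in> borel_measurable borel" "\<And>x. \<bar>h x\<bar> \<le> B"
  shows "integrable lborel (\<lambda>x. indicator unit_body x * (N x powr p * h x))"
proof (rule Bochner_Integration.integrable_bound)
  have [measurable]: "unit_body \<in> sets borel" by (intro borel_compact compact_unit)
  note [measurable] = h(1)
  have "integrable lborel (\<lambda>x. indicator unit_body x * N x powr p)"
    using nn_integral_gauge_powr_finite[OF assms(1)]
    by (intro integrableI_nonneg) (auto simp: ennreal_mult' ennreal_indicator mult.commute)
  then show "integrable lborel (\<lambda>x. B * (indicator unit_body x * N x powr p))" by simp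
  show "AE x in lborel. norm (indicator unit_body x * (N x powr p * h x)) \<le> norm (B * (indicator unit_body x * N x powr p))"
  proof (rule AE_I2)
    fix x
    have "\<bar>h x\<bar> \<le> \<bar>B\<bar>" using h(2)[of x] by linarith
    then show "norm (indicator unit_body x * (N x powr p * h x)) \<le> norm (B * (indicator unit_body x * N x powr p))"
      by (auto simp: abs_mult mult.commute intro!: mult_right_mono split: split_indicator)
  qed
  show "(\<lambda>x. indicator unit_body x * (N x powr p * h x)) \<in> borel_measurable lborel" by measurable
qed

text \<open>The embedding measure is \<open>m\<close> times the image of \<open>Q\<close> under
  \<open>\<xi>\<close>. By Fubini the hypothesis says that its potential and \<open>N^p\<close> have
  the same integrals against all radially projected test functions; so the two densities have equal
  images on the boundary, agree almost everywhere by homogeneity, and then agree at every nonzero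
  point.\<close>

lemma embeds_if_test_integrals_eq:
  fixes \<phi> :: "nat \<Rightarrow> 'a \<Rightarrow> real"
  assumes p: "-1 < p" "p \<noteq> 0"
    and \<phi>: "\<And>i. continuous_on UNIV (\<phi> i)" "\<And>i x. 0 \<le> \<phi> i x" "\<And>i x. \<phi> i x \<le> 1"
    and determine: "\<And>A B :: 'a measure. sets A = sets borel \<Longrightarrow> sets B = sets borel \<Longrightarrow> emeasure A UNIV < \<infinity> \<Longrightarrow>
      (\<And>i. (\<integral>\<^sup>+x. ennreal (\<phi> i x) \<partial>A) = (\<integral>\<^sup>+x. ennreal (\<phi> i x) \<partial>B)) \<Longrightarrow> A = B"
    and \<xi>: "\<And>t. isCont \<xi> t" "\<And>t. norm (\<xi> t) = 1"
    and Q: "real_distribution Q" and m: "0 \<le> m"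
    and eq: "\<And>i. (body_integral (\<lambda>x. N x powr p * \<phi> i (radial_proj x))) =
      m * (LINT t|Q. LINT x|lborel. indicator unit_body x * (\<bar>x \<bullet> \<xi> t\<bar> powr p * \<phi> i (radial_proj x)))"
  shows "embeds_in_Lp p N"
proof -
  obtain R where "bounded_borel unit_body R" by (rule unit_body_borel)
  then interpret L: bounded_borel unit_body R .
  interpret Q: real_distribution Q by (rule Q)
  define h where "h i x = \<phi> i (radial_proj x)" for i x
  have \<phi>_meas [measurable]: "\<phi> i \<in> borel_measurable borel" for i
    by (rule borel_measurable_continuous_onI) (rule \<phi>(1))
  have h_meas [measurable]: "h i \<in> borel_measurable borel" for i unfolding h_def by measurable
  have h_nonneg: "0 \<le> h i x" and h_le: "\<bar>h i x\<bar> \<le> 1" for i x using \<phi> by (auto simp: h_def)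
  have n: "- real DIM('a) < p" using p(1) by (smt (verit) DIM_positive of_nat_1 of_nat_mono One_nat_def Suc_leI)
  define S where "S = restrict_space borel (sphere (0::'a) 1)"
  have \<xi>_borel [measurable]: "\<xi> \<in> borel_measurable borel"
    using \<xi>(1) by (intro borel_measurable_continuous_onI) (simp add: continuous_at_imp_continuous_on)
  have \<xi>_meas: "\<xi> \<in> measurable Q S"
    unfolding S_def using \<xi>(2) by (intro measurable_restrict_space2) auto
  define \<mu> where "\<mu> = scale_measure (ennreal m) (distr Q S \<xi>)"
  have nn\<mu>: "(\<integral>\<^sup>+v. f v \<partial>\<mu>) = ennreal m * (\<integral>\<^sup>+t. f (\<xi> t) \<partial>Q)" if "f \<in> borel_measurable S" for f
    unfolding \<mu>_def using that by (simp add: nn_integral_scale_measure nn_integral_distr[OF \<xi>_meas])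
  have sets_\<mu>: "sets \<mu> = sets S" by (simp add: \<mu>_def)
  have fin\<mu>: "finite_measure \<mu>"
  proof
    have "emeasure (distr Q S \<xi>) (space S) \<le> 1"
      using \<xi>_meas by (subst emeasure_distr) (auto intro: Q.emeasure_le_1)
    then show "emeasure \<mu> (space \<mu>) \<noteq> \<infinity>"
      by (simp add: \<mu>_def space_scale_measure ennreal_mult_eq_top_iff) (metis ennreal_one_less_top leD)
  qed
  interpret \<mu>: sphere_measure \<mu> p
    by (rule sphere_measure.intro) (use fin\<mu> sets_\<mu> p in \<open>simp_all add: S_def\<close>)
  let ?I = "indicator unit_body :: 'a \<Rightarrow> ennreal"
  have int_w: "(\<integral>\<^sup>+x. ennreal (N x powr p) * ?I x * ennreal (h i x) \<partial>lborel) =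
      ennreal (body_integral (\<lambda>x. N x powr p * h i x))" for i
  proof -
    have "(\<integral>\<^sup>+x. ennreal (N x powr p) * ?I x * ennreal (h i x) \<partial>lborel) =
      (\<integral>\<^sup>+x. ennreal (indicator unit_body x * (N x powr p * h i x)) \<partial>lborel)"
      by (intro nn_integral_cong) (auto simp: ennreal_mult' h_nonneg split: split_indicator)
    also have "\<dots> = ennreal (body_integral (\<lambda>x. N x powr p * h i x))"
      by (intro nn_integral_eq_integral integrable_gauge_powr[OF n _ h_le]) (auto simp: h_nonneg)
    finally show ?thesis .
  qed
  have inner: "(\<integral>\<^sup>+x. abs_powr p (x \<bullet> v) * (?I x * ennreal (h i x)) \<partial>lborel) = ennreal (L.cosine_transform p (h i) v)"
    if "norm v = 1" for v i
  proof -
    have "v \<noteq> 0" using that by auto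
    have "(\<integral>\<^sup>+x. abs_powr p (x \<bullet> v) * (?I x * ennreal (h i x)) \<partial>lborel) =
      (\<integral>\<^sup>+x. ennreal (indicator unit_body x * (\<bar>x \<bullet> v\<bar> powr p * h i x)) \<partial>lborel)"
      by (rule nn_integral_cong_AE, use AE_inner_nonzero[OF \<open>v \<noteq> 0\<close>] in eventually_elim)
        (auto simp: ennreal_mult' h_nonneg abs_powr_nonzero split: split_indicator)
    also have "\<dots> = ennreal (L.cosine_transform p (h i) v)"
      unfolding L.cosine_transform_def
      by (intro nn_integral_eq_integral L.integrable_kernel_unit[OF p(1) that _ h_le]) (auto simp: h_nonneg)
    finally show ?thesis .
  qed
  have int_S: "(\<integral>\<^sup>+x. \<mu>.potential x * ?I x * ennreal (h i x) \<partial>lborel) =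
      ennreal (body_integral (\<lambda>x. N x powr p * h i x))" for i
  proof -
    have cont: "continuous_on UNIV (\<lambda>t. L.cosine_transform p (h i) (\<xi> t))"
      by (rule continuous_on_compose2[OF L.continuous_on_cosine_transform[OF p h_meas h_le]])
        (use \<xi> in \<open>auto simp: continuous_at_imp_continuous_on\<close>)
    have T0: "0 \<le> L.cosine_transform p (h i) v" for v
      unfolding L.cosine_transform_def by (intro Bochner_Integration.integral_nonneg) (auto simp: h_nonneg)
    obtain C where C: "\<And>v. norm v = 1 \<Longrightarrow> L.cosine_transform p (h i) v \<le> C"
    proof -
      have "bounded (L.cosine_transform p (h i) ` sphere 0 1)"
        by (intro compact_imp_bounded compact_continuous_image L.continuous_on_cosine_transform[OF p h_meas h_le]) auto
      then obtain C where "\<forall>y\<in>L.cosine_transform p (h i) ` sphere 0 1. norm y \<le> C" unfolding bounded_iff by blast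
      then have "L.cosine_transform p (h i) v \<le> C" if "norm v = 1" for v using that by (force simp: abs_le_iff)
      with that show ?thesis by blast
    qed
    have intQ: "integrable Q (\<lambda>t. L.cosine_transform p (h i) (\<xi> t))"
      by (rule Q.integrable_const_bound[where B=C])
        (use C \<xi> T0 borel_measurable_continuous_onI[OF cont] in auto)
    have "(\<integral>\<^sup>+x. \<mu>.potential x * ?I x * ennreal (h i x) \<partial>lborel) =
      (\<integral>\<^sup>+x. \<mu>.potential x * (?I x * ennreal (h i x)) \<partial>lborel)" by (simp add: mult.assoc)
    also have "\<dots> = (\<integral>\<^sup>+v. (\<integral>\<^sup>+x. abs_powr p (x \<bullet> v) * (?I x * ennreal (h i x)) \<partial>lborel) \<partial>\<mu>)"
      by (rule \<mu>.nn_integral_potential) measurable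
    also have "\<dots> = (\<integral>\<^sup>+v. ennreal (L.cosine_transform p (h i) v) \<partial>\<mu>)"
      by (intro nn_integral_cong inner) (simp add: \<mu>.space_\<mu>)
    also have "\<dots> = ennreal m * (\<integral>\<^sup>+t. ennreal (L.cosine_transform p (h i) (\<xi> t)) \<partial>Q)"
    proof (rule nn\<mu>)
      show "(\<lambda>v. ennreal (L.cosine_transform p (h i) v)) \<in> borel_measurable S"
        unfolding S_def using L.continuous_on_cosine_transform[OF p h_meas h_le]
        by (intro measurable_compose[OF _ measurable_ennreal] borel_measurable_continuous_on_restrict)
    qed
    also have "\<dots> = ennreal (m * (LINT t|Q. L.cosine_transform p (h i) (\<xi> t)))"
      using intQ T0 m by (simp add: nn_integral_eq_integral ennreal_mult')
    also have "\<dots> = ennreal (body_integral (\<lambda>x. N x powr p * h i x))"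
      using eq[of i] by (simp add: L.cosine_transform_def h_def)
    finally show ?thesis .
  qed
  have distr: "(\<integral>\<^sup>+x. ennreal (\<phi> i x) \<partial>distr (density lborel (\<lambda>x. F x * ?I x)) borel radial_proj) =
      (\<integral>\<^sup>+x. F x * ?I x * ennreal (h i x) \<partial>lborel)"
    if [measurable]: "F \<in> borel_measurable borel" for F i
    unfolding h_def by (subst nn_integral_distr; (subst nn_integral_density)?) auto
  have "distr (density lborel (\<lambda>x. ennreal (N x powr p) * ?I x)) borel radial_proj =
      distr (density lborel (\<lambda>x. \<mu>.potential x * ?I x)) borel radial_proj"
  proof (rule determine)
    show "emeasure (distr (density lborel (\<lambda>x. ennreal (N x powr p) * ?I x)) borel radial_proj) UNIV < \<infinity>"
      using nn_integral_gauge_powr_finite[OF n] by (subst emeasure_distr) (auto simp: emeasure_density)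
    show "(\<integral>\<^sup>+x. ennreal (\<phi> i x) \<partial>distr (density lborel (\<lambda>x. ennreal (N x powr p) * ?I x)) borel radial_proj) =
       (\<integral>\<^sup>+x. ennreal (\<phi> i x) \<partial>distr (density lborel (\<lambda>x. \<mu>.potential x * ?I x)) borel radial_proj)" for i
      by (subst (1 2) distr) (simp_all add: int_w int_S)
  qed auto
  then have "AE x in lborel. N x \<le> 1 \<longrightarrow> \<mu>.potential x = ennreal (N x powr p)"
    by (intro AE_eq_if_radial_distr_eq[where p=p] nn_integral_gauge_powr_finite[OF n])
      (auto simp: \<mu>.potential_scale scale powr_mult nonneg ennreal_mult)
  then have "ennreal (N x powr p) = (\<integral>\<^sup>+ v. abs_powr p (x \<bullet> v) \<partial>\<mu>)" if "x \<noteq> 0" for x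
    using \<mu>.potential_eq_gauge[OF gauge_norm_axioms _ that] by (simp add: \<mu>.potential_def)
  then show ?thesis unfolding embeds_in_Lp_def using fin\<mu> sets_\<mu> by (intro exI[of _ \<mu>]) (auto simp: S_def)
qed

text \<open>The first outcome of \<open>cone_alternative\<close> would produce an embedding, so the
  second holds. Its finite combination of test functions, composed with \<open>radial_proj\<close>
  and symmetrised, is \<open>h\<close>. Invariance under all \<open>c \<noteq> 0\<close> includes
  evenness.\<close>

lemma separation:
  assumes p: "-1 < p" "p \<noteq> 0" and not: "\<not> embeds_in_Lp p N"
  obtains h B \<kappa> where "h \<in> borel_measurable borel" "\<And>x. \<bar>h x\<bar> \<le> B" "\<And>c x. c \<noteq> 0 \<Longrightarrow> h (c *\<^sub>R x) = h x"
    "continuous_on (- {0}) h" "0 < \<kappa>"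
    "\<And>v. v \<noteq> 0 \<Longrightarrow> \<kappa> * body_integral (\<lambda>x. \<bar>x \<bullet> v\<bar> powr p) \<le>
       body_integral (\<lambda>x. \<bar>x \<bullet> v\<bar> powr p * h x)"
    "body_integral (\<lambda>x. N x powr p * h x) < 0"
proof -
  obtain R where "bounded_borel unit_body R" by (rule unit_body_borel)
  then interpret L: bounded_borel unit_body R .
  have n: "- real DIM('a) < p" using p(1) by (smt (verit) DIM_positive of_nat_1 of_nat_mono One_nat_def Suc_leI)
  obtain \<phi> :: "nat \<Rightarrow> 'a \<Rightarrow> real" where \<phi>0: "\<phi> 0 = (\<lambda>_. 1)"
    and \<phi>: "\<And>i. continuous_on UNIV (\<phi> i)" "\<And>i x. 0 \<le> \<phi> i x" "\<And>i x. \<phi> i x \<le> 1"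
    and determine: "\<And>A B :: 'a measure. sets A = sets borel \<Longrightarrow> sets B = sets borel \<Longrightarrow> emeasure A UNIV < \<infinity> \<Longrightarrow>
      (\<And>i. (\<integral>\<^sup>+x. ennreal (\<phi> i x) \<partial>A) = (\<integral>\<^sup>+x. ennreal (\<phi> i x) \<partial>B)) \<Longrightarrow> A = B"
    using countable_test_functions by blast
  obtain \<xi> :: "real \<Rightarrow> 'a" where \<xi>: "\<And>t. isCont \<xi> t" "\<And>t. norm (\<xi> t) = 1"
    "\<And>x. x \<noteq> 0 \<Longrightarrow> \<exists>t\<in>{0..1}. \<exists>c. x = c *\<^sub>R \<xi> t"
    using sphere_curve by blast
  define h where "h i x = \<phi> i (radial_proj x)" for i x
  have [measurable]: "\<phi> i \<in> borel_measurable borel" for i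
    by (rule borel_measurable_continuous_onI) (rule \<phi>(1))
  have h_meas [measurable]: "h i \<in> borel_measurable borel" for i unfolding h_def by measurable
  have h_nonneg: "0 \<le> h i x" and h_le: "\<bar>h i x\<bar> \<le> 1" and h_le1: "h i x \<le> 1" for i x using \<phi> by (auto simp: h_def)
  have h0: "h 0 x = 1" for x by (simp add: h_def \<phi>0)
  define T where "T i t = L.cosine_transform p (h i) (\<xi> t)" for i t
  define w where "w i = body_integral (\<lambda>x. N x powr p * h i x)" for i
  have int_T: "integrable lborel (\<lambda>x. indicator unit_body x * (\<bar>x \<bullet> v\<bar> powr p * h i x))" if "norm v = 1" for i v
    by (rule L.integrable_kernel_unit[OF p(1) that h_meas h_le])
  have int_w: "integrable lborel (\<lambda>x. indicator unit_body x * (N x powr p * h i x))" for i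
    by (rule integrable_gauge_powr[OF n h_meas h_le])
  have cont_T: "continuous_on (sphere 0 1) (L.cosine_transform p (h i))" for i
    by (rule L.continuous_on_cosine_transform[OF p h_meas h_le])
  have "continuous_on UNIV (T i)" for i
    unfolding T_def
    by (rule continuous_on_compose2[OF cont_T]) (use \<xi> in \<open>auto simp: continuous_at_imp_continuous_on\<close>)
  then have T_cont: "isCont (T i) t" for i t by (simp add: continuous_on_eq_continuous_at)
  have T_nonneg: "0 \<le> T i t" for i t
    unfolding T_def L.cosine_transform_def by (intro Bochner_Integration.integral_nonneg) (auto simp: h_nonneg)
  have T_le: "T i t \<le> T 0 t" for i t
    unfolding T_def L.cosine_transform_def h0
  proof (rule Bochner_Integration.integral_mono)
    show "integrable lborel (\<lambda>x. indicator unit_body x * (\<bar>x \<bullet> \<xi> t\<bar> powr p * 1))" using int_T[of "\<xi> t" 0] \<xi>(2) by (simp add: h0)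
    show "indicator unit_body x * (\<bar>x \<bullet> \<xi> t\<bar> powr p * h i x) \<le> indicator unit_body x * (\<bar>x \<bullet> \<xi> t\<bar> powr p * 1)" for x
      by (intro mult_left_mono h_le1) auto
  qed (rule int_T, rule \<xi>(2))
  have ne: "sphere (0::'a) 1 \<noteq> {}" using \<xi>(2)[of 0] by (metis empty_iff mem_sphere_0)
  obtain u1 where u1: "norm u1 = 1" "\<And>v. norm v = 1 \<Longrightarrow> L.cosine_transform p (h 0) v \<le> L.cosine_transform p (h 0) u1"
    using continuous_attains_sup[OF compact_sphere ne cont_T[of 0]] by auto
  obtain u0 where u0: "norm u0 = 1" "\<And>v. norm v = 1 \<Longrightarrow> L.cosine_transform p (h 0) u0 \<le> L.cosine_transform p (h 0) v"
    using continuous_attains_inf[OF compact_sphere ne cont_T[of 0]] by auto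
  \<comment> \<open>The minimum over the compact sphere is attained, hence positive; it is the lower
    bound \<open>c\<close> that \<open>cone_alternative\<close> needs.\<close>
  have pos0: "0 < L.cosine_transform p (h 0) u0"
    using kernel_integral_pos[OF p(1), of u0] u0(1) by (force simp: L.cosine_transform_def h0)
  have w_nonneg: "0 \<le> w i" for i unfolding w_def by (intro Bochner_Integration.integral_nonneg) (auto simp: h_nonneg)
  have w_le: "w i \<le> w 0" for i
    unfolding w_def h0
  proof (rule Bochner_Integration.integral_mono)
    show "integrable lborel (\<lambda>x. indicator unit_body x * (N x powr p * 1))" using int_w[of 0] by (simp add: h0)
    show "indicator unit_body x * (N x powr p * h i x) \<le> indicator unit_body x * (N x powr p * 1)" for x
      by (intro mult_left_mono h_le1) auto
  qed (rule int_w)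
  have "\<not> (\<exists>m Q. 0 \<le> m \<and> real_distribution Q \<and> (\<forall>i. w i = m * integral\<^sup>L Q (T i)))"
  proof
    assume "\<exists>m Q. 0 \<le> m \<and> real_distribution Q \<and> (\<forall>i. w i = m * integral\<^sup>L Q (T i))"
    then obtain m Q where mQ: "0 \<le> m" "real_distribution Q" "\<And>i. w i = m * integral\<^sup>L Q (T i)" by blast
    have "embeds_in_Lp p N"
    proof (rule embeds_if_test_integrals_eq[OF p \<phi> determine \<xi>(1,2) mQ(2,1)])
      show "body_integral (\<lambda>x. N x powr p * \<phi> i (radial_proj x)) =
        m * (LINT t|Q. LINT x|lborel. indicator unit_body x * (\<bar>x \<bullet> \<xi> t\<bar> powr p * \<phi> i (radial_proj x)))" for i
        using mQ(3)[of i] by (simp add: w_def T_def[abs_def] L.cosine_transform_def h_def)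
    qed
    with not show False by simp
  qed
  moreover have "(\<exists>m Q. 0 \<le> m \<and> real_distribution Q \<and> (\<forall>i. w i = m * integral\<^sup>L Q (T i))) \<or>
    (\<exists>k a \<kappa>. 0 < \<kappa> \<and> (\<forall>t\<in>{0..1}. \<kappa> * T 0 t \<le> (\<Sum>i<k. a i * T i t)) \<and> (\<Sum>i<k. a i * w i) < 0)"
  proof (rule cone_alternative[OF T_cont _ _ _ pos0])
    show "\<bar>T i t\<bar> \<le> T 0 t" for i t using T_nonneg T_le by (simp add: abs_of_nonneg)
    show "T 0 t \<le> L.cosine_transform p (h 0) u1" for t unfolding T_def by (intro u1 \<xi>)
    show "L.cosine_transform p (h 0) u0 \<le> T 0 t" for t unfolding T_def by (intro u0 \<xi>)
    show "\<bar>w i\<bar> \<le> w 0" for i using w_nonneg w_le by (simp add: abs_of_nonneg)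
  qed
  ultimately obtain k a \<kappa> where \<kappa>: "0 < \<kappa>" "\<And>t. t \<in> {0..1} \<Longrightarrow> \<kappa> * T 0 t \<le> (\<Sum>i<k. a i * T i t)"
    "(\<Sum>i<k. a i * w i) < 0" by blast
  \<comment> \<open>Symmetrising makes \<open>g\<close> even and, by \<open>symm\<close>, leaves its
    integrals against even functions unchanged; both \<open>\<bar>x \<bullet> v\<bar> powr p\<close>
    and \<open>N x powr p\<close> are even.\<close>
  define g where "g x = (\<Sum>i<k. a i * ((h i x + h i (- x)) / 2))" for x
  have reflect: "(LINT x|lborel. F (- x)) = (LINT x|lborel. F x)" if "F \<in> borel_measurable borel" for F :: "'a \<Rightarrow> real"
  proof -
    have "(LINT x|lborel. F x) = (LINT x|distr lborel borel uminus. F x)"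
      using lborel_affine[of "-1" "0::'a"] by (simp add: density_1)
    also have "\<dots> = (LINT x|lborel. F (- x))" using that by (intro integral_distr) auto
    finally show ?thesis by simp
  qed
  have symm: "(LINT x|lborel. F x * g x) = (\<Sum>i<k. a i * (LINT x|lborel. F x * h i x))"
    if F: "F \<in> borel_measurable borel" "\<And>x. F (- x) = F x" "\<And>i. integrable lborel (\<lambda>x. F x * h i x)" for F
  proof -
    note [measurable] = F(1)
    have ref: "(LINT x|lborel. F x * h i (- x)) = (LINT x|lborel. F x * h i x)" for i
      using reflect[of "\<lambda>x. F x * h i x"] by (simp add: F(2))
    have int: "integrable lborel (\<lambda>x. F x * h i (- x))" for i
    proof -
      have "integrable (distr lborel borel uminus) (\<lambda>x. F x * h i x)"
        using F(3)[of i] lborel_affine[of "-1" "0::'a"] by (simp add: density_1)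
      then show ?thesis by (subst (asm) integrable_distr_eq) (simp_all add: F(2))
    qed
    have "(LINT x|lborel. F x * g x) = (LINT x|lborel. (\<Sum>i<k. a i / 2 * (F x * h i x + F x * h i (- x))))"
      unfolding g_def by (intro Bochner_Integration.integral_cong refl) (simp add: sum_distrib_left field_simps)
    also have "\<dots> = (\<Sum>i<k. (LINT x|lborel. a i / 2 * (F x * h i x + F x * h i (- x))))"
      by (intro Bochner_Integration.integral_sum integrable_mult_right Bochner_Integration.integrable_add F(3) int)
    also have "\<dots> = (\<Sum>i<k. a i * (LINT x|lborel. F x * h i x))"
      by (intro sum.cong refl) (simp add: Bochner_Integration.integral_add[OF F(3) int] ref)
    finally show ?thesis .
  qed
  have g_meas: "g \<in> borel_measurable borel" unfolding g_def by measurable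
  have g_bound: "\<bar>g x\<bar> \<le> (\<Sum>i<k. \<bar>a i\<bar>)" for x
  proof -
    have "\<bar>g x\<bar> \<le> (\<Sum>i<k. \<bar>a i * ((h i x + h i (- x)) / 2)\<bar>)" unfolding g_def by (rule sum_abs)
    also have "\<dots> \<le> (\<Sum>i<k. \<bar>a i\<bar>)"
    proof (rule sum_mono)
      fix i
      have "\<bar>(h i x + h i (- x)) / 2\<bar> \<le> 1" using h_nonneg[of i x] h_nonneg[of i "- x"] h_le1[of i x] h_le1[of i "- x"] by simp
      from mult_left_mono[OF this abs_ge_zero[of "a i"]]
      show "\<bar>a i * ((h i x + h i (- x)) / 2)\<bar> \<le> \<bar>a i\<bar>" by (simp only: abs_mult mult_1_right)
    qed
    finally show ?thesis .
  qed
  have g_hom: "g (c *\<^sub>R x) = g x" if "c \<noteq> 0" for c x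
  proof (cases "0 < c")
    case True
    then have "h i (c *\<^sub>R x) = h i x" "h i (- (c *\<^sub>R x)) = h i (- x)" for i
      using radial_proj_scale[of c x] by (simp_all add: h_def radial_proj_minus)
    then show ?thesis by (simp add: g_def)
  next
    case False
    then have "0 < - c" using that by simp
    from radial_proj_scale[OF this, of x] have r: "radial_proj (- (c *\<^sub>R x)) = radial_proj x" by simp
    then have "radial_proj (c *\<^sub>R x) = - radial_proj x" by (simp add: radial_proj_minus) (metis minus_minus)
    then have "h i (c *\<^sub>R x) = h i (- x)" "h i (- (c *\<^sub>R x)) = h i x" for i
      using r by (simp_all add: h_def radial_proj_minus)
    then show ?thesis by (simp add: g_def add.commute)
  qed
  have proj_cont: "continuous_on (- {0}) (\<lambda>x. radial_proj x)"
    unfolding radial_proj_def by (intro continuous_intros continuous) (use pos in force)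
  have g_cont: "continuous_on (- {0}) g"
    unfolding g_def h_def radial_proj_minus
    by (intro continuous_intros continuous_on_compose2[OF \<phi>(1)] proj_cont) auto
  have [measurable]: "unit_body \<in> sets borel" by (intro borel_compact compact_unit)
  have ge1: "\<kappa> * body_integral (\<lambda>x. \<bar>x \<bullet> \<xi> t\<bar> powr p) \<le>
      body_integral (\<lambda>x. \<bar>x \<bullet> \<xi> t\<bar> powr p * g x)" if "t \<in> {0..1}" for t
  proof -
    have "(LINT x|lborel. (indicator unit_body x * \<bar>x \<bullet> \<xi> t\<bar> powr p) * g x) =
        (\<Sum>i<k. a i * (LINT x|lborel. (indicator unit_body x * \<bar>x \<bullet> \<xi> t\<bar> powr p) * h i x))"
      by (rule symm) (use int_T[OF \<xi>(2)] in \<open>auto simp: minus mult.assoc indicator_def\<close>)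
    then show ?thesis using \<kappa>(2)[OF that] by (simp add: T_def L.cosine_transform_def h0 mult.assoc)
  qed
  \<comment> \<open>Every \<open>v\<close> is a multiple, possibly negative, of some
    \<open>\<xi> t\<close> with \<open>t\<close> in [0,1], and both sides scale by
    \<open>\<bar>c\<bar> powr p\<close>.\<close>
  have ge: "\<kappa> * body_integral (\<lambda>x. \<bar>x \<bullet> v\<bar> powr p) \<le>
      body_integral (\<lambda>x. \<bar>x \<bullet> v\<bar> powr p * g x)" if v: "v \<noteq> 0" for v
  proof -
    obtain t c where t: "t \<in> {0..1}" "v = c *\<^sub>R \<xi> t" using \<xi>(3)[OF v] by blast
    have "body_integral (\<lambda>x. \<bar>x \<bullet> v\<bar> powr p * f x) =
       \<bar>c\<bar> powr p * body_integral (\<lambda>x. \<bar>x \<bullet> \<xi> t\<bar> powr p * f x)" for f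
      unfolding t(2) integral_mult_right_zero[symmetric]
      by (intro Bochner_Integration.integral_cong refl) (simp add: abs_mult powr_mult)
    from this[of g] this[of "\<lambda>_. 1"] ge1[OF t(1)] show ?thesis
      by (simp add: mult.left_commute[of \<kappa>] mult_left_mono)
  qed
  have lt: "body_integral (\<lambda>x. N x powr p * g x) < 0"
  proof -
    have "(LINT x|lborel. (indicator unit_body x * N x powr p) * g x) =
        (\<Sum>i<k. a i * (LINT x|lborel. (indicator unit_body x * N x powr p) * h i x))"
      by (rule symm) (use int_w in \<open>auto simp: minus mult.assoc indicator_def\<close>)
    then show ?thesis using \<kappa>(3) by (simp add: w_def mult.assoc)
  qed
  show ?thesis by (rule that[OF g_meas g_bound g_hom g_cont \<kappa>(1) ge lt])
qed

end

section \<open>Perturbation of the norm\<close>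

lemma powr_first_order:
  fixes \<alpha> \<delta> :: real
  assumes "0 < \<delta>"
  obtains r where "0 < r" "\<And>x. \<bar>x\<bar> < r \<Longrightarrow> \<bar>(1 + x) powr (- \<alpha>) - 1 + \<alpha> * x\<bar> \<le> \<delta> * \<bar>x\<bar>"
proof -
  have "((\<lambda>x. (1 + x) powr (- \<alpha>)) has_field_derivative (- \<alpha>)) (at 0)"
    by (auto intro!: derivative_eq_intros)
  then have "((\<lambda>x. (1 + x) powr (- \<alpha>)) has_derivative (\<lambda>h. h * (- \<alpha>))) (at 0)"
    by (simp only: has_field_derivative_def mult_commute_abs)
  then obtain r where "0 < r" "\<And>y. norm (y - 0) < r \<Longrightarrow>
      norm ((1 + y) powr (- \<alpha>) - (1 + 0) powr (- \<alpha>) - (y - 0) * (- \<alpha>)) \<le> \<delta> * norm (y - 0)"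
    unfolding has_derivative_at_alt using assms by blast
  then show ?thesis using that[of r] by (simp add: mult.commute)
qed

context strict_gauge
begin

text \<open>With \<open>M - t N\<close> close to \<open>- h N\<close>, the function
  \<open>N' = N + \<epsilon> (M - t N)\<close> equals \<open>N\<close> times a factor close to
  \<open>1 - \<epsilon> h\<close>, and it is a norm as soon as
  \<open>1 - \<epsilon> t \<ge> 0\<close>. The approximation, and hence \<open>t\<close>, is fixed
  before \<open>\<epsilon>\<close>. Two exponents are handled at once because volume and kernel
  integral scale with different powers but must be controlled for the same body.\<close>

lemma perturbed_gauge:
  fixes h :: "'a \<Rightarrow> real"
  assumes h: "\<And>x. \<bar>h x\<bar> \<le> B" "\<And>c x. c \<noteq> 0 \<Longrightarrow> h (c *\<^sub>R x) = h x" "continuous_on (- {0}) h"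
    and E: "0 < E" and ab: "0 < a" "0 < b"
  obtains N' \<epsilon> where "gauge_norm N'" "0 < \<epsilon>"
    "\<And>x \<alpha>. x \<noteq> 0 \<Longrightarrow> \<alpha> \<in> {a, b} \<Longrightarrow> \<bar>(N x / N' x) powr \<alpha> - (1 + \<alpha> * \<epsilon> * h x)\<bar> \<le> \<epsilon> * E"
proof -
  have B: "0 \<le> B" using h(1)[of 0] by linarith
  \<comment> \<open>The error budget \<open>\<epsilon> * E\<close> is halved: \<open>\<eta>\<close>
    bounds the error of approximating \<open>- h\<close>, and \<open>\<delta>\<close> below the
    remainder of the power function beyond first order.\<close>
  define \<eta> where "\<eta> = E / (2 * (a + b))"
  have \<eta>: "0 < \<eta>" using ab E by (simp add: \<eta>_def)
  have \<alpha>\<eta>: "\<alpha> * \<eta> \<le> E / 2" if "\<alpha> \<in> {a, b}" for \<alpha>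
    using that ab E by (auto simp: \<eta>_def field_simps)
  define f where "f x = - N x * h x" for x
  have "continuous_on {x. N x = 1} f"
    unfolding f_def by (intro continuous_intros continuous continuous_on_subset[OF h(3)]) auto
  moreover have "f (c *\<^sub>R x) = \<bar>c\<bar> * f x" for c x
    by (cases "c = 0") (auto simp: f_def scale h(2))
  ultimately obtain t M where tM: "0 \<le> t" "\<And>c x. M (c *\<^sub>R x) = \<bar>c\<bar> * M x" "\<And>x y. M (x + y) \<le> M x + M y"
    "\<And>x. \<bar>M x - t * N x - f x\<bar> \<le> \<eta> * N x"
    using approx_by_seminorm_difference[of f \<eta>] \<eta> by blast
  define G where "G = B + \<eta>"
  have G: "0 < G" using B \<eta> by (simp add: G_def)
  define \<delta> where "\<delta> = E / (2 * G)"
  have \<delta>: "0 < \<delta>" "\<delta> * G = E / 2" using E G by (simp_all add: \<delta>_def)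
  obtain ra where ra: "0 < ra" "\<And>x. \<bar>x\<bar> < ra \<Longrightarrow> \<bar>(1 + x) powr (- a) - 1 + a * x\<bar> \<le> \<delta> * \<bar>x\<bar>"
    using powr_first_order[OF \<delta>(1)] by blast
  obtain rb where rb: "0 < rb" "\<And>x. \<bar>x\<bar> < rb \<Longrightarrow> \<bar>(1 + x) powr (- b) - 1 + b * x\<bar> \<le> \<delta> * \<bar>x\<bar>"
    using powr_first_order[OF \<delta>(1)] by blast
  define r where "r = min (min ra rb) 1"
  have r: "0 < r" "r \<le> ra" "r \<le> rb" "r \<le> 1" using ra rb by (auto simp: r_def)
  \<comment> \<open>The first bound keeps \<open>\<epsilon> * \<gamma> x\<close> within the range of
    the first-order expansion, the second keeps the coefficient \<open>1 - \<epsilon> * t\<close> of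
    \<open>N\<close> nonnegative.\<close>
  define \<epsilon> where "\<epsilon> = min (r / (2 * G)) (1 / (t + 1))"
  have \<epsilon>: "0 < \<epsilon>" using r G tM(1) by (simp add: \<epsilon>_def)
  have \<epsilon>G: "\<epsilon> * G < r"
  proof -
    have "\<epsilon> * G \<le> r / (2 * G) * G" using G by (intro mult_right_mono) (auto simp: \<epsilon>_def)
    then show ?thesis using G r by simp
  qed
  have \<epsilon>t: "\<epsilon> * t \<le> 1"
  proof -
    have "\<epsilon> * t \<le> 1 / (t + 1) * t" using tM(1) by (intro mult_right_mono) (auto simp: \<epsilon>_def)
    also have "\<dots> \<le> 1" using tM(1) by (simp add: divide_le_eq)
    finally show ?thesis .
  qed
  define N' where "N' x = (1 - \<epsilon> * t) * N x + \<epsilon> * M x" for x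
  define \<gamma> where "\<gamma> x = (M x - t * N x) / N x" for x
  have \<gamma>: "\<bar>\<gamma> x + h x\<bar> \<le> \<eta>" "\<bar>\<gamma> x\<bar> \<le> G" "N' x = N x * (1 + \<epsilon> * \<gamma> x)" if "x \<noteq> 0" for x
  proof -
    have Nx: "0 < N x" by (rule pos[OF that])
    have "\<gamma> x + h x = (M x - t * N x - f x) / N x" using Nx by (simp add: \<gamma>_def f_def field_simps)
    then show 1: "\<bar>\<gamma> x + h x\<bar> \<le> \<eta>" using tM(4)[of x] Nx by (simp add: divide_le_eq)
    show "\<bar>\<gamma> x\<bar> \<le> G" using 1 h(1)[of x] by (simp add: G_def abs_le_iff)
    show "N' x = N x * (1 + \<epsilon> * \<gamma> x)" using Nx by (simp add: N'_def \<gamma>_def field_simps)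
  qed
  have small: "\<bar>\<epsilon> * \<gamma> x\<bar> < r" if "x \<noteq> 0" for x
  proof -
    have "\<bar>\<epsilon> * \<gamma> x\<bar> \<le> \<epsilon> * G" using \<gamma>(2)[OF that] \<epsilon> by (simp add: abs_mult mult_left_mono)
    then show ?thesis using \<epsilon>G by simp
  qed
  have "gauge_norm N'"
  proof
    show "0 < N' x" if "x \<noteq> 0" for x
      using pos[OF that] small[OF that] r unfolding \<gamma>(3)[OF that] by (intro mult_pos_pos) auto
    show "N' (c *\<^sub>R x) = \<bar>c\<bar> * N' x" for c x by (simp add: N'_def scale tM(2) algebra_simps)
    show "N' (x + y) \<le> N' x + N' y" for x y
    proof -
      have "(1 - \<epsilon> * t) * N (x + y) \<le> (1 - \<epsilon> * t) * (N x + N y)"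
        using \<epsilon>t by (intro mult_left_mono triangle) auto
      moreover have "\<epsilon> * M (x + y) \<le> \<epsilon> * (M x + M y)" using \<epsilon> by (intro mult_left_mono tM(3)) auto
      ultimately show ?thesis by (simp add: N'_def algebra_simps)
    qed
  qed
  moreover have "\<bar>(N x / N' x) powr \<alpha> - (1 + \<alpha> * \<epsilon> * h x)\<bar> \<le> \<epsilon> * E" if x: "x \<noteq> 0" and \<alpha>: "\<alpha> \<in> {a, b}" for x \<alpha>
  proof -
    have Nx: "0 < N x" by (rule pos[OF x])
    have p1: "0 < 1 + \<epsilon> * \<gamma> x" using small[OF x] r by (simp add: abs_less_iff)
    have "N x / N' x = 1 / (1 + \<epsilon> * \<gamma> x)" using Nx unfolding \<gamma>(3)[OF x] by simp
    then have u: "(N x / N' x) powr \<alpha> = (1 + \<epsilon> * \<gamma> x) powr (- \<alpha>)"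
      by (simp only: powr_divide powr_minus_divide powr_one_eq_one)
    have "\<bar>(1 + \<epsilon> * \<gamma> x) powr (- \<alpha>) - 1 + \<alpha> * (\<epsilon> * \<gamma> x)\<bar> \<le> \<delta> * \<bar>\<epsilon> * \<gamma> x\<bar>"
      using small[OF x] r \<alpha> ra(2)[of "\<epsilon> * \<gamma> x"] rb(2)[of "\<epsilon> * \<gamma> x"] by auto
    also have "\<dots> \<le> \<delta> * (\<epsilon> * G)"
      using \<gamma>(2)[OF x] \<epsilon> \<delta>(1) by (intro mult_left_mono) (auto simp: abs_mult)
    also have "\<dots> = \<epsilon> * (E / 2)" unfolding \<delta>(2)[symmetric] by (simp only: mult_ac)
    finally have 1: "\<bar>(1 + \<epsilon> * \<gamma> x) powr (- \<alpha>) - 1 + \<alpha> * (\<epsilon> * \<gamma> x)\<bar> \<le> \<epsilon> * (E / 2)" .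
    have \<alpha>0: "0 < \<alpha>" using \<alpha> ab by auto
    have "\<bar>\<alpha> * \<epsilon> * (\<gamma> x + h x)\<bar> = \<alpha> * \<epsilon> * \<bar>\<gamma> x + h x\<bar>" using \<alpha>0 \<epsilon> by (simp add: abs_mult)
    also have "\<dots> \<le> \<alpha> * \<epsilon> * \<eta>" using \<gamma>(1)[OF x] \<alpha>0 \<epsilon> by (intro mult_left_mono) auto
    also have "\<dots> = \<epsilon> * (\<alpha> * \<eta>)" by simp
    also have "\<dots> \<le> \<epsilon> * (E / 2)" using \<epsilon> \<alpha>\<eta>[OF \<alpha>] by (intro mult_left_mono) auto
    finally have 2: "\<bar>\<alpha> * \<epsilon> * (\<gamma> x + h x)\<bar> \<le> \<epsilon> * (E / 2)" .
    have "(N x / N' x) powr \<alpha> - (1 + \<alpha> * \<epsilon> * h x) =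
      ((1 + \<epsilon> * \<gamma> x) powr (- \<alpha>) - 1 + \<alpha> * (\<epsilon> * \<gamma> x)) - \<alpha> * \<epsilon> * (\<gamma> x + h x)"
      unfolding u by (simp add: algebra_simps)
    then have "\<bar>(N x / N' x) powr \<alpha> - (1 + \<alpha> * \<epsilon> * h x)\<bar> \<le>
      \<bar>(1 + \<epsilon> * \<gamma> x) powr (- \<alpha>) - 1 + \<alpha> * (\<epsilon> * \<gamma> x)\<bar> + \<bar>\<alpha> * \<epsilon> * (\<gamma> x + h x)\<bar>"
      by (simp only: abs_triangle_ineq4)
    also have "\<dots> \<le> \<epsilon> * (E / 2) + \<epsilon> * (E / 2)" using 1 2 by (rule add_mono)
    finally show ?thesis by (simp add: mult.commute)
  qed
  ultimately show ?thesis using that \<epsilon> by blast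
qed

end

section \<open>Volume and kernel integrals of a second body, written over the first\<close>

context gauge_norm
begin

text \<open>\<open>radial_integral\<close> with constant \<open>G\<close> and \<beta> = n + p. This
  \<beta> is chosen so that the weight \<open>N^p\<close> appears, making the first variation of the
  volume the very functional \<open>\<integral> N^p h\<close> that the separation controls.\<close>

lemma measure_gauge_body:
  assumes M: "gauge_norm M" and p: "- real DIM('a) < p"
  shows "measure lborel {x. M x \<le> 1} = (real DIM('a) + p) / real DIM('a) *
    body_integral (\<lambda>x. N x powr p * (N x / M x) powr real DIM('a))"
proof -
  interpret M: gauge_norm M by (rule M)
  let ?n = "real DIM('a)"
  have quot: "(N x / M x) powr \<alpha> = N x powr \<alpha> * M x powr - \<alpha>" for x \<alpha>
    by (simp only: powr_divide powr_minus_divide times_divide_eq_right mult_1_right)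
  have [measurable]: "unit_body \<in> sets borel" by (intro borel_compact compact_unit)
  have Mb: "{x. M x \<le> 1} \<in> sets borel" by (intro borel_compact M.compact_unit)
  have AE0: "AE x in lborel. x \<noteq> (0 :: 'a)" using AE_lborel_singleton[of 0] by simp
  have "emeasure lborel {x. M x \<le> 1} = (\<integral>\<^sup>+x. 1 * indicator {x. M x \<le> 1} x \<partial>lborel)"
    using Mb by simp
  also have "\<dots> = ennreal ((?n + p) / (?n + 0)) *
    (\<integral>\<^sup>+x. 1 * ennreal (N x powr (?n + p) * M x powr - (?n + 0)) * indicator unit_body x \<partial>lborel)"
    by (rule radial_integral) (use pos M.pos p in \<open>auto simp: scale M.scale\<close>)
  also have "(\<integral>\<^sup>+x. 1 * ennreal (N x powr (?n + p) * M x powr - (?n + 0)) * indicator unit_body x \<partial>lborel) =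
      (\<integral>\<^sup>+x. ennreal (indicator unit_body x * (N x powr p * (N x / M x) powr ?n)) \<partial>lborel)"
    by (rule nn_integral_cong_AE, use AE0 in eventually_elim)
      (auto simp: quot powr_add mult_ac split: split_indicator)
  finally have "measure lborel {x. M x \<le> 1} = (?n + p) / ?n *
      enn2real (\<integral>\<^sup>+x. ennreal (indicator unit_body x * (N x powr p * (N x / M x) powr ?n)) \<partial>lborel)"
    using p by (simp add: measure_def enn2real_mult)
  also have "enn2real (\<integral>\<^sup>+x. ennreal (indicator unit_body x * (N x powr p * (N x / M x) powr ?n)) \<partial>lborel) =
      body_integral (\<lambda>x. N x powr p * (N x / M x) powr ?n)"
    by (rule integral_eq_nn_integral[symmetric]) auto
  finally show ?thesis .
qed

text \<open>Here the kernel supplies the degree p, so with \<beta> = n + p the constant in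
  \<open>radial_integral\<close> is 1 and the powers of both norms combine into one
  quotient.\<close>

lemma kernel_integral_gauge_body:
  assumes M: "gauge_norm M" and p: "- real DIM('a) < p"
  shows "(LINT x|lborel. indicator {x. M x \<le> 1} x * \<bar>x \<bullet> v\<bar> powr p) =
    body_integral (\<lambda>x. \<bar>x \<bullet> v\<bar> powr p * (N x / M x) powr (real DIM('a) + p))"
proof -
  interpret M: gauge_norm M by (rule M)
  let ?n = "real DIM('a)"
  have quot: "(N x / M x) powr \<alpha> = N x powr \<alpha> * M x powr - \<alpha>" for x \<alpha>
    by (simp only: powr_divide powr_minus_divide times_divide_eq_right mult_1_right)
  have [measurable]: "unit_body \<in> sets borel" by (intro borel_compact compact_unit)
  have [measurable]: "{x. M x \<le> 1} \<in> sets borel" by (intro borel_compact M.compact_unit)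
  have AE0: "AE x in lborel. x \<noteq> (0 :: 'a)" using AE_lborel_singleton[of 0] by simp
  have "(LINT x|lborel. indicator {x. M x \<le> 1} x * \<bar>x \<bullet> v\<bar> powr p) =
      enn2real (\<integral>\<^sup>+x. ennreal (indicator {x. M x \<le> 1} x * \<bar>x \<bullet> v\<bar> powr p) \<partial>lborel)"
    by (rule integral_eq_nn_integral) auto
  also have "(\<integral>\<^sup>+x. ennreal (indicator {x. M x \<le> 1} x * \<bar>x \<bullet> v\<bar> powr p) \<partial>lborel) =
      (\<integral>\<^sup>+x. ennreal (\<bar>x \<bullet> v\<bar> powr p) * indicator {x. M x \<le> 1} x \<partial>lborel)"
    by (intro nn_integral_cong) (auto split: split_indicator)
  also have "\<dots> = ennreal ((?n + p) / (?n + p)) *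
    (\<integral>\<^sup>+x. ennreal (\<bar>x \<bullet> v\<bar> powr p) * ennreal (N x powr (?n + p) * M x powr - (?n + p)) * indicator unit_body x \<partial>lborel)"
    by (rule radial_integral) (use pos M.pos p in \<open>auto simp: scale M.scale abs_mult powr_mult ennreal_mult\<close>)
  also have "\<dots> = (\<integral>\<^sup>+x. ennreal (indicator unit_body x * (\<bar>x \<bullet> v\<bar> powr p * (N x / M x) powr (?n + p))) \<partial>lborel)"
  proof -
    have "ennreal ((?n + p) / (?n + p)) = 1" using p by simp
    moreover have "ennreal (\<bar>x \<bullet> v\<bar> powr p) * ennreal (N x powr (?n + p) * M x powr - (?n + p)) * indicator unit_body x =
        ennreal (indicator unit_body x * (\<bar>x \<bullet> v\<bar> powr p * (N x / M x) powr (?n + p)))" for x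
      unfolding quot by (cases "N x \<le> 1") (simp_all add: ennreal_mult)
    ultimately show ?thesis by (simp only: mult_1)
  qed
  also have "enn2real \<dots> = body_integral (\<lambda>x. \<bar>x \<bullet> v\<bar> powr p * (N x / M x) powr (?n + p))"
    by (rule integral_eq_nn_integral[symmetric]) auto
  finally show ?thesis .
qed

end

context gauge_norm
begin

lemma measure_unit_body_pos: "0 < measure lborel unit_body"
proof -
  obtain R where "bounded_borel unit_body R" by (rule unit_body_borel)
  then interpret L: bounded_borel unit_body R .
  have "emeasure lborel unit_body \<noteq> 0"
  proof
    assume "emeasure lborel unit_body = 0"
    then have "AE x in lborel. x \<notin> unit_body" using L.L by (intro AE_not_in) auto
    from AE_unit_body_exists[OF this] show False by blast
  qed
  then show ?thesis using L.emeasure_finite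
    by (simp add: measure_def enn2real_positive_iff zero_less_iff_neq_zero)
qed

lemma polar_centroid_functional_unit_body:
  "v \<noteq> 0 \<Longrightarrow> polar_centroid_functional p unit_body v =
    (body_integral (\<lambda>x. \<bar>x \<bullet> v\<bar> powr p) / measure lborel unit_body) powr (1 / p)"
  by (simp add: polar_centroid_functional_def set_lebesgue_integral_def)

end

context strict_gauge
begin

text \<open>The two strict gains of the separation, \<kappa> for the kernel integrals and
  \<open>A\<close> for the volume, are both of order \<open>\<epsilon>\<close>; the perturbation
  error is kept below each of them uniformly in \<open>v\<close>.\<close>

lemma smaller_body_with_larger_centroid_functional:
  assumes p: "-1 < p" "p \<noteq> 0" and not: "\<not> embeds_in_Lp p N"
  obtains M where "gauge_norm M" "measure lborel {x. M x \<le> 1} < measure lborel unit_body"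
    "\<And>v. v \<noteq> 0 \<Longrightarrow> polar_centroid_functional p unit_body v \<le> polar_centroid_functional p {x. M x \<le> 1} v"
proof -
  define n where "n = real DIM('a)"
  have n1: "1 \<le> n" using DIM_positive[where 'a='a] by (simp add: n_def Suc_le_eq)
  have n: "0 < n" "0 < n + p" "- n < p" using n1 p(1) by linarith+
  obtain h B \<kappa> where h: "h \<in> borel_measurable borel" "\<And>x. \<bar>h x\<bar> \<le> B" "\<And>c x. c \<noteq> 0 \<Longrightarrow> h (c *\<^sub>R x) = h x"
    "continuous_on (- {0}) h" and \<kappa>: "0 < \<kappa>"
    "\<And>v. v \<noteq> 0 \<Longrightarrow> \<kappa> * body_integral (\<lambda>x. \<bar>x \<bullet> v\<bar> powr p) \<le>
       body_integral (\<lambda>x. \<bar>x \<bullet> v\<bar> powr p * h x)"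
    and neg: "body_integral (\<lambda>x. N x powr p * h x) < 0"
    by (rule separation[OF p not]) (rule that)
  define A where "A = - body_integral (\<lambda>x. N x powr p * h x)"
  define W where "W = body_integral (\<lambda>x. N x powr p)"
  define T where "T v = body_integral (\<lambda>x. \<bar>x \<bullet> v\<bar> powr p)" for v
  have A: "0 < A" using neg by (simp add: A_def)
  have W: "0 \<le> W" unfolding W_def by (intro Bochner_Integration.integral_nonneg) auto
  have T: "0 < T v" if "v \<noteq> 0" for v unfolding T_def by (rule kernel_integral_pos[OF p(1) that])
  define w where "w = W + 1"
  have w: "0 < w" using W by (simp add: w_def)
  \<comment> \<open>The first bound lets the error use up at most half of the gain in the kernel
    integrals, the second at most half of the change of \<open>\<Phi>\<close>. Taking
    \<open>w = W + 1\<close> keeps the denominator positive.\<close>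
  define E where "E = min ((n + p) * \<kappa> / 2) (n * A / (2 * w))"
  have E: "0 < E" using n \<kappa>(1) A w by (simp add: E_def)
  have E\<kappa>: "E \<le> (n + p) * \<kappa> / 2" unfolding E_def by (rule min.cobounded1)
  have EW: "E * W < n * A"
  proof -
    have "E * W \<le> E * w" using E by (simp add: w_def)
    also have "\<dots> \<le> n * A / (2 * w) * w" using w by (intro mult_right_mono) (auto simp: E_def)
    also have "\<dots> < n * A" using w n A by simp
    finally show ?thesis .
  qed
  define \<sigma> where "\<sigma> = sgn p"
  have \<sigma>: "\<bar>\<sigma>\<bar> = 1" using p(2) by (simp add: \<sigma>_def abs_sgn_eq)
  obtain N' \<epsilon> where N': "gauge_norm N'" and \<epsilon>: "0 < \<epsilon>"
    and approx: "\<And>x \<alpha>. x \<noteq> 0 \<Longrightarrow> \<alpha> \<in> {n, n + p} \<Longrightarrow>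
      \<bar>(N x / N' x) powr \<alpha> - (1 + \<alpha> * \<epsilon> * (\<sigma> * h x))\<bar> \<le> \<epsilon> * E"
  proof (rule perturbed_gauge[of "\<lambda>x. \<sigma> * h x" B E n "n + p"])
    show "\<bar>\<sigma> * h x\<bar> \<le> B" for x using h(2) \<sigma> by (simp add: abs_mult)
    show "\<sigma> * h (c *\<^sub>R x) = \<sigma> * h x" if "c \<noteq> 0" for c x using h(3)[OF that] by simp
    show "continuous_on (- {0}) (\<lambda>x. \<sigma> * h x)" by (intro continuous_intros h(4))
  qed (use E n in auto)
  interpret N': gauge_norm N' by (rule N')
  define u where "u \<alpha> x = (N x / N' x) powr \<alpha>" for \<alpha> x
  have u_meas [measurable]: "u \<alpha> \<in> borel_measurable borel" for \<alpha> unfolding u_def by measurable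
  have u_bound: "\<bar>u \<alpha> x\<bar> \<le> 1 + \<alpha> * \<epsilon> * B + \<epsilon> * E" if \<alpha>: "\<alpha> \<in> {n, n + p}" for \<alpha> x
  proof -
    have \<alpha>0: "0 < \<alpha>" using \<alpha> n by auto
    have B: "0 \<le> B" using h(2)[of 0] by linarith
    show ?thesis
    proof (cases "x = 0")
      case True
      have "0 \<le> 1 + \<alpha> * \<epsilon> * B + \<epsilon> * E" using \<alpha>0 \<epsilon> B E by simp
      then show ?thesis using True by (simp add: u_def)
    next
      case False
      have "\<alpha> * \<epsilon> * (\<sigma> * h x) \<le> \<bar>\<alpha> * \<epsilon> * (\<sigma> * h x)\<bar>" by simp
      also have "\<dots> = \<alpha> * \<epsilon> * \<bar>h x\<bar>" using \<sigma> \<alpha>0 \<epsilon> by (simp add: abs_mult)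
      also have "\<dots> \<le> \<alpha> * \<epsilon> * B" using h(2)[of x] \<alpha>0 \<epsilon> by (intro mult_left_mono) auto
      finally have "u \<alpha> x \<le> 1 + \<alpha> * \<epsilon> * B + \<epsilon> * E"
        using approx[OF False \<alpha>] by (simp add: u_def abs_le_iff)
      moreover have "0 \<le> u \<alpha> x" by (simp add: u_def)
      ultimately show ?thesis by simp
    qed
  qed
  have AE0: "AE x in lborel. x \<noteq> (0 :: 'a)" using AE_lborel_singleton[of 0] by simp
  \<comment> \<open>The pointwise expansion integrated against a nonnegative weight. It is applied
    twice: to \<open>N^p\<close> with exponent \<open>n\<close>, and to the kernel with exponent
    \<open>n + p\<close>, both restricted to the body.\<close>
  have first_order: "\<bar>(LINT x|lborel. F x * u \<alpha> x) - ((LINT x|lborel. F x) + \<alpha> * \<epsilon> * \<sigma> * (LINT x|lborel. F x * h x))\<bar>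
      \<le> \<epsilon> * E * (LINT x|lborel. F x)"
    if \<alpha>: "\<alpha> \<in> {n, n + p}" and F0: "\<And>x. 0 \<le> F x"
      and F_int: "\<forall>g C. g \<in> borel_measurable borel \<longrightarrow> (\<forall>x. \<bar>g x\<bar> \<le> C) \<longrightarrow> integrable lborel (\<lambda>x. F x * g x)"
    for \<alpha> and F :: "'a \<Rightarrow> real"
  proof -
    have F: "integrable lborel (\<lambda>x. F x * g x)" if "g \<in> borel_measurable borel" "\<And>x. \<bar>g x\<bar> \<le> C" for g C
      using F_int that by blast
    have i1: "integrable lborel (\<lambda>x. F x * u \<alpha> x)" by (rule F[OF u_meas u_bound[OF \<alpha>]])
    have i2: "integrable lborel F" using F[of "\<lambda>_. 1" 1] by simp
    have i3: "integrable lborel (\<lambda>x. F x * h x)" by (rule F[OF h(1,2)])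
    have "(LINT x|lborel. F x * u \<alpha> x) - ((LINT x|lborel. F x) + \<alpha> * \<epsilon> * \<sigma> * (LINT x|lborel. F x * h x)) =
        (LINT x|lborel. F x * u \<alpha> x - (F x + \<alpha> * \<epsilon> * \<sigma> * (F x * h x)))"
      using i1 i2 i3 by simp
    also have "\<bar>\<dots>\<bar> \<le> (LINT x|lborel. \<bar>F x * u \<alpha> x - (F x + \<alpha> * \<epsilon> * \<sigma> * (F x * h x))\<bar>)"
      by (rule integral_abs_bound)
    also have "\<dots> \<le> (LINT x|lborel. \<epsilon> * E * F x)"
    proof (rule integral_mono_AE)
      show "AE x in lborel. \<bar>F x * u \<alpha> x - (F x + \<alpha> * \<epsilon> * \<sigma> * (F x * h x))\<bar> \<le> \<epsilon> * E * F x"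
        using AE0
      proof eventually_elim
        fix x :: 'a assume x: "x \<noteq> 0"
        have "F x * u \<alpha> x - (F x + \<alpha> * \<epsilon> * \<sigma> * (F x * h x)) = F x * (u \<alpha> x - (1 + \<alpha> * \<epsilon> * (\<sigma> * h x)))"
          by (simp add: algebra_simps)
        also have "\<bar>\<dots>\<bar> \<le> F x * (\<epsilon> * E)"
          using mult_left_mono[OF approx[OF x \<alpha>] F0[of x]] F0[of x] by (simp add: abs_mult u_def)
        finally show "\<bar>F x * u \<alpha> x - (F x + \<alpha> * \<epsilon> * \<sigma> * (F x * h x))\<bar> \<le> \<epsilon> * E * F x" by (simp add: mult_ac)
      qed
    qed (use i1 i2 i3 in auto)
    finally show ?thesis by simp
  qed
  define \<Phi> where "\<Phi> = body_integral (\<lambda>x. N x powr p * u n x)"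
  have vol: "\<bar>\<Phi> - (W - n * \<epsilon> * \<sigma> * A)\<bar> \<le> \<epsilon> * (E * W)"
  proof -
    have "\<forall>g C. g \<in> borel_measurable borel \<longrightarrow> (\<forall>x. \<bar>g x\<bar> \<le> C) \<longrightarrow>
        integrable lborel (\<lambda>x. (indicator unit_body x * N x powr p) * g x)"
      using integrable_gauge_powr[of p] n(3) unfolding n_def mult.assoc by blast
    from first_order[of n "\<lambda>x. indicator unit_body x * N x powr p", OF _ _ this]
    show ?thesis by (simp add: \<Phi>_def W_def A_def mult.assoc)
  qed
  define T' where "T' v = body_integral (\<lambda>x. \<bar>x \<bullet> v\<bar> powr p * u (n + p) x)" for v
  define H where "H v = body_integral (\<lambda>x. \<bar>x \<bullet> v\<bar> powr p * h x)" for v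
  have kern: "\<bar>T' v - (T v + (n + p) * \<epsilon> * \<sigma> * H v)\<bar> \<le> \<epsilon> * (E * T v)" if v: "v \<noteq> 0" for v
  proof -
    have "\<forall>g C. g \<in> borel_measurable borel \<longrightarrow> (\<forall>x. \<bar>g x\<bar> \<le> C) \<longrightarrow>
        integrable lborel (\<lambda>x. (indicator unit_body x * \<bar>x \<bullet> v\<bar> powr p) * g x)"
      using kernel_integrable[OF p(1) v] unfolding mult.assoc by blast
    from first_order[of "n + p" "\<lambda>x. indicator unit_body x * \<bar>x \<bullet> v\<bar> powr p", OF _ _ this]
    show ?thesis by (simp add: T'_def T_def H_def mult.assoc)
  qed
  \<comment> \<open>The first-order gain covers the error and leaves a fixed fraction of
    \<open>T v\<close>, the same for all directions. For p < 0 this surplus pays for the reduction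
    in volume.\<close>
  have gain: "\<epsilon> * (E * T v) + \<epsilon> * ((n + p) * \<kappa> / 2 * T v) \<le> (n + p) * \<epsilon> * H v" if v: "v \<noteq> 0" for v
  proof -
    have "E * T v + (n + p) * \<kappa> / 2 * T v \<le> (n + p) * \<kappa> / 2 * T v + (n + p) * \<kappa> / 2 * T v"
      using E\<kappa> T[OF v] by (intro add_right_mono mult_right_mono) auto
    also have "\<dots> = (n + p) * (\<kappa> * T v)" by (simp add: field_simps)
    also have "\<dots> \<le> (n + p) * H v" using \<kappa>(2)[OF v] n by (intro mult_left_mono) (auto simp: T_def H_def)
    finally have "\<epsilon> * (E * T v + (n + p) * \<kappa> / 2 * T v) \<le> \<epsilon> * ((n + p) * H v)" using \<epsilon> by (intro mult_left_mono) auto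
    then show ?thesis by (simp add: algebra_simps)
  qed
  have volW: "\<epsilon> * (E * W) < n * \<epsilon> * A" using EW \<epsilon> by (simp add: mult.left_commute[of n])
  define V where "V = measure lborel unit_body"
  have V: "0 < V" unfolding V_def by (rule measure_unit_body_pos)
  have V_W: "V = (n + p) / n * W"
  proof -
    have "body_integral (\<lambda>x. N x powr p * (N x / N x) powr n) = W"
      unfolding W_def using pos by (intro integral_cong_AE) (use AE0 in \<open>auto elim!: AE_mp\<close>)
    then show ?thesis using measure_gauge_body[OF gauge_norm_axioms, of p] n by (simp add: V_def n_def)
  qed
  show ?thesis
  proof (cases "0 < p")
    case True
    then have \<sigma>1: "\<sigma> = 1" by (simp add: \<sigma>_def)
    have "\<Phi> < W" using vol volW by (simp add: \<sigma>1 abs_le_iff)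
    then have less: "measure lborel {x. N' x \<le> 1} < V"
      using measure_gauge_body[OF N', of p] n unfolding V_W
      by (simp add: \<Phi>_def u_def n_def divide_strict_right_mono mult_strict_left_mono)
    have "polar_centroid_functional p unit_body v \<le> polar_centroid_functional p {x. N' x \<le> 1} v" if v: "v \<noteq> 0" for v
    proof -
      have "0 \<le> \<epsilon> * ((n + p) * \<kappa> / 2 * T v)" using \<epsilon> n \<kappa> T[OF v] by simp
      then have "T v \<le> T' v" using kern[OF v] gain[OF v] by (simp add: \<sigma>1 abs_le_iff)
      then have "T v / V \<le> T' v / measure lborel {x. N' x \<le> 1}"
        using T[OF v] less N'.measure_unit_body_pos by (intro frac_le) auto
      moreover have "T' v = (LINT x|lborel. indicator {x. N' x \<le> 1} x * \<bar>x \<bullet> v\<bar> powr p)"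
        using kernel_integral_gauge_body[OF N', of p v] n by (simp add: T'_def u_def n_def)
      ultimately show ?thesis
        using True T[OF v] V
        unfolding polar_centroid_functional_unit_body[OF v] N'.polar_centroid_functional_unit_body[OF v]
        by (intro powr_mono2) (auto simp: T_def V_def)
    qed
    with that[OF N'] less show ?thesis by (simp add: V_def)
  next
    case False
    then have p0: "p < 0" and \<sigma>1: "\<sigma> = -1" using p by (simp_all add: \<sigma>_def)
    have "W < \<Phi>" using vol volW by (simp add: \<sigma>1 abs_le_iff)
    then have "(n + p) / n * W < (n + p) / n * \<Phi>" using n by (intro mult_strict_left_mono) auto
    then have less: "V < (n + p) / n * \<Phi>" by (simp add: V_W)
    define \<rho> where "\<rho> = \<epsilon> * ((n + p) * \<kappa> / 2)"
    \<comment> \<open>Capped at 1/2 so that \<open>1 - \<delta>\<close>, which becomes the ratio of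
      the new volume to \<open>V\<close>, stays positive.\<close>
    define \<delta> where "\<delta> = min \<rho> (1/2)"
    have \<rho>: "0 < \<rho>" using \<epsilon> n \<kappa> by (simp add: \<rho>_def)
    have \<delta>: "0 < \<delta>" "\<delta> < 1" "\<delta> \<le> \<rho>" using \<rho> by (auto simp: \<delta>_def)
    have T'_le: "T' v \<le> (1 - \<delta>) * T v" if v: "v \<noteq> 0" for v
    proof -
      have "T' v \<le> T v - \<rho> * T v" using kern[OF v] gain[OF v] by (simp add: \<sigma>1 abs_le_iff \<rho>_def mult.assoc)
      also have "\<dots> \<le> T v - \<delta> * T v" using T[OF v] \<delta>(3) by (simp add: mult_right_mono)
      finally show ?thesis by (simp add: algebra_simps)
    qed
    define V' where "V' = (n + p) / n * \<Phi>"
    have V': "0 < V'" "V < V'" using less V by (simp_all add: V'_def)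
    \<comment> \<open>The dilation factor that brings the volume \<open>V'\<close> of the perturbed
      body down to \<open>(1 - \<delta>) * V\<close>. The kernel integral is multiplied by
      \<open>l powr (n + p) \<le> 1\<close> and is already at most
      \<open>(1 - \<delta>) * T v\<close>, so the average does not exceed
      \<open>T v / V\<close>.\<close>
    define l where "l = ((1 - \<delta>) * V / V') powr (1 / n)"
    have l0: "0 < l" using \<delta> V V' by (simp add: l_def)
    have ratio: "(1 - \<delta>) * V / V' \<le> 1"
      using V V' \<delta> by (simp add: divide_le_eq) (smt (verit) mult_left_le_one_le)
    have l1: "l \<le> 1" unfolding l_def using ratio n \<delta> V V' by (intro powr_le1) auto
    have ln: "l powr n = (1 - \<delta>) * V / V'" using n \<delta> V V' by (simp add: l_def powr_powr)
    define M where "M x = N' x / l" for x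
    have M: "gauge_norm M"
    proof
      show "M (x + y) \<le> M x + M y" for x y
        using N'.triangle[of x y] l0 by (simp add: M_def add_divide_distrib[symmetric] divide_right_mono)
    qed (use l0 N'.pos in \<open>auto simp: M_def N'.scale\<close>)
    interpret M: gauge_norm M by (rule M)
    have uM: "(N x / M x) powr \<alpha> = l powr \<alpha> * u \<alpha> x" for x \<alpha>
      using l0 by (simp add: M_def u_def powr_mult powr_divide)
    have "measure lborel {x. M x \<le> 1} = (n + p) / n * (LINT x|lborel. l powr n * (indicator unit_body x * (N x powr p * u n x)))"
      using measure_gauge_body[OF M, of p] n unfolding uM n_def[symmetric] by (simp add: mult_ac)
    also have "\<dots> = l powr n * V'" by (simp add: \<Phi>_def V'_def)
    also have "\<dots> = (1 - \<delta>) * V" using ln V' by simp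
    finally have vM: "measure lborel {x. M x \<le> 1} = (1 - \<delta>) * V" .
    have "polar_centroid_functional p unit_body v \<le> polar_centroid_functional p {x. M x \<le> 1} v" if v: "v \<noteq> 0" for v
    proof -
      have "(LINT x|lborel. indicator {x. M x \<le> 1} x * \<bar>x \<bullet> v\<bar> powr p) =
          (LINT x|lborel. l powr (n + p) * (indicator unit_body x * (\<bar>x \<bullet> v\<bar> powr p * u (n + p) x)))"
        using kernel_integral_gauge_body[OF M, of p v] n unfolding uM n_def[symmetric] by (simp add: mult_ac)
      also have "\<dots> = l powr (n + p) * T' v" by (simp add: T'_def)
      finally have TM: "(LINT x|lborel. indicator {x. M x \<le> 1} x * \<bar>x \<bullet> v\<bar> powr p) = l powr (n + p) * T' v" .
      have TM0: "0 < l powr (n + p) * T' v" using M.kernel_integral_pos[OF p(1) v] unfolding TM .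
      then have "0 < T' v" using l0 by (simp add: zero_less_mult_iff)
      then have "l powr (n + p) * T' v \<le> 1 * T' v"
        using l0 l1 n by (intro mult_right_mono powr_le1) auto
      also have "\<dots> \<le> (1 - \<delta>) * T v" using T'_le[OF v] by simp
      finally have "l powr (n + p) * T' v / ((1 - \<delta>) * V) \<le> (1 - \<delta>) * T v / ((1 - \<delta>) * V)"
        using \<delta> V by (intro divide_right_mono) auto
      also have "\<dots> = T v / V" using \<delta> by simp
      finally have "l powr (n + p) * T' v / ((1 - \<delta>) * V) \<le> T v / V" .
      moreover have "0 < l powr (n + p) * T' v / ((1 - \<delta>) * V)" using TM0 \<delta> V by simp
      ultimately show ?thesis
        using p0 unfolding polar_centroid_functional_unit_body[OF v] M.polar_centroid_functional_unit_body[OF v] TM vM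
        by (intro powr_mono2') (auto simp: T_def V_def)
    qed
    moreover have "measure lborel {x. M x \<le> 1} < measure lborel unit_body"
      unfolding vM using \<delta> V by (simp add: V_def)
    ultimately show ?thesis using that[OF M] by blast
  qed
qed

end

theorem theorem2p6:
  fixes p :: real and L :: "(real ^ 'n) set"
  assumes "- 1 < p" and "p < 1" and "p \<noteq> 0"
    and "convex_body L" and "origin_symmetric L" and "strictly_convex L"
    and "infinitely_smooth L"
    and "\<not> embeds_in_Lp p (minkowski_functional L)"
  shows "\<exists>K :: (real ^ 'n) set.
           convex_body K \<and> origin_symmetric K \<and>
           polar_centroid_body p K \<subseteq> polar_centroid_body p L \<and>
           measure lborel L > measure lborel K"
proof -
  interpret strict_gauge "minkowski_functional L"
    by (rule strict_gauge_minkowski_functional) (use assms in auto)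
  have L: "{x. minkowski_functional L x \<le> 1} = L"
    using assms by (intro minkowski_functional_le_1)
  obtain M where M: "gauge_norm M" "measure lborel {x. M x \<le> 1} < measure lborel L"
    "\<And>v. v \<noteq> 0 \<Longrightarrow> polar_centroid_functional p L v \<le> polar_centroid_functional p {x. M x \<le> 1} v"
    using smaller_body_with_larger_centroid_functional[OF assms(1,3,8)] unfolding L by blast
  have "polar_centroid_functional p L v \<le> polar_centroid_functional p {x. M x \<le> 1} v" for v
    using M(3)[of v] by (cases "v = 0") (auto simp: polar_centroid_functional_def)
  then have "polar_centroid_body p {x. M x \<le> 1} \<subseteq> polar_centroid_body p L"
    unfolding polar_centroid_body_def by (blast intro: order_trans)
  then show ?thesis
    using gauge_norm.convex_body_unit[OF M(1)] gauge_norm.origin_symmetric_unit[OF M(1)] M(2) by blast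
qed

end
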